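(* For fixed $t\in\mathbb{R}$, let $D_n(t)$ be the $n\times n$ Hankel determinant generated by the weight $w(x;t)=\mathrm{e}^{-x^4+tx^2}$ on $\mathbb{R}$. Then, as $n\to\infty$, \begin{align*} \ln D_n(t)=&\ \frac{n^2\ln n}{4}-\left(\frac{3}{8}+\frac{\ln 12}{4}\right)n^2+\frac{2n^{3/2}t}{3\sqrt{3}}+\left[\frac{t^2}{12}+\ln(2\pi)\right]n+\frac{n^{1/2}t^3}{36\sqrt{3}}-\frac{\ln n}{12}+\frac{t^4}{432}+\zeta'(-1)-\frac{\ln 2}{12}\\ &+\frac{t(t^4-120)}{2880\sqrt{3}\,n^{1/2}}-\frac{t^2}{288n}-\frac{t^3(t^4-168)}{290304\sqrt{3}\,n^{3/2}}+\frac{5t^4-267}{34560n^2}+O\big(n^{-5/2}\big), \end{align*} where $\zeta(\cdot)$ is the Riemann zeta function.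
   Context: For $t\in\mathbb{R}$ and $w(x;t)=\mathrm{e}^{-x^4+tx^2}$, $x\in\mathbb{R}$, the moments are $\mu_j(t)=\int_{-\infty}^{\infty}x^jw(x;t)\,dx$, and the Hankel determinant is $D_n(t)=\det\left(\mu_{j+k}(t)\right)_{j,k=0}^{n-1}$. The implied constant in the $O$-term may depend on $t$. *)

theory Defs
  imports
    "HOL-Analysis.Analysis"
    "HOL-Complex_Analysis.Complex_Analysis"
    "HOL-Library.Landau_Symbols"
    "Jordan_Normal_Form.Determinant"
begin

definition weight :: "real \<Rightarrow> real \<Rightarrow> real" where
  "weight x t = exp (- (x ^ 4) + t * x ^ 2)"

definition moment :: "nat \<Rightarrow> real \<Rightarrow> real" where
  "moment j t = (LINT x|lborel. x ^ j * weight x t)"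

definition hankel_det :: "nat \<Rightarrow> real \<Rightarrow> real" where
  "hankel_det n t = Determinant.det (Matrix.mat n n (\<lambda>(j, k). moment (j + k) t))"

definition is_riemann_zeta :: "(complex \<Rightarrow> complex) \<Rightarrow> bool" where
  "is_riemann_zeta f \<longleftrightarrow>
     f holomorphic_on (- {1}) \<and>
     (\<forall>s. Re s > 1 \<longrightarrow> (\<lambda>n. 1 / of_nat (Suc n) powr s) sums f s)"

(* The Riemann zeta function as the analytic continuation of its Dirichlet series. Only the
   value at the pole 1 is left open by the choice, see is_riemann_zeta_unique. *)
definition riemann_zeta :: "complex \<Rightarrow> complex" where
  "riemann_zeta = (SOME f. is_riemann_zeta f)"

lemma is_riemann_zeta_unique:
  assumes f: "is_riemann_zeta f" and g: "is_riemann_zeta g" and "s \<noteq> 1"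
  shows "f s = g s"
proof (rule analytic_continuation_open[of "{s. Re s > 1}" "- {1}" f g])
  show "open {s. Re s > 1}" by (rule open_halfspace_Re_gt)
  show "{s. Re s > 1} \<noteq> {}" by (auto intro!: exI[of _ "2 :: complex"])
  show "connected (- {1 :: complex})" by (rule connected_punctured_universe) simp
  show "f z = g z" if "z \<in> {s. Re s > 1}" for z
    using f g that unfolding is_riemann_zeta_def by (auto intro: sums_unique2)
qed (use assms in \<open>auto simp: is_riemann_zeta_def\<close>)

end

theory Submission
  imports
    Defs
    "HOL-Probability.Probability"
    "HOL-Real_Asymp.Real_Asymp"
begin

text \<open>Let \<open>r\<^sub>n(t)\<close> be the recurrence coefficients of the monic orthogonal polynomials for the weight.
  They satisfy the string equation \<open>4 r\<^sub>n (r\<^sub>n\<^sub>-\<^sub>1 + r\<^sub>n + r\<^sub>n\<^sub>+\<^sub>1) - 2 t r\<^sub>n = n\<close>, and an approximate solution with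
  small residual is relatively close to \<open>r\<^sub>n\<close>, because the relative error obeys a contraction. The bounds are
  uniform in \<open>t \<le> T\<close>. As \<open>r\<^sub>n\<close> is the exponential of the second difference of \<open>ln D\<^sub>n\<close> in \<open>n\<close>, this determines
  \<open>ln D\<^sub>n(t)\<close> up to \<open>c\<^sub>1(t) n + c\<^sub>0(t) + O(n\<^sup>-\<^sup>4)\<close>. The second derivative of \<open>ln D\<^sub>n\<close> in \<open>t\<close> is
  \<open>r\<^sub>n (r\<^sub>n\<^sub>-\<^sub>1 + r\<^sub>n\<^sub>+\<^sub>1)\<close> (Toda equation), which forces \<open>c\<^sub>0\<close> and \<open>c\<^sub>1\<close> to be affine in \<open>t\<close>. As \<open>t\<close> tends to \<open>-\<infinity>\<close>
  the determinant degenerates to the Gaussian one, a product of factorials, so \<open>c\<^sub>1 = 0\<close> and \<open>c\<^sub>0\<close> is the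
  constant \<open>\<zeta>'(-1)\<close> of the Barnes asymptotics.\<close>

section \<open>Moments and orthogonal polynomials\<close>

text \<open>A recurrence in \<open>n\<close> cannot see an affine function of \<open>n\<close>, so
  the linear and the constant term must come from the dependence on \<open>t\<close>. Integrating
  the Toda equation from minus infinity would need error bounds integrable over all negative
  \<open>t\<close>. Second differences in \<open>t\<close> with step 1 avoid this: they need the
  Toda error only on \<open>[t - 1, t + 1]\<close>, and they make \<open>c1\<close> and
  \<open>c0\<close> affine along the progression t, t - 1, t - 2, ... For fixed \<open>n\<close> the
  quantity c1 n + c0 stays bounded along it, because the bounds in \<open>n\<close> are uniform down
  to minus infinity, and this excludes a nonzero slope. The uniformity dictates the form of the
  estimates. The coefficients \<open>rcoeff\<close> tend to 0 as \<open>t\<close> tends to minus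
  infinity, so only relative errors can be controlled, and all corrections are polynomials in three
  quantities \<open>ww\<close>, \<open>ee\<close>, \<open>rho\<close> with bounds free of
  \<open>t\<close>. The contraction works while \<open>rho\<close> is not much larger than 1/12, its
  limit for fixed \<open>t\<close>; this restricts \<open>t\<close> from above only.\<close>

lemma weight_pos: "0 < weight x t"
  by (simp add: weight_def)

text \<open>Completing the square in \<open>x^2\<close>. The shift by 1/2 leaves exactly the
  standard Gaussian, whose absolute moments are known to be integrable.\<close>

lemma weight_le_gauss: "weight x t \<le> exp ((t + 1/2)^2 / 4) * exp (- (x^2) / 2)"
proof -
  have "0 \<le> (x^2 - (t + 1/2) / 2)^2" by simp
  also have "\<dots> = x^4 - (t + 1/2) * x^2 + (t + 1/2)^2 / 4"
    by (simp add: power2_eq_square power4_eq_xxxx field_simps)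
  finally have "- (x^4) + t * x^2 \<le> (t + 1/2)^2 / 4 - x^2 / 2"
    by (simp add: algebra_simps)
  then show ?thesis by (simp add: weight_def flip: exp_add)
qed

lemma measurable_weight [measurable]: "(\<lambda>x. weight x t) \<in> borel_measurable borel"
  unfolding weight_def by measurable

lemma integrable_moment: "integrable lborel (\<lambda>x. x ^ j * weight x t)"
proof (rule Bochner_Integration.integrable_bound)
  show "integrable lborel (\<lambda>x. (exp ((t + 1/2)^2 / 4) * sqrt (2 * pi)) * (std_normal_density x * \<bar>x\<bar> ^ j))"
    by (intro integrable_mult_right integrable_std_normal_moment_abs)
  have "\<bar>x\<bar> ^ j * weight x t \<le> \<bar>x\<bar> ^ j * (exp ((t + 1/2)^2 / 4) * exp (- (x^2) / 2))" for x
    by (intro mult_left_mono weight_le_gauss) auto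
  then show "AE x in lborel. norm (x ^ j * weight x t)
      \<le> norm ((exp ((t + 1/2)^2 / 4) * sqrt (2 * pi)) * (std_normal_density x * \<bar>x\<bar> ^ j))"
    using weight_pos[of _ t]
    by (intro AE_I2) (simp add: abs_mult power_abs std_normal_density_def abs_of_pos mult_ac)
qed simp

text \<open>These are the boundary terms of the integration by parts in \<open>wint_pderiv\<close>.
  The Gaussian is weakened to a multiple of exp(-|x|), and evenness of the weight transfers the
  limit to the other end.\<close>

lemma power_weight_at_infinity:
  "((\<lambda>x. x ^ j * weight x t) \<longlongrightarrow> 0) at_top" "((\<lambda>x. x ^ j * weight x t) \<longlongrightarrow> 0) at_bot"
proof -
  have lim: "((\<lambda>x::real. x ^ j * (exp ((t + 1/2)^2 / 4 + 1/2) * exp (- x))) \<longlongrightarrow> 0) at_top"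
  proof -
    have "((\<lambda>x::real. exp ((t + 1/2)^2 / 4 + 1/2) * (x ^ j / exp x)) \<longlongrightarrow> exp ((t + 1/2)^2 / 4 + 1/2) * 0) at_top"
      by (intro tendsto_mult tendsto_const tendsto_power_div_exp_0)
    then show ?thesis by (simp add: exp_minus field_simps)
  qed
  have bd: "weight x t \<le> exp ((t + 1/2)^2 / 4 + 1/2) * exp (- \<bar>x\<bar>)" for x
  proof -
    have "0 \<le> (\<bar>x\<bar> - 1)^2" by simp
    then have "- (x^2) / 2 \<le> 1/2 - \<bar>x\<bar>" by (simp add: power2_eq_square algebra_simps)
    then have "exp (- (x^2) / 2) \<le> exp (1/2 - \<bar>x\<bar>)" by simp
    then have "exp ((t + 1/2)^2 / 4) * exp (- (x^2) / 2) \<le> exp ((t + 1/2)^2 / 4) * exp (1/2 - \<bar>x\<bar>)"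
      by (intro mult_left_mono) auto
    with weight_le_gauss[of x t] have "weight x t \<le> exp ((t + 1/2)^2 / 4) * exp (1/2 - \<bar>x\<bar>)" by linarith
    then show ?thesis by (simp add: mult_exp_exp algebra_simps)
  qed
  show top: "((\<lambda>x. x ^ j * weight x t) \<longlongrightarrow> 0) at_top"
  proof (rule tendsto_sandwich[OF _ _ tendsto_const lim])
    show "\<forall>\<^sub>F x in at_top. 0 \<le> x ^ j * weight x t"
      using eventually_ge_at_top[of 0] by eventually_elim (simp add: less_imp_le[OF weight_pos])
    show "\<forall>\<^sub>F x in at_top. x ^ j * weight x t \<le> x ^ j * (exp ((t + 1/2)^2 / 4 + 1/2) * exp (- x))"
      using eventually_ge_at_top[of 0]
    proof eventually_elim
      case (elim x)
      then show ?case using bd[of x] by (intro mult_left_mono) auto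
    qed
  qed
  have "((\<lambda>x. (-1) ^ j * (x ^ j * weight x t)) \<longlongrightarrow> (-1) ^ j * 0) at_top"
    by (intro tendsto_mult tendsto_const top)
  moreover have "(- x) ^ j * weight (- x) t = (-1) ^ j * (x ^ j * weight x t)" for x
    by (simp add: weight_def power_minus[of x])
  ultimately have "((\<lambda>x. (- x) ^ j * weight (- x) t) \<longlongrightarrow> 0) at_top" by simp
  then show "((\<lambda>x. x ^ j * weight x t) \<longlongrightarrow> 0) at_bot"
    by (simp add: filterlim_at_bot_mirror)
qed

section \<open>The moment functional on polynomials\<close>

definition wint :: "real \<Rightarrow> real poly \<Rightarrow> real" where
  "wint t p = (LINT x|lborel. poly p x * weight x t)"

lemma integrable_poly_weight: "integrable lborel (\<lambda>x. poly p x * weight x t)"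
  unfolding poly_altdef sum_distrib_right mult.assoc
  by (intro Bochner_Integration.integrable_sum integrable_mult_right integrable_moment)

lemma wint_add: "wint t (p + q) = wint t p + wint t q"
  unfolding wint_def by (simp add: distrib_right integrable_poly_weight)

lemma wint_diff: "wint t (p - q) = wint t p - wint t q"
  unfolding wint_def by (simp add: left_diff_distrib integrable_poly_weight)

lemma wint_smult: "wint t (Polynomial.smult c p) = c * wint t p"
  unfolding wint_def by (simp add: mult.assoc)

lemma wint_0: "wint t 0 = 0"
  unfolding wint_def by simp

text \<open>A nonnegative integrand with integral 0 vanishes almost everywhere, but a nonzero
  polynomial has only finitely many roots. Positivity of the norms, and with it every later division
  and logarithm, rests on this.\<close>

lemma wint_square_pos:
  assumes "p \<noteq> 0" shows "wint t (p * p) > 0"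
proof -
  have nn: "0 \<le> poly (p * p) x * weight x t" for x
    using weight_pos[of x t] by (simp add: mult_nonneg_nonneg)
  have "wint t (p * p) \<noteq> 0"
  proof
    assume "wint t (p * p) = 0"
    then have "AE x in lborel. poly (p * p) x * weight x t = 0"
      unfolding wint_def
      using integral_nonneg_eq_0_iff_AE[OF integrable_poly_weight[of "p * p" t]] nn by auto
    then have ae: "AE x in lborel. poly p x = 0"
      by eventually_elim (use weight_pos in \<open>auto simp: less_le\<close>)
    have "{x. poly p x = 0} \<in> null_sets lborel"
      using poly_roots_finite[OF assms] by (intro finite_imp_null_set_lborel)
    then have "AE x in lborel. \<not> poly p x = 0"
      using AE_not_in by fastforce
    with ae have "AE x in (lborel::real measure). False" by eventually_elim auto
    then show False using AE_iff_null_sets[of "UNIV" "lborel::real measure"] by (auto simp: trivial_limit_def[symmetric] ae_filter_eq_bot_iff)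
  qed
  moreover have "wint t (p * p) \<ge> 0" unfolding wint_def by (rule Bochner_Integration.integral_nonneg) (rule nn)
  ultimately show ?thesis by simp
qed

lemma wint_odd:
  assumes "\<And>x. poly p (- x) = - poly p x" shows "wint t p = 0"
proof -
  have "wint t p = (LINT x|lborel. poly p (- x) * weight (- x) t)"
    unfolding wint_def using lborel_integral_real_affine[of "-1" "\<lambda>x. poly p x * weight x t" 0] by simp
  also have "\<dots> = - wint t p" unfolding wint_def using assms by (simp add: weight_def)
  finally show ?thesis by simp
qed

text \<open>Integration by parts: the multiplier 4 x^3 - 2 t x is minus the logarithmic derivative
  of the weight. This is the source of the string equation.\<close>

lemma wint_pderiv: "wint t (pderiv p) = wint t ([:0, -2 * t, 0, 4:] * p)"
proof -
  let ?F = "\<lambda>x. poly p x * weight x t"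
  let ?f = "\<lambda>x. poly (pderiv p - [:0, -2 * t, 0, 4:] * p) x * weight x t"
  have lim: "(?F \<longlongrightarrow> 0) at_top" "(?F \<longlongrightarrow> 0) at_bot"
    unfolding poly_altdef sum_distrib_right mult.assoc
    by (intro tendsto_null_sum tendsto_mult_right_zero power_weight_at_infinity)+
  have "(LBINT x=-\<infinity>..\<infinity>. ?f x) = 0 - 0"
  proof (rule interval_integral_FTC_integrable)
    fix x :: real
    have "(?F has_field_derivative ?f x) (at x)"
      unfolding weight_def
      by (auto intro!: derivative_eq_intros poly_DERIV simp: algebra_simps power2_eq_square power3_eq_cube)
    then show "(?F has_vector_derivative ?f x) (at x)"
      by (simp add: has_real_derivative_iff_has_vector_derivative)
    show "isCont ?f x" unfolding weight_def by (intro continuous_intros)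
  next
    show "set_integrable lborel (einterval (- \<infinity>) \<infinity>) ?f"
      using integrable_poly_weight[of "pderiv p - [:0, -2 * t, 0, 4:] * p" t]
      unfolding set_integrable_def einterval_def by simp
    show "((?F \<circ> real_of_ereal) \<longlongrightarrow> 0) (at_right (- \<infinity>))"
      using lim(2) by (simp add: at_bot_le_at_infinity ereal_tendsto_simps1)
    show "((?F \<circ> real_of_ereal) \<longlongrightarrow> 0) (at_left \<infinity>)"
      using lim(1) by (simp add: ereal_tendsto_simps1)
  qed simp
  then have "wint t (pderiv p - [:0, -2 * t, 0, 4:] * p) = 0"
    unfolding wint_def by (simp add: interval_lebesgue_integral_def set_lebesgue_integral_def)
  then show ?thesis by (simp only: wint_diff) 
qed

section \<open>Monic orthogonal polynomials and their three-term recurrence\<close>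

fun opoly :: "real \<Rightarrow> nat \<Rightarrow> real poly" where
  "opoly t 0 = 1"
| "opoly t (Suc 0) = [:0, 1:]"
| "opoly t (Suc (Suc n)) = [:0, 1:] * opoly t (Suc n)
     - Polynomial.smult (wint t (opoly t (Suc n) * opoly t (Suc n)) / wint t (opoly t n * opoly t n)) (opoly t n)"

definition onorm2 :: "real \<Rightarrow> nat \<Rightarrow> real" where
  "onorm2 t n = wint t (opoly t n * opoly t n)"

text \<open>The value 0 at \<open>n = 0\<close> annihilates the term with the truncated index
  \<open>n - 1\<close>, so the recurrence and the derivatives in \<open>t\<close> hold for all
  \<open>n\<close> without a case distinction.\<close>

definition rcoeff :: "real \<Rightarrow> nat \<Rightarrow> real" where
  "rcoeff t n = (if n = 0 then 0 else onorm2 t n / onorm2 t (n - 1))"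

lemma opoly_rec: "[:0, 1:] * opoly t n = opoly t (Suc n) + Polynomial.smult (rcoeff t n) (opoly t (n - 1))"
  by (cases n) (simp_all add: rcoeff_def onorm2_def)

declare opoly.simps(3) [simp del]

lemma opoly_Suc: "opoly t (Suc n) = [:0, 1:] * opoly t n - Polynomial.smult (rcoeff t n) (opoly t (n - 1))"
  by (simp only: opoly_rec add_diff_cancel_right')

lemma rcoeff_0 [simp]: "rcoeff t 0 = 0"
  by (simp add: rcoeff_def)

lemma opoly_degree_coeff: "degree (opoly t n) = n \<and> coeff (opoly t n) n = 1"
proof (induction n rule: less_induct)
  case (less n)
  show ?case
  proof (cases n)
    case 0 then show ?thesis by simp
  next
    case (Suc m)
    have IH: "degree (opoly t m) = m" "coeff (opoly t m) m = 1" using less[of m] Suc by auto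
    have d: "degree (opoly t (m - 1)) \<le> m" using less[of "m - 1"] Suc by auto
    have c: "coeff (opoly t (Suc m)) k = (if k = 0 then 0 else coeff (opoly t m) (k - 1))
               - rcoeff t m * coeff (opoly t (m - 1)) k" for k
      unfolding opoly_Suc[of t m] by (cases k) (simp_all add: coeff_pCons)
    have "coeff (opoly t (m - 1)) (Suc m) = 0" using d by (intro coeff_eq_0) auto
    then have 1: "coeff (opoly t (Suc m)) (Suc m) = 1" by (simp add: c IH)
    have "degree (opoly t (Suc m)) \<le> Suc m"
      using IH d by (intro degree_le) (auto simp: c coeff_eq_0)
    moreover have "degree (opoly t (Suc m)) \<ge> Suc m" using 1 by (intro le_degree) simp
    ultimately show ?thesis using 1 Suc by simp
  qed
qed

lemma degree_opoly [simp]: "degree (opoly t n) = n"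
  and coeff_opoly_self [simp]: "coeff (opoly t n) n = 1"
  using opoly_degree_coeff by auto

lemma opoly_nz [simp]: "opoly t n \<noteq> 0"
  using coeff_opoly_self[of t n] by fastforce

lemma onorm2_pos: "onorm2 t n > 0"
  unfolding onorm2_def by (rule wint_square_pos) simp

lemma rcoeff_pos: "n > 0 \<Longrightarrow> rcoeff t n > 0"
  by (simp add: rcoeff_def onorm2_pos)

lemma onorm2_Suc: "onorm2 t (Suc n) = rcoeff t (Suc n) * onorm2 t n"
  using onorm2_pos[of t n] by (simp add: rcoeff_def)

lemma opoly_parity: "poly (opoly t n) (- x) = (-1) ^ n * poly (opoly t n) x"
proof (induction n rule: less_induct)
  case (less n)
  show ?case
  proof (cases n)
    case 0 then show ?thesis by simp
  next
    case (Suc m)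
    have "poly (opoly t m) (- x) = (-1) ^ m * poly (opoly t m) x" using less[of m] Suc by simp
    moreover have "rcoeff t m * poly (opoly t (m - 1)) (- x) = - ((-1) ^ m) * (rcoeff t m * poly (opoly t (m - 1)) x)"
      using less[of "m - 1"] Suc by (cases m) (auto simp: rcoeff_def)
    ultimately show ?thesis unfolding Suc opoly_Suc[of t m] by (simp add: algebra_simps)
  qed
qed

abbreviation ip :: "real \<Rightarrow> real poly \<Rightarrow> real poly \<Rightarrow> real" where
  "ip t p q \<equiv> wint t (p * q)"

lemma ip_add_left: "ip t (p + p') q = ip t p q + ip t p' q"
  and ip_add_right: "ip t p (q + q') = ip t p q + ip t p q'"
  and ip_smult_left: "ip t (Polynomial.smult c p) q = c * ip t p q"
  and ip_smult_right: "ip t p (Polynomial.smult c q) = c * ip t p q"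
  by (simp_all only: distrib_left distrib_right wint_add wint_smult mult_smult_left mult_smult_right)

lemmas ip_linear = ip_add_left ip_add_right ip_smult_left ip_smult_right

lemma ip_commute: "ip t p q = ip t q p"
  by (simp only: mult.commute)

lemma ip_self: "ip t (opoly t n) (opoly t n) = onorm2 t n"
  by (simp add: onorm2_def)

text \<open>The polynomials are defined by their recurrence, so orthogonality has to be derived.
  Neighbouring polynomials have opposite parity, hence an odd product. For distant indices the
  factor \<open>x\<close> is moved from one polynomial to the other, and the recurrence reduces the
  claim to smaller indices.\<close>

lemma opoly_orth_aux: "m \<le> n \<Longrightarrow> k \<le> n \<Longrightarrow> m \<noteq> k \<Longrightarrow> ip t (opoly t m) (opoly t k) = 0"
proof (induction n arbitrary: m k)
  case 0 then show ?case by simp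
next
  case (Suc n)
  have main: "ip t (opoly t m) (opoly t (Suc n)) = 0" if m: "m \<le> n" for m
  proof (cases "m = n")
    case True
    have "poly (opoly t m * opoly t (Suc n)) (- x) = - poly (opoly t m * opoly t (Suc n)) x" for x
      unfolding True by (simp add: opoly_parity power_add[symmetric])
    then show ?thesis by (rule wint_odd)
  next
    case False
    then have mn: "m < n" using m by simp
    have "ip t (opoly t m) (opoly t (Suc n)) + rcoeff t n * ip t (opoly t m) (opoly t (n - 1))
        = ip t (opoly t m) ([:0, 1:] * opoly t n)"
      unfolding opoly_rec ip_linear ..
    also have "\<dots> = ip t ([:0, 1:] * opoly t m) (opoly t n)"
      by (simp only: mult_ac)
    also have "\<dots> = ip t (opoly t (Suc m)) (opoly t n) + rcoeff t m * ip t (opoly t (m - 1)) (opoly t n)"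
      unfolding opoly_rec ip_linear ..
    also have "ip t (opoly t (m - 1)) (opoly t n) = 0" using mn by (intro Suc.IH) auto
    finally have e: "ip t (opoly t m) (opoly t (Suc n)) + rcoeff t n * ip t (opoly t m) (opoly t (n - 1))
       = ip t (opoly t (Suc m)) (opoly t n)" by simp
    show ?thesis
    proof (cases "Suc m = n")
      case True
      then have "m = n - 1" "n > 0" by auto
      \<comment> \<open>Here two terms survive; they cancel because \<open>rcoeff\<close> is the
        ratio of these norms.\<close>
      then have "rcoeff t n * onorm2 t (n - 1) = onorm2 t n"
        using onorm2_Suc[of t m] True by simp
      then show ?thesis using e True \<open>m = n - 1\<close> by (simp add: ip_self del: mult_pCons_left mult_pCons_right)
    next
      case False
      have "ip t (opoly t m) (opoly t (n - 1)) = 0" using mn False by (intro Suc.IH) auto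
      moreover have "ip t (opoly t (Suc m)) (opoly t n) = 0" using mn False by (intro Suc.IH) auto
      ultimately show ?thesis using e by simp
    qed
  qed
  show ?case
  proof (cases "m = Suc n")
    case True
    then show ?thesis using Suc.prems main[of k] ip_commute[of t "opoly t m" "opoly t k"] by simp
  next
    case m: False
    show ?thesis
    proof (cases "k = Suc n")
      case True then show ?thesis using Suc.prems main[of m] m by simp
    next
      case False then show ?thesis using Suc m by (intro Suc.IH) auto
    qed
  qed
qed

lemma opoly_orth: "m \<noteq> n \<Longrightarrow> ip t (opoly t m) (opoly t n) = 0"
  using opoly_orth_aux[of m "max m n" n t] by simp

lemma opoly_orth_lower: "degree q < n \<Longrightarrow> ip t q (opoly t n) = 0"
proof (induction "degree q" arbitrary: q rule: less_induct)
  case less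
  define d where "d = degree q"
  define q' where "q' = q - Polynomial.smult (coeff q d) (opoly t d)"
  have q: "q = q' + Polynomial.smult (coeff q d) (opoly t d)" by (simp add: q'_def)
  have 0: "ip t (opoly t d) (opoly t n) = 0" using less by (intro opoly_orth) (simp add: d_def)
  have "ip t q' (opoly t n) = 0"
  proof (cases "q' = 0")
    case True then show ?thesis by (simp add: wint_0)
  next
    case False
    have "degree q' \<le> d" unfolding q'_def by (intro degree_diff_le) (auto simp: d_def degree_smult_le)
    moreover have "coeff q' d = 0" by (simp add: q'_def)
    ultimately have "degree q' < d" using False by (metis eq_zero_or_degree_less)
    then show ?thesis using less unfolding d_def by (intro less.hyps) auto
  qed
  then show ?case by (subst q) (simp only: ip_linear 0 mult_zero_right add_0_right)
qed

lemma ip_x_left: "ip t ([:0, 1:] * opoly t n) q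
    = ip t (opoly t (Suc n)) q + rcoeff t n * ip t (opoly t (n - 1)) q"
  unfolding opoly_rec ip_linear ..

lemma ip_opoly: "ip t (opoly t m) (opoly t n) = (if m = n then onorm2 t n else 0)"
  by (simp add: opoly_orth ip_self)

text \<open>The integral of the derivative of P_n P_{n-1} against the weight is computed twice.
  Directly, P_n' equals n P_{n-1} up to lower degree, and P_{n-1}' is orthogonal to P_n. By parts,
  the factor 4 x^3 - 2 t x is distributed over the two polynomials and expanded by the
  recurrence.\<close>

lemma string_equation:
  assumes "n > 0"
  shows "4 * rcoeff t n * (rcoeff t (n - 1) + rcoeff t n + rcoeff t (n + 1) - t / 2) = real n"
proof -
  obtain m where n: "n = Suc m" using assms by (cases n) auto
  let ?P = "opoly t"
  let ?x = "[:0, 1:] :: real poly"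
  have x: "ip t (?x * ?P m) (?x * ?x * ?P n) = rcoeff t (n + 1) * onorm2 t n + rcoeff t n * onorm2 t n + rcoeff t (n - 1) * onorm2 t n"
  proof -
    have "ip t (?x * ?P m) (?x * ?x * ?P n)
        = ip t (?x * ?P m) (?x * ?P (Suc n)) + rcoeff t n * ip t (?x * ?P m) (?x * ?P m)"
      using ip_linear opoly_rec[of t n] n by (simp only: mult.assoc distrib_left diff_Suc_1 mult_smult_right wint_add wint_smult)
    moreover have "ip t (?x * ?P m) (?x * ?P (Suc n)) = rcoeff t (n + 1) * onorm2 t n"
      unfolding opoly_rec ip_linear ip_opoly using n by auto
    moreover have "ip t (?x * ?P m) (?x * ?P m) = onorm2 t n + rcoeff t m * (rcoeff t m * onorm2 t (m - 1))"
      unfolding opoly_rec ip_linear ip_opoly using n by auto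
    moreover have "rcoeff t m * onorm2 t (m - 1) = (if m = 0 then 0 else onorm2 t m)"
      using onorm2_pos[of t "m - 1"] by (simp add: rcoeff_def)
    moreover have "rcoeff t n * onorm2 t m = onorm2 t n" using onorm2_Suc[of t m] n by simp
    moreover have "rcoeff t n * (onorm2 t n + rcoeff t m * onorm2 t m)
        = rcoeff t n * onorm2 t n + rcoeff t m * (rcoeff t n * onorm2 t m)"
      by (simp add: algebra_simps)
    ultimately show ?thesis using n by (cases "m = 0") simp_all
  qed
  have "ip t (?P n) (pderiv (?P m)) = 0"
  proof (cases "m = 0")
    case True then show ?thesis by (simp add: wint_0)
  next
    case False
    then show ?thesis using n by (subst ip_commute, intro opoly_orth_lower) (simp add: degree_pderiv)
  qed
  moreover have "ip t (pderiv (?P n)) (?P m) = real n * onorm2 t m"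
  proof -
    define q where "q = pderiv (?P n) - Polynomial.smult (real n) (?P m)"
    have "degree q \<le> m" unfolding q_def
      by (intro degree_diff_le) (auto simp: degree_pderiv n intro: order.trans[OF degree_smult_le])
    moreover have "coeff q m = 0" by (simp add: q_def coeff_pderiv n)
    ultimately have "q = 0 \<or> degree q < m" by (metis eq_zero_or_degree_less)
    then have "ip t q (?P m) = 0" using opoly_orth_lower[of q m t] by (auto simp: wint_0)
    moreover have "pderiv (?P n) = q + Polynomial.smult (real n) (?P m)" by (simp add: q_def)
    ultimately show ?thesis by (simp only: ip_linear ip_self)
  qed
  ultimately have "wint t (pderiv (?P n * ?P m)) = real n * onorm2 t m"
    by (simp only: pderiv_mult wint_add mult.commute[of "?P m"])
  moreover have "wint t (pderiv (?P n * ?P m))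
      = 4 * ip t (?x * ?P m) (?x * ?x * ?P n) - 2 * t * ip t (?x * ?P m) (?P n)"
  proof -
    have "[:0, -2 * t, 0, 4:] * (?P n * ?P m)
       = Polynomial.smult 4 ((?x * ?P m) * (?x * ?x * ?P n)) + Polynomial.smult (- 2 * t) ((?x * ?P m) * ?P n)"
      by (simp add: algebra_simps)
    then show ?thesis unfolding wint_pderiv by (simp only: wint_add wint_smult)
  qed
  moreover have "ip t (?x * ?P m) (?P n) = onorm2 t n"
    unfolding ip_x_left ip_opoly using n by auto
  ultimately have "real n * onorm2 t m
     = (4 * (rcoeff t (n + 1) + rcoeff t n + rcoeff t (n - 1)) - 2 * t) * onorm2 t n"
    using x by (simp add: algebra_simps)
  moreover have "onorm2 t n = rcoeff t n * onorm2 t m" using onorm2_Suc[of t m] n by simp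
  ultimately have "real n * onorm2 t m
     = (4 * rcoeff t n * (rcoeff t (n - 1) + rcoeff t n + rcoeff t (n + 1) - t / 2)) * onorm2 t m"
    by (simp add: algebra_simps)
  then show ?thesis using onorm2_pos[of t m] by simp
qed

section \<open>Hankel determinants and their logarithmic derivatives\<close>

text \<open>The monomial factor covers three uses: inner products (\<open>k = 0\<close>),
  orthogonality to x^i, and the factor x^2 that differentiation in \<open>t\<close> brings out of
  the weight.\<close>

lemma wint_monom_mult:
  assumes "degree p \<le> m" "degree q \<le> n"
  shows "wint t (Polynomial.monom 1 k * (p * q))
    = (\<Sum>i\<le>m. \<Sum>j\<le>n. coeff p i * coeff q j * moment (i + j + k) t)"
proof -
  have e: "poly r x = (\<Sum>i\<le>l. coeff r i * x ^ i)" if "degree r \<le> l" for r :: "real poly" and l x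
    unfolding poly_altdef by (rule sum.mono_neutral_left) (use that in \<open>auto simp: coeff_eq_0\<close>)
  have "poly (Polynomial.monom 1 k * (p * q)) x * weight x t
     = (\<Sum>i\<le>m. \<Sum>j\<le>n. coeff p i * coeff q j * (x ^ (i + j + k) * weight x t))" for x
    by (simp add: e[OF assms(1)] e[OF assms(2)] poly_monom sum_product sum_distrib_left sum_distrib_right
         power_add mult_ac) (subst sum.swap, simp add: mult_ac)
  then show ?thesis
    unfolding wint_def moment_def by (simp add: integrable_moment)
qed

lemma ip_moments:
  assumes "degree p \<le> m" "degree q \<le> n"
  shows "ip t p q = (\<Sum>i\<le>m. \<Sum>j\<le>n. coeff p i * coeff q j * moment (i + j) t)"
  using wint_monom_mult[OF assms, of t 0] by simp

text \<open>The coefficient matrix of the monic orthogonal polynomials is unitriangular, and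
  congruence with it turns the Hankel matrix into their Gram matrix, which is diagonal.\<close>

lemma hankel_det_prod: "hankel_det n t = (\<Prod>j<n. onorm2 t j)"
proof -
  define A where "A = Matrix.mat n n (\<lambda>(i, k). coeff (opoly t i) k)"
  define H where "H = Matrix.mat n n (\<lambda>(j, k). moment (j + k) t)"
  have A: "A \<in> carrier_mat n n" and H: "H \<in> carrier_mat n n" by (auto simp: A_def H_def)
  have entry: "(A * H * transpose_mat A) $$ (i, j) = ip t (opoly t i) (opoly t j)" if "i < n" "j < n" for i j
  proof -
    have "ip t (opoly t i) (opoly t j)
        = (\<Sum>k\<le>n - 1. \<Sum>l\<le>n - 1. coeff (opoly t i) k * coeff (opoly t j) l * moment (k + l) t)"
      using that by (intro ip_moments) auto
    also have "{..n - 1} = {0..<n}" using that by auto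
    finally show ?thesis using that A H
      by (simp add: scalar_prod_def A_def H_def sum_distrib_right mult_ac)
         (subst sum.swap, simp add: sum_distrib_left mult_ac)
  qed
  have diag: "diag_mat B = map (\<lambda>i. B $$ (i, i)) [0..<n]" if "B \<in> carrier_mat n n" for B :: "real mat"
    using that by (simp add: diag_mat_def)
  have "Determinant.det A = prod_list (diag_mat A)"
    by (rule det_lower_triangular[OF _ A]) (auto simp: A_def coeff_eq_0)
  also have "\<dots> = 1"
    unfolding diag[OF A] by (simp add: A_def prod.distinct_set_conv_list[symmetric] cong: map_cong)
  finally have detA: "Determinant.det A = 1" .
  let ?B = "A * H * transpose_mat A"
  have B: "?B \<in> carrier_mat n n" using A H by auto
  have "Determinant.det ?B = prod_list (diag_mat ?B)"
    by (rule det_lower_triangular[OF _ B]) (simp add: entry ip_opoly del: index_mult_mat)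
  also have "diag_mat ?B = map (\<lambda>i. onorm2 t i) [0..<n]"
    unfolding diag[OF B] by (intro map_cong refl) (simp add: entry ip_opoly del: index_mult_mat)
  also have "prod_list \<dots> = (\<Prod>j<n. onorm2 t j)"
    by (simp add: prod.distinct_set_conv_list[symmetric] atLeast0LessThan)
  finally have "Determinant.det ?B = (\<Prod>j<n. onorm2 t j)" .
  moreover have "Determinant.det ?B = Determinant.det H"
    using A H detA by (simp add: Determinant.det_mult[of _ n] Determinant.det_transpose[of _ n])
  ultimately show ?thesis by (simp add: hankel_det_def H_def)
qed

section \<open>Differentiation with respect to \<open>t\<close>\<close>

lemma exp_taylor2_bound: "\<bar>exp y - 1 - y\<bar> \<le> y^2 * exp \<bar>y :: real\<bar>"
proof -
  have l: "1 + y \<le> exp y" "1 + (- y) \<le> exp (- y)" by (rule exp_ge_add_one_self)+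
  have "exp y * (1 - y) \<le> exp y * exp (- y)" using l by (intro mult_left_mono) auto
  then have u: "exp y - 1 - y \<le> y * (exp y - 1)" by (simp add: exp_minus algebra_simps)
  also have "\<dots> \<le> y^2 * exp \<bar>y\<bar>"
  proof (cases "y \<ge> 0")
    case True
    have "exp y - 1 \<le> y * exp y" using \<open>exp y * (1 - y) \<le> exp y * exp (- y)\<close>
      by (simp add: exp_minus algebra_simps)
    then have "y * (exp y - 1) \<le> y * (y * exp y)" using True by (rule mult_left_mono)
    then show ?thesis using True by (simp add: power2_eq_square mult.assoc)
  next
    case False
    then have "(- y) * (1 - exp y) \<le> (- y) * (- y)" using l(1) by (intro mult_left_mono) linarith+
    moreover have "y^2 * 1 \<le> y^2 * exp \<bar>y\<bar>" by (intro mult_left_mono) auto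
    ultimately show ?thesis by (simp add: power2_eq_square algebra_simps)
  qed
  finally have "exp y - 1 - y \<le> y^2 * exp \<bar>y\<bar>" .
  moreover have "0 \<le> exp y - 1 - y" using l(1) by linarith
  ultimately show ?thesis by (simp only: abs_of_nonneg)
qed

lemma has_real_derivative_quadratic_bound:
  fixes f :: "real \<Rightarrow> real"
  assumes "\<And>s. \<bar>s - t\<bar> \<le> 1 \<Longrightarrow> \<bar>f s - f t - (s - t) * D\<bar> \<le> K * (s - t)^2"
  shows "(f has_real_derivative D) (at t)"
  unfolding has_field_derivative_iff
proof (rule LIM_zero_cancel, rule Lim_null_comparison)
  show "\<forall>\<^sub>F s in at t. norm ((f s - f t) / (s - t) - D) \<le> K * \<bar>s - t\<bar>"
    unfolding eventually_at
  proof (intro exI[of _ 1] conjI ballI impI)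
    fix s assume "s \<noteq> t \<and> dist s t < 1"
    then have s: "s \<noteq> t" "\<bar>s - t\<bar> \<le> 1" by (auto simp: dist_real_def)
    have "norm ((f s - f t) / (s - t) - D) = \<bar>f s - f t - (s - t) * D\<bar> / \<bar>s - t\<bar>"
      using s by (simp add: field_simps flip: abs_divide)
    also have "\<dots> \<le> K * (s - t)^2 / \<bar>s - t\<bar>"
      by (intro divide_right_mono assms s) auto
    also have "\<dots> = K * \<bar>s - t\<bar>"
      using s by (simp add: power2_eq_square field_simps flip: abs_mult)
    finally show "norm ((f s - f t) / (s - t) - D) \<le> K * \<bar>s - t\<bar>" .
  qed simp
  have "((\<lambda>s. K * \<bar>s - t\<bar>) \<longlongrightarrow> K * \<bar>t - t\<bar>) (at t)" by (intro tendsto_intros)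
  then show "((\<lambda>s. K * \<bar>s - t\<bar>) \<longlongrightarrow> 0) (at t)" by simp
qed

text \<open>Differentiation under the integral with an explicit majorant: for |s - t| at most 1, the
  exponential in the Taylor remainder is at most exp(x^2), which merely shifts the weight from
  \<open>t\<close> to \<open>t + 1\<close>, where all moments are still finite.\<close>

lemma moment_deriv: "(moment j has_real_derivative moment (j + 2) t) (at t)"
proof (rule has_real_derivative_quadratic_bound)
  fix s assume s: "\<bar>s - t\<bar> \<le> 1"
  have pw: "\<bar>x ^ j * weight x s - x ^ j * weight x t - (s - t) * (x ^ (j + 2) * weight x t)\<bar>
       \<le> \<bar>x ^ (j + 4) * weight x (t + 1)\<bar> * (s - t)^2" for x
  proof -
    define y where "y = (s - t) * x^2"
    have ws: "weight x s = weight x t * exp y"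
      by (simp add: weight_def y_def algebra_simps flip: exp_add)
    have w1: "weight x (t + 1) = weight x t * exp (x^2)"
      by (simp add: weight_def algebra_simps flip: exp_add)
    have "x ^ j * weight x s - x ^ j * weight x t - (s - t) * (x ^ (j + 2) * weight x t)
        = x ^ j * (weight x t * (exp y - 1 - y))"
      unfolding ws by (simp add: y_def power_add power2_eq_square algebra_simps)
    then have "\<bar>x ^ j * weight x s - x ^ j * weight x t - (s - t) * (x ^ (j + 2) * weight x t)\<bar>
        = \<bar>x\<bar> ^ j * (weight x t * \<bar>exp y - 1 - y\<bar>)"
      using weight_pos[of x t] by (simp only: abs_mult power_abs abs_of_pos)
    also have "\<dots> \<le> \<bar>x\<bar> ^ j * (weight x t * (y^2 * exp (x^2)))"
    proof -
      have "\<bar>y\<bar> \<le> 1 * x^2" unfolding y_def abs_mult using s by (intro mult_mono) auto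
      then have "y^2 * exp \<bar>y\<bar> \<le> y^2 * exp (x^2)" by (intro mult_left_mono) auto
      with exp_taylor2_bound[of y] show ?thesis
        using weight_pos[of x t] by (intro mult_left_mono) auto
    qed
    also have "\<dots> = \<bar>x ^ (j + 4) * weight x (t + 1)\<bar> * (s - t)^2"
      using weight_pos[of x t]
      by (simp add: w1 y_def abs_mult power_add power_abs power_mult_distrib power4_eq_xxxx power2_eq_square)
    finally show ?thesis .
  qed
  have "\<bar>moment j s - moment j t - (s - t) * moment (j + 2) t\<bar>
     = \<bar>LINT x|lborel. x ^ j * weight x s - x ^ j * weight x t - (s - t) * (x ^ (j + 2) * weight x t)\<bar>"
    unfolding moment_def by (subst Bochner_Integration.integral_diff | intro Bochner_Integration.integrable_diff integrable_mult_right integrable_moment | simp)+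
  also have "\<dots> \<le> (LINT x|lborel. \<bar>x ^ j * weight x s - x ^ j * weight x t - (s - t) * (x ^ (j + 2) * weight x t)\<bar>)"
    by (rule integral_abs_bound)
  also have "\<dots> \<le> (LINT x|lborel. \<bar>x ^ (j + 4) * weight x (t + 1)\<bar> * (s - t)^2)"
    by (intro integral_mono pw integrable_abs integrable_mult_left Bochner_Integration.integrable_diff integrable_mult_right integrable_moment)
  finally show "\<bar>moment j s - moment j t - (s - t) * moment (j + 2) t\<bar>
     \<le> (LINT x|lborel. \<bar>x ^ (j + 4) * weight x (t + 1)\<bar>) * (s - t)^2"
    by simp
qed

lemma onorm2_moments:
  "onorm2 t n = (\<Sum>i\<le>n. \<Sum>j\<le>n. coeff (opoly t n) i * coeff (opoly t n) j * moment (i + j) t)"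
  unfolding onorm2_def by (rule ip_moments) auto

lemma field_differentiable_moment: "moment j field_differentiable (at t)"
  using moment_deriv field_differentiable_def by blast

text \<open>Mere differentiability is enough: the values of these derivatives drop out of
  \<open>onorm2_deriv\<close> by orthogonality.\<close>

lemma opoly_differentiable: "(\<lambda>s. coeff (opoly s n) k) field_differentiable (at t)"
proof (induction n arbitrary: k rule: less_induct)
  case (less n)
  have h: "(\<lambda>s. onorm2 s m) field_differentiable (at t)" if "m < n" for m
    unfolding onorm2_moments
    by (intro field_differentiable_sum field_differentiable_mult less that field_differentiable_moment)
  show ?case
  proof (cases n)
    case 0 then show ?thesis by simp
  next
    case (Suc m)
    have b: "(\<lambda>s. rcoeff s m) field_differentiable (at t)"
    proof (cases m)
      case 0 then show ?thesis by simp
    next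
      case (Suc l)
      then show ?thesis unfolding rcoeff_def using h[of m] h[of l] \<open>n = Suc m\<close> onorm2_pos[of t l]
        by (auto intro!: field_differentiable_divide)
    qed
    have "coeff (opoly s n) k = (if k = 0 then 0 else coeff (opoly s m) (k - 1))
               - rcoeff s m * coeff (opoly s (m - 1)) k" for s
      unfolding Suc opoly_Suc[of s m] by (cases k) (simp_all add: coeff_pCons)
    moreover have "(\<lambda>s. (if k = 0 then 0 else coeff (opoly s m) (k - 1))
               - rcoeff s m * coeff (opoly s (m - 1)) k) field_differentiable (at t)"
      using less[of m] less[of "m - 1"] b Suc
      by (cases "k = 0") (auto intro!: field_differentiable_diff field_differentiable_mult field_differentiable_minus)
    ultimately show ?thesis by simp
  qed
qed

text \<open>The derivative of a monic polynomial in \<open>t\<close> has lower degree and is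
  therefore orthogonal to it. What remains is the derivative of the weight, that is, the squared
  norm of x P_n, which the recurrence evaluates.\<close>

lemma onorm2_deriv:
  "((\<lambda>s. onorm2 s n) has_real_derivative onorm2 t n * (rcoeff t n + rcoeff t (n + 1))) (at t)"
proof -
  define c where "c i s = coeff (opoly s n) i" for i s
  define c' where "c' i = deriv (c i) t" for i
  have c: "(c i has_real_derivative c' i) (at t)" for i
    unfolding c'_def using opoly_differentiable[of n i t] unfolding c_def
    by (simp add: field_differentiable_derivI)
  \<comment> \<open>The leading coefficient is constantly 1.\<close>
  have c0: "c' n = 0"
    using DERIV_unique[OF c[of n]] unfolding c_def by simp
  let ?P = "opoly t n" and ?x = "[:0, 1:] :: real poly"
  have z: "c' i * (\<Sum>j\<le>n. c j t * moment (i + j) t) = 0" if "i \<le> n" for i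
  proof (cases "i = n")
    case True then show ?thesis using c0 by simp
  next
    case False
    have "(\<Sum>j\<le>n. c j t * moment (i + j) t) = wint t (Polynomial.monom 1 i * (1 * ?P))"
      by (subst wint_monom_mult[of _ 0 _ n]) (auto simp: c_def add.commute)
    also have "\<dots> = 0"
      using opoly_orth_lower[of "Polynomial.monom 1 i" n t] that False by (simp add: degree_monom_eq)
    finally show ?thesis by simp
  qed
  let ?d = "\<Sum>i\<le>n. \<Sum>j\<le>n. (c' i * c j t + c i t * c' j) * moment (i + j) t
              + c i t * c j t * moment (i + j + 2) t"
  have "((\<lambda>s. \<Sum>i\<le>n. \<Sum>j\<le>n. c i s * c j s * moment (i + j) s) has_real_derivative ?d) (at t)"
    by (intro DERIV_sum) (auto intro!: derivative_eq_intros c moment_deriv simp: algebra_simps)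
  moreover have "(\<Sum>i\<le>n. \<Sum>j\<le>n. c i s * c j s * moment (i + j) s) = onorm2 s n" for s
    unfolding onorm2_moments c_def ..
  moreover have "?d = onorm2 t n * (rcoeff t n + rcoeff t (n + 1))"
  proof -
    have "?d = (\<Sum>i\<le>n. c' i * (\<Sum>j\<le>n. c j t * moment (i + j) t))
         + (\<Sum>i\<le>n. \<Sum>j\<le>n. c' j * (c i t * moment (j + i) t))
         + (\<Sum>i\<le>n. \<Sum>j\<le>n. c i t * c j t * moment (i + j + 2) t)"
      by (simp add: sum.distrib algebra_simps sum_distrib_left add.commute)
    also have "(\<Sum>i\<le>n. \<Sum>j\<le>n. c' j * (c i t * moment (j + i) t))
        = (\<Sum>j\<le>n. c' j * (\<Sum>i\<le>n. c i t * moment (j + i) t))"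
      by (subst sum.swap) (simp add: sum_distrib_left)
    also have "(\<Sum>i\<le>n. \<Sum>j\<le>n. c i t * c j t * moment (i + j + 2) t)
        = wint t (Polynomial.monom 1 2 * (?P * ?P))"
      unfolding c_def by (rule wint_monom_mult[symmetric]) auto
    also have "Polynomial.monom 1 2 * (?P * ?P) = (?x * ?P) * (?x * ?P)"
      by (simp add: monom_altdef power2_eq_square)
    also have "wint t \<dots> = onorm2 t (Suc n) + rcoeff t n * (rcoeff t n * onorm2 t (n - 1))"
      unfolding opoly_rec ip_linear ip_opoly by (cases n) auto
    also have "rcoeff t n * (rcoeff t n * onorm2 t (n - 1)) = rcoeff t n * onorm2 t n"
      using onorm2_pos[of t "n - 1"] by (simp add: rcoeff_def)
    finally show ?thesis using z by (simp add: onorm2_Suc algebra_simps)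
  qed
  ultimately show ?thesis by simp
qed

lemma ln_onorm2_deriv:
  "((\<lambda>s. ln (onorm2 s n)) has_real_derivative rcoeff t n + rcoeff t (n + 1)) (at t)"
  using onorm2_pos[of t n] by (auto intro!: derivative_eq_intros onorm2_deriv)

text \<open>The Volterra lattice. The logarithmic derivatives of the two norms in the quotient share
  the summand \<open>rcoeff t n\<close>, which cancels.\<close>

lemma rcoeff_deriv:
  "((\<lambda>s. rcoeff s n) has_real_derivative rcoeff t n * (rcoeff t (n + 1) - rcoeff t (n - 1))) (at t)"
proof (cases n)
  case 0 then show ?thesis by simp
next
  case (Suc m)
  have "((\<lambda>s. onorm2 s n / onorm2 s m) has_real_derivative
     rcoeff t n * (rcoeff t (n + 1) - rcoeff t (n - 1))) (at t)"
    using onorm2_pos[of t m] Suc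
    by (auto intro!: derivative_eq_intros onorm2_deriv simp: rcoeff_def field_simps)
  then show ?thesis using Suc by (simp add: rcoeff_def)
qed

lemma ln_hankel_det: "ln (hankel_det n t) = (\<Sum>j<n. ln (onorm2 t j))"
  unfolding hankel_det_prod by (rule ln_prod) (simp_all add: onorm2_pos onorm2_pos[THEN less_imp_neq, THEN not_sym])

lemma ln_hankel_det_second_difference:
  "ln (hankel_det (n + 2) t) - 2 * ln (hankel_det (n + 1) t) + ln (hankel_det n t) = ln (rcoeff t (n + 1))"
  using onorm2_pos[of t n] onorm2_pos[of t "Suc n"] by (simp add: ln_hankel_det rcoeff_def ln_div)

definition ln_hankel_t :: "real \<Rightarrow> nat \<Rightarrow> real" where
  "ln_hankel_t t n = (\<Sum>j<n. rcoeff t j + rcoeff t (j + 1))"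

lemma ln_hankel_det_deriv:
  "((\<lambda>s. ln (hankel_det n s)) has_real_derivative ln_hankel_t t n) (at t)"
  unfolding ln_hankel_det ln_hankel_t_def by (intro DERIV_sum ln_onorm2_deriv)

text \<open>The sum telescopes because of the Volterra equation for the recurrence coefficients.\<close>
lemma ln_hankel_t_deriv:
  "((\<lambda>s. ln_hankel_t s n) has_real_derivative rcoeff t n * (rcoeff t (n + 1) + rcoeff t (n - 1))) (at t)"
proof (induction n)
  case 0 then show ?case by (simp add: ln_hankel_t_def)
next
  case (Suc n)
  have "((\<lambda>s. ln_hankel_t s n + (rcoeff s n + rcoeff s (Suc n))) has_real_derivative
     rcoeff t n * (rcoeff t (n + 1) + rcoeff t (n - 1)) +
     (rcoeff t n * (rcoeff t (n + 1) - rcoeff t (n - 1)) +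
      rcoeff t (Suc n) * (rcoeff t (Suc n + 1) - rcoeff t (Suc n - 1)))) (at t)"
    by (intro DERIV_add Suc rcoeff_deriv)
  then show ?case by (simp add: ln_hankel_t_def algebra_simps)
qed

section \<open>The Gaussian limit\<close>

text \<open>The factor exp(-x^4) lies between 1 - x^4 and 1, and the rest is a Gaussian of variance
  1 / (2 a), whose fourth moment 3 / (4 a^2) gives the lower bound.\<close>

lemma moment_0_bounds:
  assumes a: "a > 0"
  shows "sqrt (pi / a) * (1 - 3 / (4 * a^2)) \<le> moment 0 (- a)" "moment 0 (- a) \<le> sqrt (pi / a)"
proof -
  define \<sigma> where "\<sigma> = sqrt (1 / (2 * a))"
  have s: "\<sigma> > 0" "\<sigma>^2 = 1 / (2 * a)" using a by (auto simp: \<sigma>_def)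
  let ?g = "\<lambda>x. sqrt (pi / a) * normal_density 0 \<sigma> x"
  have g: "?g x = exp (- (a * x^2))" for x
    using a by (simp add: normal_density_def s real_sqrt_divide real_sqrt_mult field_simps)
  have i0: "integrable lborel ?g" using s by (intro integrable_mult_right integrable_normal_density)
  have i4: "integrable lborel (\<lambda>x. sqrt (pi / a) * (normal_density 0 \<sigma> x * x ^ 4))"
    using integrable_normal_moment[OF s(1), of 0 4] by simp
  have e0: "(LINT x|lborel. ?g x) = sqrt (pi / a)" using s by simp
  have e4: "(LINT x|lborel. sqrt (pi / a) * (normal_density 0 \<sigma> x * x ^ 4)) = sqrt (pi / a) * (3 / (4 * a^2))"
  proof -
    have "(LINT x|lborel. normal_density 0 \<sigma> x * x ^ 4) = 3 * (\<sigma>^2)^2"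
      using integral_normal_moment_even[OF s(1), of 0 2]
      by (simp add: fact_numeral power2_eq_square)
    also have "\<dots> = 3 / (4 * a^2)" unfolding s by (simp add: power2_eq_square)
    finally show ?thesis by (simp only: integral_mult_right_zero)
  qed
  have w: "x ^ 0 * weight x (- a) = exp (- (x ^ 4)) * ?g x" for x
    unfolding g weight_def exp_add[symmetric] by simp
  have m: "moment 0 (- a) = (LINT x|lborel. exp (- (x ^ 4)) * ?g x)"
    unfolding moment_def w ..
  have im: "integrable lborel (\<lambda>x. exp (- (x ^ 4)) * ?g x)"
    using integrable_moment[of 0 "- a"] unfolding w .
  have g0: "0 \<le> ?g x" for x unfolding g by simp
  have "exp (- (x ^ 4)) * ?g x \<le> ?g x" for x
    using mult_right_mono[OF _ g0[of x], of "exp (- (x ^ 4))" 1] by simp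
  then have "moment 0 (- a) \<le> (LINT x|lborel. ?g x)"
    unfolding m by (intro integral_mono im i0)
  then show "moment 0 (- a) \<le> sqrt (pi / a)" unfolding e0 .
  have "?g x - sqrt (pi / a) * (normal_density 0 \<sigma> x * x ^ 4) \<le> exp (- (x ^ 4)) * ?g x" for x
  proof -
    have "(1 - x ^ 4) * ?g x \<le> exp (- (x ^ 4)) * ?g x"
      using exp_ge_add_one_self[of "- (x^4)"] by (intro mult_right_mono g0) auto
    then show ?thesis by (simp add: algebra_simps)
  qed
  then have "(LINT x|lborel. ?g x - sqrt (pi / a) * (normal_density 0 \<sigma> x * x ^ 4)) \<le> moment 0 (- a)"
    unfolding m by (intro integral_mono im i0 i4 Bochner_Integration.integrable_diff)
  then show "sqrt (pi / a) * (1 - 3 / (4 * a^2)) \<le> moment 0 (- a)"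
    by (subst (asm) Bochner_Integration.integral_diff[OF i0 i4]) (simp only: e0 e4, simp add: algebra_simps)
qed

lemma onorm2_0: "onorm2 t 0 = moment 0 t"
  by (simp add: onorm2_def wint_def moment_def)

lemma onorm2_0_limit: "((\<lambda>a. sqrt a * onorm2 (- a) 0) \<longlongrightarrow> sqrt pi) at_top"
proof (rule tendsto_sandwich)
  show "\<forall>\<^sub>F a in at_top. sqrt pi * (1 - 3 / (4 * a^2)) \<le> sqrt a * onorm2 (- a) 0"
    using eventually_gt_at_top[of 0]
  proof eventually_elim
    case (elim a)
    then have "sqrt a * (sqrt (pi / a) * (1 - 3 / (4 * a^2))) \<le> sqrt a * onorm2 (- a) 0"
      unfolding onorm2_0 by (intro mult_left_mono moment_0_bounds) auto
    then show ?case using elim by (simp add: real_sqrt_divide)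
  qed
  show "\<forall>\<^sub>F a in at_top. sqrt a * onorm2 (- a) 0 \<le> sqrt pi"
    using eventually_gt_at_top[of 0]
  proof eventually_elim
    case (elim a)
    then have "sqrt a * onorm2 (- a) 0 \<le> sqrt a * sqrt (pi / a)"
      unfolding onorm2_0 by (intro mult_left_mono moment_0_bounds) auto
    then show ?case using elim by (simp add: real_sqrt_divide)
  qed
  have "((\<lambda>a::real. 1 - 3 / (4 * a^2)) \<longlongrightarrow> 1) at_top" by real_asymp
  then show "((\<lambda>a::real. sqrt pi * (1 - 3 / (4 * a^2))) \<longlongrightarrow> sqrt pi) at_top"
    using tendsto_mult_left[of _ 1 at_top "sqrt pi"] by simp
qed simp

lemma rcoeff_nonneg: "rcoeff t n \<ge> 0"
  by (cases n) (auto intro: less_imp_le rcoeff_pos)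

text \<open>For negative \<open>t\<close> every term of the string equation is nonnegative, so the
  three recurrence coefficients in the bracket may be dropped.\<close>

lemma rcoeff_le:
  assumes "a > 0" shows "rcoeff (- a) n \<le> real n / (2 * a)"
proof (cases "n = 0")
  case False
  have "real n = 4 * rcoeff (-a) n * (rcoeff (-a) (n - 1) + rcoeff (-a) n + rcoeff (-a) (n + 1) + a / 2)"
    using string_equation[of n "- a"] False by simp
  also have "\<dots> \<ge> 4 * rcoeff (-a) n * (a / 2)"
    using rcoeff_nonneg[of "-a"] by (intro mult_left_mono) (auto intro!: add_nonneg_nonneg)
  finally show ?thesis using assms by (simp add: field_simps)
qed simp

lemma rcoeff_tendsto_0: "((\<lambda>a. rcoeff (- a) n) \<longlongrightarrow> 0) at_top"
proof (rule tendsto_sandwich)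
  show "\<forall>\<^sub>F a in at_top. 0 \<le> rcoeff (- a) n" by (simp add: rcoeff_nonneg)
  show "\<forall>\<^sub>F a in at_top. rcoeff (- a) n \<le> real n / (2 * a)"
    using eventually_gt_at_top[of 0] by eventually_elim (rule rcoeff_le)
  show "((\<lambda>a. real n / (2 * a)) \<longlongrightarrow> 0) at_top" by real_asymp
qed simp

text \<open>The term \<open>a / 2\<close> dominates the bracket of the string equation, because the
  recurrence coefficients there tend to 0. The limit is the Hermite recurrence coefficient.\<close>

lemma rcoeff_limit: "((\<lambda>a. 2 * a * rcoeff (- a) n) \<longlongrightarrow> real n) at_top"
proof (cases "n = 0")
  case False
  let ?S = "\<lambda>a. rcoeff (- a) (n - 1) + rcoeff (- a) n + rcoeff (- a) (n + 1)"
  have inv: "((\<lambda>a::real. 1 / a) \<longlongrightarrow> 0) at_top" by real_asymp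
  have "((\<lambda>a. real n / (1 + 2 * ?S a * (1 / a))) \<longlongrightarrow> real n / (1 + 2 * (0 + 0 + 0) * 0)) at_top"
    by (intro tendsto_intros rcoeff_tendsto_0 inv) auto
  moreover have "\<forall>\<^sub>F a in at_top. real n / (1 + 2 * ?S a * (1 / a)) = 2 * a * rcoeff (- a) n"
    using eventually_gt_at_top[of 0]
  proof eventually_elim
    case (elim a)
    have S: "?S a \<ge> 0" using rcoeff_nonneg[of "-a"] by (intro add_nonneg_nonneg) auto
    have "real n = 4 * rcoeff (-a) n * (?S a + a / 2)"
      using string_equation[of n "- a"] False by simp
    moreover have "4 * r * (S + a / 2) = 2 * a * r * (1 + 2 * S * (1 / a))" for r S
      using elim by (simp add: field_simps)
    ultimately have "real n = 2 * a * rcoeff (- a) n * (1 + 2 * ?S a * (1 / a))"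
      by simp
    moreover have "1 + 2 * ?S a * (1 / a) > 0" using S elim by (intro add_pos_nonneg) auto
    ultimately show ?case by (simp add: field_simps)
  qed
  ultimately show ?thesis using tendsto_cong by fastforce
qed simp

text \<open>As \<open>t\<close> tends to \<open>-\<infinity>\<close> the weight degenerates to the Gaussian \<open>exp (t x\<^sup>2)\<close>.\<close>
lemma ln_onorm2_limit:
  "((\<lambda>a. ln (onorm2 (- a) j) + (real j + 1/2) * ln (2 * a)) \<longlongrightarrow> ln (2 * pi) / 2 + ln (fact j)) at_top"
proof (induction j)
  case 0
  have "((\<lambda>a. ln (sqrt a * onorm2 (- a) 0) + ln 2 / 2) \<longlongrightarrow> ln (sqrt pi) + ln 2 / 2) at_top"
    by (intro tendsto_intros onorm2_0_limit) auto
  moreover have "\<forall>\<^sub>F a in at_top. ln (sqrt a * onorm2 (- a) 0) + ln 2 / 2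
      = ln (onorm2 (- a) 0) + (real 0 + 1/2) * ln (2 * a)"
    using eventually_gt_at_top[of 0]
  proof eventually_elim
    case (elim a)
    then show ?case using onorm2_pos[of "- a" 0] by (simp add: ln_mult ln_sqrt)
  qed
  ultimately show ?case by (simp add: ln_sqrt ln_mult add_divide_distrib tendsto_cong add.commute)
next
  case (Suc j)
  have "((\<lambda>a. (ln (onorm2 (- a) j) + (real j + 1/2) * ln (2 * a)) + ln (2 * a * rcoeff (- a) (Suc j)))
      \<longlongrightarrow> (ln (2 * pi) / 2 + ln (fact j)) + ln (real (Suc j))) at_top"
    by (intro tendsto_intros Suc rcoeff_limit) auto
  moreover have "\<forall>\<^sub>F a in at_top. (ln (onorm2 (- a) j) + (real j + 1/2) * ln (2 * a)) + ln (2 * a * rcoeff (- a) (Suc j))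
      = ln (onorm2 (- a) (Suc j)) + (real (Suc j) + 1/2) * ln (2 * a)"
    using eventually_gt_at_top[of 0]
  proof eventually_elim
    case (elim a)
    have "ln (2 * a * rcoeff (- a) (Suc j)) = ln (2 * a) + ln (rcoeff (- a) (Suc j))"
      using elim rcoeff_pos[of "Suc j" "- a"] by (subst ln_mult) auto
    then show ?case
      using rcoeff_pos[of "Suc j" "- a"] onorm2_pos[of "- a" j]
      by (simp add: onorm2_Suc ln_mult algebra_simps)
  qed
  ultimately show ?case by (simp add: ln_mult tendsto_cong add_ac del: of_nat_Suc)
qed

lemma ln_hankel_det_limit:
  "((\<lambda>a. ln (hankel_det n (- a)) + real n ^ 2 / 2 * ln (2 * a))
     \<longlongrightarrow> real n / 2 * ln (2 * pi) + (\<Sum>j<n. ln (fact j))) at_top"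
proof -
  have s: "(\<Sum>j<n. real j + 1/2) = real n ^ 2 / 2"
    by (induction n) (auto simp: power2_eq_square field_simps)
  have "((\<lambda>a. \<Sum>j<n. ln (onorm2 (- a) j) + (real j + 1/2) * ln (2 * a))
     \<longlongrightarrow> (\<Sum>j<n. ln (2 * pi) / 2 + ln (fact j))) at_top"
    by (intro tendsto_sum ln_onorm2_limit)
  moreover have "(\<Sum>j<n. ln (onorm2 (- a) j) + (real j + 1/2) * ln (2 * a))
      = ln (hankel_det n (- a)) + real n ^ 2 / 2 * ln (2 * a)" for a
    using s by (simp only: sum.distrib sum_distrib_right[symmetric] ln_hankel_det)
  ultimately show ?thesis by (simp add: sum.distrib)
qed

section \<open>An approximate solution of the string equation\<close>

text \<open>\<open>rr t x\<close> is the positive solution \<open>r\<close> of \<open>12 r\<^sup>2 - 2 t r = x\<close>, the string equation with equal neighbours, and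
  \<open>dd\<close> is the root of its discriminant. The polynomials in \<open>ww\<close>, \<open>ee\<close> and \<open>rho\<close> are closed under
  differentiation in \<open>x\<close>.\<close>
definition dd :: "real \<Rightarrow> real \<Rightarrow> real" where "dd t x = sqrt (t^2 + 12 * x)"
definition rr :: "real \<Rightarrow> real \<Rightarrow> real" where "rr t x = (t + dd t x) / 12"
definition ee :: "real \<Rightarrow> real \<Rightarrow> real" where "ee t x = 1 / dd t x ^ 2"
definition ww :: "real \<Rightarrow> real \<Rightarrow> real" where "ww t x = 1 / (dd t x * rr t x)"
definition rho :: "real \<Rightarrow> real \<Rightarrow> real" where "rho t x = rr t x / dd t x"

lemma dd_sq: "x > 0 \<Longrightarrow> dd t x ^ 2 = t^2 + 12 * x"
  by (simp add: dd_def)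

lemma dd_gt: assumes "x > 0" shows "dd t x > \<bar>t\<bar>"
  unfolding dd_def using assms by (intro real_less_rsqrt) simp

lemma dd_pos: "x > 0 \<Longrightarrow> dd t x > 0"
  using dd_gt[of x t] by linarith

lemma rr_pos: "x > 0 \<Longrightarrow> rr t x > 0"
  using dd_gt[of x t] by (simp add: rr_def)

lemma x_eq: "x > 0 \<Longrightarrow> x = 2 * rr t x * dd t x - 12 * rr t x ^ 2"
  using dd_sq[of x t] by (simp add: rr_def power2_eq_square field_simps)

lemma t_eq: "t = 12 * rr t x - dd t x"
  by (simp add: rr_def add_divide_distrib)

lemma ww_rho: "x > 0 \<Longrightarrow> ww t x * rho t x = ee t x"
  using rr_pos[of x t] dd_pos[of x t] by (simp add: ww_def rho_def ee_def power2_eq_square field_simps)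

lemma rr_ww: "x > 0 \<Longrightarrow> rr t x * ww t x = 1 / dd t x"
  using rr_pos[of x t] by (simp add: ww_def)

lemma ee_pos: "x > 0 \<Longrightarrow> ee t x > 0"
  using dd_pos[of x t] by (simp add: ee_def)

lemma ww_pos: "x > 0 \<Longrightarrow> ww t x > 0"
  using dd_pos[of x t] rr_pos[of x t] by (simp add: ww_def)

lemma rho_pos: "x > 0 \<Longrightarrow> rho t x > 0"
  using dd_pos[of x t] rr_pos[of x t] by (simp add: rho_def)

text \<open>This bound and those in \<open>rho_less\<close> and \<open>ww_le\<close> do not involve
  \<open>t\<close>. All uniformity in \<open>t\<close> of the later estimates comes from them:
  \<open>ee\<close> and \<open>ww\<close> count as order 1 / x, \<open>rho\<close> as order
  1.\<close>

lemma ee_le: assumes "x > 0" shows "ee t x \<le> 1 / (12 * x)"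
  unfolding ee_def dd_sq[OF assms] using assms by (intro divide_left_mono) (auto intro!: mult_pos_pos add_nonneg_pos)

lemma rho_less: assumes "x > 0" shows "rho t x < 1 / 6"
  using dd_gt[OF assms, of t] dd_pos[OF assms, of t] by (simp add: rho_def rr_def field_simps)

lemma rho_eq: assumes "x > 0" shows "rho t x = 1 / 12 + t / (12 * dd t x)"
  using dd_pos[OF assms, of t] by (simp add: rho_def rr_def field_simps)

text \<open>Substituting the quadratic equation for \<open>rr\<close> removes \<open>rr\<close> from
  the denominator. It could not be bounded there, since it tends to 0 as \<open>t\<close> tends to
  minus infinity.\<close>

lemma ww_eq: assumes "x > 0" shows "ww t x = 2 * (1 - 6 * rho t x) / x"
proof -
  have "x * ww t x = 2 * (1 - 6 * rho t x)"
    by (subst x_eq[OF assms, of t], use dd_pos[OF assms, of t] rr_pos[OF assms, of t] in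
      \<open>simp add: ww_def rho_def power2_eq_square field_simps\<close>)
  then show ?thesis using assms by (simp add: field_simps)
qed

lemma ww_le: assumes "x > 0" shows "ww t x \<le> 2 / x"
  unfolding ww_eq[OF assms] using assms rho_pos[OF assms, of t] by (intro divide_right_mono) auto

lemma dd_deriv: assumes "x > 0" shows "(dd t has_real_derivative 6 / dd t x) (at x within S)"
proof -
  have "t^2 + 12 * x > 0" using assms by (simp add: add_nonneg_pos)
  then show ?thesis unfolding dd_def
    by (auto intro!: derivative_eq_intros simp: field_simps)
qed

lemma rr_deriv: assumes "x > 0" shows "(rr t has_real_derivative rr t x * (ww t x / 2)) (at x within S)"
proof -
  have "((\<lambda>x. (t + dd t x) / 12) has_real_derivative 6 / dd t x / 12) (at x within S)"
    by (auto intro!: derivative_eq_intros dd_deriv assms)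
  moreover have "6 / dd t x / 12 = rr t x * (ww t x / 2)"
    using rr_pos[OF assms, of t] by (simp add: ww_def)
  ultimately show ?thesis by (simp only: rr_def[abs_def])
qed

lemma ee_deriv: assumes "x > 0" shows "(ee t has_real_derivative - 12 * ee t x ^ 2) (at x within S)"
  unfolding ee_def[abs_def] using dd_pos[OF assms, of t]
  by (auto intro!: derivative_eq_intros dd_deriv assms simp: power2_eq_square field_simps)

lemma rho_deriv: assumes "x > 0"
  shows "(rho t has_real_derivative ee t x / 2 - 6 * ee t x * rho t x) (at x within S)"
  unfolding rho_def[abs_def] using dd_pos[OF assms, of t] rr_pos[OF assms, of t]
  by (auto intro!: derivative_eq_intros dd_deriv rr_deriv assms simp: ee_def ww_def power2_eq_square field_simps)

lemma ww_deriv: assumes "x > 0"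
  shows "(ww t has_real_derivative - 6 * ee t x * ww t x - ww t x ^ 2 / 2) (at x within S)"
  unfolding ww_def[abs_def] using dd_pos[OF assms, of t] rr_pos[OF assms, of t]
  by (auto intro!: derivative_eq_intros dd_deriv rr_deriv assms simp: ee_def ww_def power2_eq_square field_simps)

lemma ln_rr_deriv: assumes "x > 0"
  shows "((\<lambda>x. ln (rr t x)) has_real_derivative ww t x / 2) (at x within S)"
  using rr_pos[OF assms, of t] by (auto intro!: derivative_eq_intros rr_deriv assms)

lemma ln_dd_deriv: assumes "x > 0"
  shows "((\<lambda>x. ln (dd t x)) has_real_derivative 6 * ee t x) (at x within S)"
  using dd_pos[OF assms, of t]
  by (auto intro!: derivative_eq_intros dd_deriv assms simp: ee_def power2_eq_square)

lemmas basic_derivs = rr_deriv ee_deriv rho_deriv ww_deriv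

text \<open>\<open>f0\<close>, \<open>f1\<close> and the head of \<open>f2_diffs\<close> are the terms of order \<open>n\<^sup>2\<close>, \<open>1\<close> and \<open>n\<^sup>-\<^sup>2\<close> in the approximation of
  \<open>ln D\<^sub>n\<close>: the second derivative of \<open>f0\<close> is \<open>ln rr\<close>, and the others solve the second difference
  equation for the next orders. The lists \<open>lnr_diffs\<close> and \<open>f1_diffs\<close> start with the first derivative of
  \<open>ln rr\<close> and \<open>f1\<close>; \<open>f2_diffs\<close> starts with the function itself, and so does \<open>b_diffs\<close>, whose entries are
  divided by \<open>rr\<close>.\<close>
definition f0 :: "real \<Rightarrow> real \<Rightarrow> real" where
  "f0 t x = x^2 / 2 * ln (rr t x) - 3 * rr t x ^ 2 * dd t x ^ 2 + 44 * rr t x ^ 3 * dd t x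
     - 150 * rr t x ^ 4 + x * ln (2 * pi)"

definition f1 :: "real \<Rightarrow> real \<Rightarrow> real" where
  "f1 t x = - (ln 2 + ln (rr t x) + ln (dd t x)) / 12"

definition lnr_diffs :: "real \<Rightarrow> real \<Rightarrow> real list" where
  "lnr_diffs w e = [
     1/2 * w,
     - 1/4 * w^2 - 3 * w * e,
     1/4 * w^3 + 9/2 * w^2 * e + 54 * w * e^2,
     - 3/8 * w^4 - 9 * w^3 * e - 135 * w^2 * e^2 - 1620 * w * e^3,
     3/4 * w^5 + 45/2 * w^4 * e + 405 * w^3 * e^2 + 5670 * w^2 * e^3 + 68040 * w * e^4,
     - 15/8 * w^6 - 135/2 * w^5 * e - 2835/2 * w^4 * e^2 - 22680 * w^3 * e^3 - 306180 * w^2 * e^4 - 3674160 * w * e^5]"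

definition f1_diffs :: "real \<Rightarrow> real \<Rightarrow> real list" where
  "f1_diffs w e = [
     - 1/24 * w - 1/2 * e,
     1/48 * w^2 + 1/4 * w * e + 6 * e^2,
     - 1/48 * w^3 - 3/8 * w^2 * e - 9/2 * w * e^2 - 144 * e^3,
     1/32 * w^4 + 3/4 * w^3 * e + 45/4 * w^2 * e^2 + 135 * w * e^3 + 5184 * e^4,
     - 1/16 * w^5 - 15/8 * w^4 * e - 135/4 * w^3 * e^2 - 945/2 * w^2 * e^3 - 5670 * w * e^4 - 248832 * e^5,
     5/32 * w^6 + 45/8 * w^5 * e + 945/8 * w^4 * e^2 + 1890 * w^3 * e^3 + 25515 * w^2 * e^4 + 306180 * w * e^5 + 14929920 * e^6]"

definition f2_diffs :: "real \<Rightarrow> real \<Rightarrow> real \<Rightarrow> real list" where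
  "f2_diffs w e h = [
     - 1/960 * w^2 - 1/80 * w * e - 9/80 * e^2 - 42/5 * e^2 * h,
     1/960 * w^3 + 3/160 * w^2 * e + 9/40 * w * e^2 - 3/2 * e^3 + 252 * e^3 * h,
     - 1/640 * w^4 - 3/80 * w^3 * e - 9/16 * w^2 * e^2 - 27/4 * w * e^3 + 180 * e^4 - 10584 * e^4 * h,
     1/320 * w^5 + 3/32 * w^4 * e + 27/16 * w^3 * e^2 + 189/8 * w^2 * e^3 + 567/2 * w * e^4 - 13932 * e^5 + 571536 * e^5 * h,
     - 1/128 * w^6 - 9/32 * w^5 * e - 189/32 * w^4 * e^2 - 189/2 * w^3 * e^3 - 5103/4 * w^2 * e^4 - 15309 * w * e^5 + 1121688 * e^6 - 37721376 * e^6 * h]"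

definition b_diffs :: "real \<Rightarrow> real \<Rightarrow> real \<Rightarrow> real list" where
  "b_diffs w e h = [
     1 + 6 * e^2 + 630 * e^4 - 10584 * e^4 * h,
     1/2 * w + 3 * w * e^2 + 315 * w * e^4 - 144 * e^3 - 40824 * e^5 + 571536 * e^5 * h,
     - 3 * w * e - 162 * w * e^3 - 37422 * w * e^5 + 5184 * e^4 + 3020976 * e^6 - 37721376 * e^6 * h,
     54 * w * e^2 + 9396 * w * e^4 + 3980340 * w * e^6 - 248832 * e^5 - 255231648 * e^7 + 2942267328 * e^7 * h,
     - 1620 * w * e^3 - 631800 * w * e^5 - 438082344 * w * e^7 + 14929920 * e^6 + 24381725760 * e^8 - 264804059520 * e^8 * h,
     68040 * w * e^4 + 49163760 * w * e^6 + 51618273840 * w * e^8 - 1074954240 * e^7 - 2605449732480 * e^9 + 27010014071040 * e^9 * h,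
     - 3674160 * w * e^5 - 4372250400 * w * e^7 - 6567788797920 * w * e^9 + 90296156160 * e^8 + 308398585178880 * e^10 - 3079141604098560 * e^10 * h]"

section \<open>Derivatives of the correction terms\<close>

lemma less_numeral_cases:
  "(m::nat) < 4 \<longleftrightarrow> m = 0 \<or> m = 1 \<or> m = 2 \<or> m = 3"
  "m < 5 \<longleftrightarrow> m = 0 \<or> m = 1 \<or> m = 2 \<or> m = 3 \<or> m = 4"
  "m < 6 \<longleftrightarrow> m = 0 \<or> m = 1 \<or> m = 2 \<or> m = 3 \<or> m = 4 \<or> m = 5"
  by arith+

lemma lnr_diffs_deriv:
  assumes "x > 0" "m < 5"
  shows "((\<lambda>x. lnr_diffs (ww t x) (ee t x) ! m) has_real_derivative lnr_diffs (ww t x) (ee t x) ! Suc m) (at x)"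
  using assms(2) unfolding less_numeral_cases lnr_diffs_def
  by (elim disjE; simp only: nth_Cons_0 nth_Cons_Suc numeral_nat One_nat_def BitM.simps)
    (rule DERIV_cong, (rule derivative_intros basic_derivs assms(1))+, simp add: algebra_simps power2_eq_square)+

lemma f1_diffs_deriv:
  assumes "x > 0" "m < 5"
  shows "((\<lambda>x. f1_diffs (ww t x) (ee t x) ! m) has_real_derivative f1_diffs (ww t x) (ee t x) ! Suc m) (at x)"
  using assms(2) unfolding less_numeral_cases f1_diffs_def
  by (elim disjE; simp only: nth_Cons_0 nth_Cons_Suc numeral_nat One_nat_def BitM.simps)
    (rule DERIV_cong, (rule derivative_intros basic_derivs assms(1))+, simp add: algebra_simps power2_eq_square)+

lemma f2_diffs_deriv:
  assumes "x > 0" "m < 4"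
  shows "((\<lambda>x. f2_diffs (ww t x) (ee t x) (rho t x) ! m) has_real_derivative f2_diffs (ww t x) (ee t x) (rho t x) ! Suc m) (at x)"
  using assms(2) unfolding less_numeral_cases f2_diffs_def
  by (elim disjE; simp only: nth_Cons_0 nth_Cons_Suc numeral_nat One_nat_def BitM.simps)
    (rule DERIV_cong, (rule derivative_intros basic_derivs assms(1))+, (simp only: ww_rho[OF assms(1), symmetric])?, (simp add: algebra_simps power2_eq_square; fail | simp add: field_simps power2_eq_square; fail))+

text \<open>Since \<open>rr * ww\<close> is 1 / \<open>dd\<close>, the squares of \<open>w\<close>
  cancel at each differentiation and all entries stay linear in \<open>w\<close>. The derivative of
  \<open>rr\<close> produces products of \<open>w\<close> and \<open>h\<close>; the entries agree
  only modulo \<open>w * h = e\<close>, so \<open>e\<close> is eliminated before comparing.\<close>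

lemma b_diffs_deriv:
  assumes "x > 0" "m < 6"
  shows "((\<lambda>x. rr t x * b_diffs (ww t x) (ee t x) (rho t x) ! m) has_real_derivative rr t x * b_diffs (ww t x) (ee t x) (rho t x) ! Suc m) (at x)"
  using assms(2) unfolding less_numeral_cases b_diffs_def
  by (elim disjE; simp only: nth_Cons_0 nth_Cons_Suc numeral_nat One_nat_def BitM.simps)
    (rule DERIV_cong, (rule derivative_intros basic_derivs assms(1))+, (simp only: ww_rho[OF assms(1), symmetric])?, (simp add: algebra_simps power2_eq_square; fail | simp add: field_simps power2_eq_square; fail))+

text \<open>Division by \<open>dd * rr\<close> is undone by writing \<open>x\<close> through
  \<open>rr\<close> and \<open>dd\<close>. The summand \<open>x * ln (2 * pi)\<close> of
  \<open>f0\<close> is invisible to the second derivative; it is fixed by the Gaussian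
  limit.\<close>

lemma f0_deriv:
  assumes "x > 0"
  shows "(f0 t has_real_derivative x * ln (rr t x) - 2 * rr t x * dd t x + 18 * rr t x ^ 2 + ln (2 * pi)) (at x)"
    (is "(_ has_real_derivative ?D) _")
proof -
  let ?r = "rr t x" and ?d = "dd t x"
  have p: "?r > 0" "?d > 0" using rr_pos dd_pos assms by auto
  have x: "x = 2 * ?r * ?d - 12 * ?r ^ 2" by (rule x_eq[OF assms])
  have r: "(rr t has_real_derivative 1 / (2 * ?d)) (at x)"
    using rr_deriv[OF assms, of t UNIV] rr_ww[OF assms, of t] by (simp add: mult.commute)
  have "(f0 t has_real_derivative
     (x * ln ?r + x^2 / 2 * (1 / (2 * ?d * ?r)) - 3 * (2 * ?r * (1 / (2 * ?d)) * ?d^2 + ?r^2 * (2 * ?d * (6 / ?d)))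
      + 44 * (3 * ?r^2 * (1 / (2 * ?d)) * ?d + ?r^3 * (6 / ?d)) - 150 * (4 * ?r^3 * (1 / (2 * ?d))) + ln (2 * pi))) (at x)"
    unfolding f0_def[abs_def] using p
    by (auto intro!: derivative_eq_intros r dd_deriv assms simp: field_simps)
  moreover have "x^2 / 2 * (1 / (2 * ?d * ?r)) - 3 * (2 * ?r * (1 / (2 * ?d)) * ?d^2 + ?r^2 * (2 * ?d * (6 / ?d)))
      + 44 * (3 * ?r^2 * (1 / (2 * ?d)) * ?d + ?r^3 * (6 / ?d)) - 150 * (4 * ?r^3 * (1 / (2 * ?d)))
      = - 2 * ?r * ?d + 18 * ?r ^ 2"
  proof -
    have xx: "x^2 / 2 * (1 / (2 * ?d * ?r)) = (2 * ?d - 12 * ?r)^2 * ?r / (4 * ?d)"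
    proof -
      have "x = ?r * (2 * ?d - 12 * ?r)" by (subst x) (simp add: power2_eq_square algebra_simps)
      then have "x^2 / 2 * (1 / (2 * ?d * ?r)) = (?r * (2 * ?d - 12 * ?r))^2 / 2 * (1 / (2 * ?d * ?r))" by simp
      also have "\<dots> = (2 * ?d - 12 * ?r)^2 * ?r / (4 * ?d)" using p by (simp add: power2_eq_square field_simps)
      finally show ?thesis .
    qed
    show ?thesis unfolding xx using p by (simp add: eval_nat_numeral field_simps)
  qed
  ultimately show ?thesis
    by (elim DERIV_cong) (simp only: mult_minus_left diff_conv_add_uminus add_ac)
qed

lemma f0_deriv2:
  assumes "x > 0"
  shows "((\<lambda>x. x * ln (rr t x) - 2 * rr t x * dd t x + 18 * rr t x ^ 2 + ln (2 * pi)) has_real_derivative ln (rr t x)) (at x)"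
proof -
  let ?r = "rr t x" and ?d = "dd t x"
  have p: "?r > 0" "?d > 0" using rr_pos dd_pos assms by auto
  have x: "x = 2 * ?r * ?d - 12 * ?r ^ 2" by (rule x_eq[OF assms])
  have r: "(rr t has_real_derivative 1 / (2 * ?d)) (at x)"
    using rr_deriv[OF assms, of t UNIV] rr_ww[OF assms, of t] by (simp add: mult.commute)
  have "x * (1 / (2 * ?d * ?r)) = (2 * ?d - 12 * ?r) / (2 * ?d)"
    using p by (subst x) (simp add: power2_eq_square field_simps)
  moreover have "(2 * ?d - 12 * ?r) / (2 * ?d) - 2 * (1 / (2 * ?d) * ?d + ?r * (6 / ?d)) + 18 * (2 * ?r * (1 / (2 * ?d))) = 0"
    using p by (simp add: field_simps)
  ultimately have e: "ln ?r + x * (1 / (2 * ?d * ?r)) - 2 * (1 / (2 * ?d) * ?d + ?r * (6 / ?d)) + 18 * (2 * ?r * (1 / (2 * ?d))) = ln ?r"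
    by simp
  have "((\<lambda>x. x * ln (rr t x) - 2 * rr t x * dd t x + 18 * rr t x ^ 2 + ln (2 * pi)) has_real_derivative
    (ln ?r + x * (1 / (2 * ?d * ?r)) - 2 * (1 / (2 * ?d) * ?d + ?r * (6 / ?d)) + 18 * (2 * ?r * (1 / (2 * ?d))))) (at x)"
    using p by (auto intro!: derivative_eq_intros r dd_deriv assms simp: field_simps)
  then show ?thesis unfolding e .
qed

lemma f1_deriv:
  assumes "x > 0"
  shows "(f1 t has_real_derivative f1_diffs (ww t x) (ee t x) ! 0) (at x)"
proof -
  have "(f1 t has_real_derivative - (0 + ww t x / 2 + 6 * ee t x) / 12) (at x)"
    unfolding f1_def[abs_def]
    by (intro DERIV_cdivide DERIV_minus DERIV_add DERIV_const ln_rr_deriv ln_dd_deriv assms)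
  then show ?thesis by (rule DERIV_cong) (simp add: f1_diffs_def)
qed

text \<open>Maclaurin expansions with steps 1 and -1 are added, so the odd orders cancel and a bound
  on the derivative of order \<open>2 * k\<close> near \<open>x\<close> suffices. The variable is
  \<open>n\<close> in most applications, and \<open>t\<close> in the one for the Toda
  equation.\<close>

lemma second_difference_taylor:
  fixes g :: "nat \<Rightarrow> real \<Rightarrow> real"
  assumes deriv: "\<And>m s. m < 2 * k \<Longrightarrow> \<bar>s - x\<bar> \<le> 1 \<Longrightarrow> (g m has_real_derivative g (Suc m) s) (at s)"
    and bound: "\<And>s. \<bar>s - x\<bar> \<le> 1 \<Longrightarrow> \<bar>g (2 * k) s\<bar> \<le> M"
  shows "\<bar>g 0 (x + 1) + g 0 (x - 1) - (\<Sum>j<k. 2 * g (2 * j) x / fact (2 * j))\<bar> \<le> 2 * M / fact (2 * k)"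
proof -
  have D: "((\<lambda>s. g m (x + s)) has_real_derivative g (Suc m) (x + s)) (at s)" if "m < 2 * k" "\<bar>s\<bar> \<le> 1" for m s
    using DERIV_shift[of "g m" "g (Suc m) (x + s)" s x] deriv[of m "x + s"] that by (simp add: add.commute)
  have taylor: "\<exists>s. \<bar>s\<bar> \<le> 1 \<and> g 0 (x + h) = (\<Sum>m<2 * k. g m x / fact m * h ^ m) + g (2 * k) (x + s) / fact (2 * k)"
    if h: "\<bar>h\<bar> = 1" for h
  proof -
    have "h ^ (2 * k) = 1" using h by (simp add: power_mult power2_eq_square flip: abs_mult_self_eq[of h])
    then show ?thesis
      using Maclaurin_bi_le[of "\<lambda>m s. g m (x + s)" "\<lambda>s. g 0 (x + s)" "2 * k" h] D h by auto
  qed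
  obtain s1 where s1: "\<bar>s1\<bar> \<le> 1"
    "g 0 (x + 1) = (\<Sum>m<2 * k. g m x / fact m) + g (2 * k) (x + s1) / fact (2 * k)"
    using taylor[of 1] by auto
  obtain s2 where s2: "\<bar>s2\<bar> \<le> 1"
    "g 0 (x - 1) = (\<Sum>m<2 * k. g m x / fact m * (-1) ^ m) + g (2 * k) (x + s2) / fact (2 * k)"
    using taylor[of "-1"] by auto
  have sums: "(\<Sum>m<2 * l. g m x / fact m) + (\<Sum>m<2 * l. g m x / fact m * (-1) ^ m)
      = (\<Sum>j<l. 2 * g (2 * j) x / fact (2 * j))" for l
    by (induction l) simp_all
  have "\<bar>g 0 (x + 1) + g 0 (x - 1) - (\<Sum>j<k. 2 * g (2 * j) x / fact (2 * j))\<bar>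
      = \<bar>g (2 * k) (x + s1) + g (2 * k) (x + s2)\<bar> / fact (2 * k)"
  proof -
    have "g 0 (x + 1) + g 0 (x - 1) - (\<Sum>j<k. 2 * g (2 * j) x / fact (2 * j))
      = (g (2 * k) (x + s1) + g (2 * k) (x + s2)) / fact (2 * k)"
      using sums[of k] unfolding s1(2) s2(2) add_divide_distrib by linarith
    then show ?thesis by (simp add: abs_divide)
  qed
  also have "\<dots> \<le> (M + M) / fact (2 * k)"
    by (intro divide_right_mono order.trans[OF abs_triangle_ineq] add_mono bound) (use s1 s2 in auto)
  finally show ?thesis by simp
qed

text \<open>With \<open>M = 4 / x\<close>, every monomial of total degree at least 6 in
  \<open>w\<close> and \<open>e\<close> is of order x^-6, the precision to which the string equation
  and the second differences are matched.\<close>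

lemma monomial_bound:
  fixes w e h M :: real
  assumes "0 \<le> w" "w \<le> M" "0 \<le> e" "e \<le> M" "0 \<le> h" "h \<le> 1" "M \<le> 1" "6 \<le> i + j"
  shows "0 \<le> w ^ i * e ^ j * h ^ k" "w ^ i * e ^ j * h ^ k \<le> M ^ 6"
proof -
  show "0 \<le> w ^ i * e ^ j * h ^ k" using assms by simp
  have "w ^ i * e ^ j * h ^ k \<le> M ^ i * M ^ j * 1"
    using assms by (intro mult_mono power_mono power_le_one) auto
  also have "\<dots> = M ^ (i + j)" by (simp add: power_add)
  also have "\<dots> \<le> M ^ 6" using assms by (intro power_decreasing) auto
  finally show "w ^ i * e ^ j * h ^ k \<le> M ^ 6" .
qed

context
  fixes w e h M :: real
  assumes weh: "0 \<le> w" "w \<le> M" "0 \<le> e" "e \<le> M" "0 \<le> h" "h \<le> 1" "M \<le> 1"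
begin

lemmas mb = monomial_bound[OF weh]

lemma zero_le_mult_powers: "0 \<le> w ^ i * e ^ j"
  using weh by simp

text \<open>The power of 10 here, as in the next three bounds, is a round majorant of the sum of the
  absolute values of the coefficients.\<close>

lemma lnr_diffs_bound: "\<bar>lnr_diffs w e ! 5\<bar> \<le> 10^7 * M ^ 6"
proof -
  note m = zero_le_power[OF weh(1), of 6] zero_le_mult_powers[of 5 1, unfolded power_one_right] zero_le_mult_powers[of 4 2] zero_le_mult_powers[of 3 3] zero_le_mult_powers[of 2 4] zero_le_mult_powers[of 1 5, unfolded power_one_right]
    mb(2)[of 6 0 0, simplified] mb(2)[of 5 1 0, simplified] mb(2)[of 4 2 0, simplified] mb(2)[of 3 3 0, simplified] mb(2)[of 2 4 0, simplified] mb(2)[of 1 5 0, simplified]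
  show ?thesis
    by (simp add: lnr_diffs_def abs_le_iff) (intro conjI; use m in linarith)
qed

lemma f1_diffs_bound: "\<bar>f1_diffs w e ! 5\<bar> \<le> 10^8 * M ^ 6"
proof -
  note m = zero_le_power[OF weh(1), of 6] zero_le_mult_powers[of 5 1, unfolded power_one_right] zero_le_mult_powers[of 4 2] zero_le_mult_powers[of 3 3] zero_le_mult_powers[of 2 4] zero_le_mult_powers[of 1 5, unfolded power_one_right] zero_le_power[OF weh(3), of 6]
    mb(2)[of 6 0 0, simplified] mb(2)[of 5 1 0, simplified] mb(2)[of 4 2 0, simplified] mb(2)[of 3 3 0, simplified] mb(2)[of 2 4 0, simplified] mb(2)[of 1 5 0, simplified] mb(2)[of 0 6 0, simplified]
  show ?thesis
    by (simp add: f1_diffs_def abs_le_iff) (intro conjI; use m in linarith)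
qed

lemma f2_diffs_bound: "\<bar>f2_diffs w e h ! 4\<bar> \<le> 10^8 * M ^ 6"
proof -
  note m = zero_le_power[OF weh(1), of 6] zero_le_mult_powers[of 5 1, unfolded power_one_right] zero_le_mult_powers[of 4 2] zero_le_mult_powers[of 3 3] zero_le_mult_powers[of 2 4] zero_le_mult_powers[of 1 5, unfolded power_one_right] zero_le_power[OF weh(3), of 6] mb(1)[of 0 6 1, simplified]
    mb(2)[of 6 0 0, simplified] mb(2)[of 5 1 0, simplified] mb(2)[of 4 2 0, simplified] mb(2)[of 3 3 0, simplified] mb(2)[of 2 4 0, simplified] mb(2)[of 1 5 0, simplified] mb(2)[of 0 6 0, simplified] mb(2)[of 0 6 1, simplified]
  show ?thesis
    by (simp add: f2_diffs_def abs_le_iff) (intro conjI; use m in linarith)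
qed

lemma b_diffs_bound: "\<bar>b_diffs w e h ! 6\<bar> \<le> 10^16 * M ^ 6"
proof -
  note m = zero_le_mult_powers[of 1 5, unfolded power_one_right] zero_le_mult_powers[of 1 7, unfolded power_one_right] zero_le_mult_powers[of 1 9, unfolded power_one_right] zero_le_power[OF weh(3), of 8] zero_le_power[OF weh(3), of 10] mb(1)[of 0 10 1, simplified]
    mb(2)[of 1 5 0, simplified] mb(2)[of 1 7 0, simplified] mb(2)[of 1 9 0, simplified] mb(2)[of 0 8 0, simplified] mb(2)[of 0 10 0, simplified] mb(2)[of 0 10 1, simplified]
  show ?thesis
    by (simp add: b_diffs_def abs_le_iff) (intro conjI; use m in linarith)
qed

end

lemma weh_bounds:
  assumes "x \<ge> 3" "\<bar>s - x\<bar> \<le> 1"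
  shows "0 \<le> ww t s" "ww t s \<le> 4 / x" "0 \<le> ee t s" "ee t s \<le> 4 / x" "0 \<le> rho t s" "rho t s \<le> 1"
proof -
  have s: "s > 0" "s \<ge> x / 2" using assms by auto
  show "0 \<le> ww t s" "0 \<le> ee t s" "0 \<le> rho t s"
    using ww_pos[OF s(1)] ee_pos[OF s(1)] rho_pos[OF s(1)] by (auto intro: less_imp_le)
  have "2 / s \<le> 4 / x" using s assms by (simp add: field_simps)
  then show "ww t s \<le> 4 / x" using ww_le[OF s(1), of t] by simp
  have "1 / (12 * s) \<le> 4 / x" using s assms by (simp add: field_simps)
  then show "ee t s \<le> 4 / x" using ee_le[OF s(1), of t] by simp
  show "rho t s \<le> 1" using rho_less[OF s(1), of t] by simp
qed

definition det_approx :: "real \<Rightarrow> real \<Rightarrow> real" where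
  "det_approx t x = f0 t x + f1 t x + f2_diffs (ww t x) (ee t x) (rho t x) ! 0"

text \<open>The formal power series solution of the string equation around \<open>rr\<close>, cut off after the second correction.\<close>
definition rcoeff_approx :: "real \<Rightarrow> real \<Rightarrow> real" where
  "rcoeff_approx t x = rr t x * b_diffs (ww t x) (ee t x) (rho t x) ! 0"

lemma ln_one_plus_cubic_bound:
  fixes y :: real
  assumes "y \<ge> 0"
  shows "\<bar>ln (1 + y) - y + y^2 / 2\<bar> \<le> y^3"
proof -
  let ?g = "\<lambda>y::real. ln (1 + y) - y + y^2 / 2"
  have d: "(?g has_real_derivative s^2 / (1 + s)) (at s)" if "s \<ge> 0" for s
    using that by (auto intro!: derivative_eq_intros simp: power2_eq_square field_simps)
  have "?g 0 \<le> ?g y"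
    using assms by (intro DERIV_nonneg_imp_nondecreasing[of 0 y ?g]) (auto intro!: exI d)
  moreover have "y^3 - ?g y \<ge> 0^3 - ?g 0"
  proof (rule DERIV_nonneg_imp_nondecreasing[of 0 y "\<lambda>y. y^3 - ?g y"])
    fix s assume s: "0 \<le> s" "s \<le> y"
    have "s^2 / (1 + s) \<le> s^2 / 1" using s by (intro divide_left_mono) auto
    then have "3 * s^2 - s^2 / (1 + s) \<ge> 0" using zero_le_power2[of s] by linarith
    moreover have "((\<lambda>y. y^3 - ?g y) has_real_derivative 3 * s^2 - s^2 / (1 + s)) (at s)"
      by (rule DERIV_cong, rule DERIV_diff[OF DERIV_power[OF DERIV_ident] d[OF s(1)]]) simp
    ultimately show "\<exists>D. ((\<lambda>y. y^3 - ?g y) has_real_derivative D) (at s) \<and> 0 \<le> D" by blast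
  qed (use assms in auto)
  ultimately show ?thesis by simp
qed

text \<open>\<open>f0\<close> has order x^2, so the remainder reaches order x^-6 with the eighth
  derivative, the sixth one of ln \<open>rr\<close>. For \<open>f1\<close> and
  \<open>f2_diffs\<close>, of orders 0 and -2, the sixth and the fourth derivative do the same. The
  denominators 12 and 360 are 4!/2 and 6!/2.\<close>

lemma f0_second_difference:
  assumes x: "x \<ge> 4"
  shows "\<bar>f0 t (x + 1) + f0 t (x - 1) - 2 * f0 t x - ln (rr t x) - lnr_diffs (ww t x) (ee t x) ! 1 / 12
      - lnr_diffs (ww t x) (ee t x) ! 3 / 360\<bar> \<le> 10^7 * (4 / x)^6"
proof -
  define g where "g = (\<lambda>m. if m = 0 then f0 t else
    if m = 1 then (\<lambda>x. x * ln (rr t x) - 2 * rr t x * dd t x + 18 * rr t x ^ 2 + ln (2 * pi)) else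
    if m = 2 then (\<lambda>x. ln (rr t x)) else (\<lambda>x. lnr_diffs (ww t x) (ee t x) ! (m - 3)))"
  have "\<bar>g 0 (x + 1) + g 0 (x - 1) - (\<Sum>j<4. 2 * g (2 * j) x / fact (2 * j))\<bar> \<le> 2 * (10^7 * (4 / x)^6) / fact (2 * 4)"
  proof (rule second_difference_taylor)
    fix s assume s: "\<bar>s - x\<bar> \<le> 1"
    then have s0: "s > 0" using x by auto
    show "(g m has_real_derivative g (Suc m) s) (at s)" if "m < 2 * 4" for m
    proof -
      have "m = 0 \<or> m = 1 \<or> m = 2 \<or> m = (m - 3) + 3 \<and> m - 3 < 5" using that by linarith
      then consider "m = 0" | "m = 1" | "m = 2" | l where "m = l + 3" "l < 5" by blast
      then show ?thesis
      proof cases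
        case 4
        then show ?thesis using lnr_diffs_deriv[OF s0, of l t] by (simp add: g_def)
      qed (use f0_deriv[OF s0, of t] f0_deriv2[OF s0, of t] ln_rr_deriv[OF s0, of t UNIV] in
        \<open>simp_all add: g_def lnr_diffs_def\<close>)
    qed
    show "\<bar>g (2 * 4) s\<bar> \<le> 10^7 * (4 / x)^6"
      using lnr_diffs_bound[OF weh_bounds(1-6)[of x s t]] s x by (simp add: g_def)
  qed
  also have "\<dots> \<le> 10^7 * (4 / x)^6" using x by (simp add: fact_numeral)
  also have "(\<Sum>j<4. 2 * g (2 * j) x / fact (2 * j))
     = 2 * f0 t x + ln (rr t x) + lnr_diffs (ww t x) (ee t x) ! 1 / 12 + lnr_diffs (ww t x) (ee t x) ! 3 / 360"
    by (simp add: eval_nat_numeral(2,3) g_def fact_numeral lessThan_Suc)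
  finally show ?thesis by (simp add: g_def algebra_simps)
qed

lemma f1_second_difference:
  assumes x: "x \<ge> 4"
  shows "\<bar>f1 t (x + 1) + f1 t (x - 1) - 2 * f1 t x - f1_diffs (ww t x) (ee t x) ! 1
      - f1_diffs (ww t x) (ee t x) ! 3 / 12\<bar> \<le> 10^8 * (4 / x)^6"
proof -
  define g where "g = (\<lambda>m. if m = 0 then f1 t else (\<lambda>x. f1_diffs (ww t x) (ee t x) ! (m - 1)))"
  have "\<bar>g 0 (x + 1) + g 0 (x - 1) - (\<Sum>j<3. 2 * g (2 * j) x / fact (2 * j))\<bar> \<le> 2 * (10^8 * (4 / x)^6) / fact (2 * 3)"
  proof (rule second_difference_taylor)
    fix s assume s: "\<bar>s - x\<bar> \<le> 1"
    then have s0: "s > 0" using x by auto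
    show "(g m has_real_derivative g (Suc m) s) (at s)" if "m < 2 * 3" for m
      using f1_diffs_deriv[OF s0, of "m - 1" t] f1_deriv[OF s0, of t] that
      by (cases m) (simp_all add: g_def)
    show "\<bar>g (2 * 3) s\<bar> \<le> 10^8 * (4 / x)^6"
      using f1_diffs_bound[OF weh_bounds(1-6)[of x s t]] s x by (simp add: g_def)
  qed
  also have "\<dots> \<le> 10^8 * (4 / x)^6" using x by (simp add: fact_numeral)
  also have "(\<Sum>j<3. 2 * g (2 * j) x / fact (2 * j))
     = 2 * f1 t x + f1_diffs (ww t x) (ee t x) ! 1 + f1_diffs (ww t x) (ee t x) ! 3 / 12"
    by (simp add: eval_nat_numeral(2,3) g_def fact_numeral lessThan_Suc)
  finally show ?thesis by (simp add: g_def algebra_simps)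
qed

lemma f2_second_difference:
  fixes t x :: real
  assumes x: "x \<ge> 4"
  defines "g \<equiv> \<lambda>m x. f2_diffs (ww t x) (ee t x) (rho t x) ! m"
  shows "\<bar>g 0 (x + 1) + g 0 (x - 1) - 2 * g 0 x - g 2 x\<bar> \<le> 10^8 * (4 / x)^6"
proof -
  have "\<bar>g 0 (x + 1) + g 0 (x - 1) - (\<Sum>j<2. 2 * g (2 * j) x / fact (2 * j))\<bar> \<le> 2 * (10^8 * (4 / x)^6) / fact (2 * 2)"
  proof (rule second_difference_taylor)
    fix s assume s: "\<bar>s - x\<bar> \<le> 1"
    then have s0: "s > 0" using x by auto
    show "(g m has_real_derivative g (Suc m) s) (at s)" if "m < 2 * 2" for m
      using f2_diffs_deriv[OF s0, of m t] that by (simp add: g_def)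
    show "\<bar>g (2 * 2) s\<bar> \<le> 10^8 * (4 / x)^6"
      using f2_diffs_bound[OF weh_bounds[of x s t]] s x by (simp add: g_def)
  qed
  also have "\<dots> \<le> 10^8 * (4 / x)^6" using x by (simp add: fact_numeral)
  also have "(\<Sum>j<2. 2 * g (2 * j) x / fact (2 * j)) = 2 * g 0 x + g 2 x"
    by (simp add: eval_nat_numeral(2,3) fact_numeral lessThan_Suc)
  finally show ?thesis by (simp add: algebra_simps)
qed

text \<open>\<open>y\<close> is the relative correction of \<open>rr\<close>. It is nonnegative
  because 6 e^2 outweighs the e^4 term as soon as \<open>e\<close> is small. In the logarithm, -18
  e^4 comes from the square of 6 e^2.\<close>

lemma b_diffs_0_bounds:
  fixes t x :: real
  assumes x: "x \<ge> 100"
  defines "y \<equiv> b_diffs (ww t x) (ee t x) (rho t x) ! 0 - 1"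
  shows "0 \<le> y" "y \<le> 1140 * ee t x ^ 2" "y \<le> 1 / 1000"
    "\<bar>ln (1 + y) - (6 * ee t x ^ 2 + (630 - 10584 * rho t x) * ee t x ^ 4 - 18 * ee t x ^ 4)\<bar> \<le> 10 ^ 10 * (4 / x) ^ 6"
proof -
  define e where "e = ee t x"
  define z where "z = 630 - 10584 * rho t x"
  have y: "y = 6 * e^2 + z * e^4" by (simp add: y_def b_diffs_def z_def e_def algebra_simps)
  \<comment> \<open>1134 is 10584 / 6 - 630, from \<open>rho\<close> lying between 0 and 1/6; the
    later 1140 is 6 + 1134.\<close>
  have z: "\<bar>z\<bar> \<le> 1134" using rho_pos[of x t] rho_less[of x t] x by (auto simp: z_def abs_le_iff)
  have e0: "0 \<le> e" using ee_pos[of x t] x by (simp add: e_def)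
  have e1: "e \<le> 1 / (12 * x)" using ee_le[of x t] x by (simp add: e_def)
  also have "\<dots> \<le> 1 / 1200" using x by (simp add: field_simps)
  finally have e2: "e \<le> 1 / 1200" .
  have esq: "e^2 \<le> (1/1200)^2" using e0 e2 by (intro power_mono)
  have e4: "e^4 = e^2 * e^2" by (simp add: power2_eq_square power4_eq_xxxx)
  have e4': "e^4 \<le> e^2 * (1/1200)^2" unfolding e4 using esq by (intro mult_left_mono) auto
  have ze: "\<bar>z * e^4\<bar> \<le> 1134 * e^4" unfolding abs_mult using z e0 by (simp add: mult_right_mono)
  have e4nn: "0 \<le> e^4" "0 \<le> e^2" by auto
  show y0: "0 \<le> y" unfolding y using ze e4' e4nn by (simp add: abs_le_iff power2_eq_square)
  show y1: "y \<le> 1140 * ee t x ^ 2" unfolding y e_def[symmetric] using ze e4' e4nn by (simp add: abs_le_iff power2_eq_square)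
  then show "y \<le> 1 / 1000" unfolding e_def[symmetric] using esq by (simp add: power2_eq_square)
  have yy: "y - y^2 / 2 - (6 * e^2 + z * e^4 - 18 * e^4) = - (6 * z) * e^6 - z^2 / 2 * e^8"
    unfolding y by (simp add: power2_eq_square eval_nat_numeral algebra_simps)
  have "e \<le> 4 / x" using e1 x by (simp add: field_simps)
  then have e6: "e^6 \<le> (4 / x)^6" using e0 by (intro power_mono)
  have "e^8 = e^6 * e^2" by (simp flip: power_add)
  also have "\<dots> \<le> e^6 * 1" using esq e0 by (intro mult_left_mono) (auto simp: power2_eq_square)
  finally have e8: "e^8 \<le> e^6" by simp
  have z2: "z^2 \<le> 1134^2" using z abs_le_square_iff[of z 1134] by simp
  have "\<bar>- (6 * z) * e^6 - z^2 / 2 * e^8\<bar> \<le> \<bar>(6 * z) * e^6\<bar> + \<bar>z^2 / 2 * e^8\<bar>"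
    by (rule order.trans[OF abs_triangle_ineq4]) simp
  also have "\<bar>(6 * z) * e^6\<bar> \<le> 6804 * e^6" unfolding abs_mult using z e0 by (intro mult_mono) auto
  also have "\<bar>z^2 / 2 * e^8\<bar> \<le> (1134^2 / 2) * e^6" unfolding abs_mult using z2 e8 e0 by (intro mult_mono) auto
  finally have a: "\<bar>y - y^2 / 2 - (6 * e^2 + z * e^4 - 18 * e^4)\<bar> \<le> 10^6 * e^6"
    unfolding yy using zero_le_power[OF e0, of 6] by simp
  have "y^3 \<le> (1140 * e^2)^3" using y0 y1 unfolding e_def by (intro power_mono)
  also have "\<dots> = 1140^3 * e^6" by (simp add: power_mult_distrib flip: power_mult)
  finally have b: "\<bar>ln (1 + y) - y + y^2 / 2\<bar> \<le> 1140^3 * e^6"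
    using ln_one_plus_cubic_bound[OF y0] by linarith
  have "\<bar>ln (1 + y) - (6 * e^2 + z * e^4 - 18 * e^4)\<bar>
     \<le> \<bar>ln (1 + y) - y + y^2 / 2\<bar> + \<bar>y - y^2 / 2 - (6 * e^2 + z * e^4 - 18 * e^4)\<bar>" by linarith
  also have "\<dots> \<le> 10^10 * e^6" using a b zero_le_power[OF e0, of 6] by simp
  also have "\<dots> \<le> 10^10 * (4 / x)^6" using e6 by simp
  finally show "\<bar>ln (1 + y) - (6 * ee t x ^ 2 + (630 - 10584 * rho t x) * ee t x ^ 4 - 18 * ee t x ^ 4)\<bar> \<le> 10 ^ 10 * (4 / x) ^ 6"
    unfolding e_def z_def .
qed

lemma rcoeff_approx_pos: "x \<ge> 100 \<Longrightarrow> rcoeff_approx t x > 0"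
  unfolding rcoeff_approx_def using b_diffs_0_bounds(1)[of x t] rr_pos[of x t] by (intro mult_pos_pos) auto

lemma det_approx_second_difference:
  assumes x: "x \<ge> 100"
  shows "\<bar>det_approx t (x + 1) + det_approx t (x - 1) - 2 * det_approx t x - ln (rcoeff_approx t x)\<bar> \<le> 10^11 * (4 / x)^6"
proof -
  let ?w = "ww t x" and ?e = "ee t x" and ?h = "rho t x"
  have x4: "x \<ge> 4" using x by simp
  have lnb: "ln (rcoeff_approx t x) = ln (rr t x) + ln (1 + (b_diffs ?w ?e ?h ! 0 - 1))"
    unfolding rcoeff_approx_def using b_diffs_0_bounds(1)[OF x, of t] rr_pos[of x t] x by (simp add: ln_mult)
  \<comment> \<open>This identity determines \<open>f1\<close> and \<open>f2_diffs\<close>: at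
    orders x^-2 and x^-4 the second derivative of the new term has to cancel what the Taylor terms
    of the previous ones leave over. All powers of \<open>w\<close> disappear.\<close>
  have id: "lnr_diffs ?w ?e ! 1 / 12 + lnr_diffs ?w ?e ! 3 / 360 + f1_diffs ?w ?e ! 1 + f1_diffs ?w ?e ! 3 / 12
     + f2_diffs ?w ?e ?h ! 2 = 6 * ?e^2 + (630 - 10584 * ?h) * ?e^4 - 18 * ?e^4"
    by (simp add: lnr_diffs_def f1_diffs_def f2_diffs_def field_simps)
  show ?thesis
    using f0_second_difference[OF x4, of t] f1_second_difference[OF x4, of t] f2_second_difference[OF x4, of t]
      b_diffs_0_bounds(4)[OF x, of t] id zero_le_power[of "4 / x" 6] x
    unfolding det_approx_def lnb abs_le_iff by simp
qed

text \<open>The even entries are linear in \<open>w\<close>, so multiplication by \<open>h\<close>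
  with \<open>w * h = e\<close> leaves polynomials in \<open>e\<close> and \<open>h\<close> alone,
  which are algebraically independent enough for a comparison of coefficients.\<close>

lemma rho_b_diffs:
  fixes t x :: real
  assumes "x > 0"
  defines "w \<equiv> ww t x" and "e \<equiv> ee t x" and "h \<equiv> rho t x"
  shows "h * b_diffs w e h ! 2 = - 3 * e^2 - 162 * e^4 - 37422 * e^6 + 5184 * e^4 * h + 3020976 * e^6 * h - 37721376 * e^6 * h^2"
    "h * b_diffs w e h ! 4 = - 1620 * e^4 - 631800 * e^6 - 438082344 * e^8 + 14929920 * e^6 * h + 24381725760 * e^8 * h - 264804059520 * e^8 * h^2"
proof -
  have e: "e = w * h" using ww_rho[OF assms(1), of t] by (simp add: w_def e_def h_def)
  show "h * b_diffs w e h ! 2 = - 3 * e^2 - 162 * e^4 - 37422 * e^6 + 5184 * e^4 * h + 3020976 * e^6 * h - 37721376 * e^6 * h^2"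
    "h * b_diffs w e h ! 4 = - 1620 * e^4 - 631800 * e^6 - 438082344 * e^8 + 14929920 * e^6 * h + 24381725760 * e^8 * h - 264804059520 * e^8 * h^2"
    unfolding b_diffs_def e by (simp_all add: algebra_simps eval_nat_numeral)
qed

definition resid_poly :: "real \<Rightarrow> real \<Rightarrow> real" where
  "resid_poly e h = - 187488 - 74468808 * e^2 - 551573064 * e^4 - 45998646120 * e^6 + 8701344 * h + 4130002728 * e^2 * h + 31662441216 * e^4 * h + 3332858459616 * e^6 * h - 76204800 * h^2 - 44776416384 * e^2 * h^2 - 402617392128 * e^4 * h^2 - 70813790490240 * e^6 * h^2 + 672126336 * e^2 * h^3 + 798486087168 * e^4 * h^3 + 467114360993280 * e^6 * h^3"

text \<open>The string equation divided by \<open>2 * rr * dd\<close>, with the neighbours replaced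
  by their Taylor polynomial of degree 4. The term \<open>1 - 6 * rho\<close> is x / (2
  \<open>rr\<close> \<open>dd\<close>). The coefficients of \<open>B 0\<close> make all orders below
  e^6 cancel.\<close>

lemma string_residual_identity:
  fixes t x :: real
  assumes "x > 0"
  defines "B \<equiv> \<lambda>k. b_diffs (ww t x) (ee t x) (rho t x) ! k"
  shows "B 0 * (2 * rho t x * (3 * B 0 + B 2 + B 4 / 12) - 12 * rho t x + 1) - (1 - 6 * rho t x)
    = ee t x ^ 6 * resid_poly (ee t x) (rho t x)"
proof -
  have B2: "rho t x * B 2 = - 3 * ee t x^2 - 162 * ee t x^4 - 37422 * ee t x^6 + 5184 * ee t x^4 * rho t x + 3020976 * ee t x^6 * rho t x - 37721376 * ee t x^6 * rho t x^2" unfolding B_def by (rule rho_b_diffs(1)[OF assms(1)])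
  have B4: "rho t x * B 4 = - 1620 * ee t x^4 - 631800 * ee t x^6 - 438082344 * ee t x^8 + 14929920 * ee t x^6 * rho t x + 24381725760 * ee t x^8 * rho t x - 264804059520 * ee t x^8 * rho t x^2" unfolding B_def by (rule rho_b_diffs(2)[OF assms(1)])
  have B0: "B 0 = 1 + 6 * ee t x ^ 2 + 630 * ee t x ^ 4 - 10584 * ee t x ^ 4 * rho t x"
    by (simp add: B_def b_diffs_def)
  have "B 0 * (2 * rho t x * (3 * B 0 + B 2 + B 4 / 12) - 12 * rho t x + 1) - (1 - 6 * rho t x)
      = B 0 * (6 * rho t x * B 0 + 2 * (rho t x * B 2) + rho t x * B 4 / 6 - 12 * rho t x + 1) - (1 - 6 * rho t x)"
    by (simp add: algebra_simps)
  also have "\<dots> = ee t x ^ 6 * resid_poly (ee t x) (rho t x)"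
    unfolding B2 B4 B0 resid_poly_def by (simp add: field_simps eval_nat_numeral)
  finally show ?thesis .
qed

lemma resid_poly_bound:
  assumes "0 \<le> e" "e \<le> 1" "0 \<le> h" "h \<le> 1"
  shows "\<bar>resid_poly e h\<bar> \<le> 1000000000000000"
proof -
  have ab: "0 \<le> e ^ i * h ^ j" "e ^ i * h ^ j \<le> 1" for i j
    using assms by (auto intro!: mult_le_one power_le_one)
  note m = ab[of 0 1, unfolded power_0 power_one_right mult_1_left mult_1_right]
    ab[of 0 2, unfolded power_0 power_one_right mult_1_left mult_1_right]
    ab[of 0 3, unfolded power_0 power_one_right mult_1_left mult_1_right]
    ab[of 2 0, unfolded power_0 power_one_right mult_1_left mult_1_right]
    ab[of 2 1, unfolded power_0 power_one_right mult_1_left mult_1_right]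
    ab[of 2 2, unfolded power_0 power_one_right mult_1_left mult_1_right]
    ab[of 2 3, unfolded power_0 power_one_right mult_1_left mult_1_right]
    ab[of 4 0, unfolded power_0 power_one_right mult_1_left mult_1_right]
    ab[of 4 1, unfolded power_0 power_one_right mult_1_left mult_1_right]
    ab[of 4 2, unfolded power_0 power_one_right mult_1_left mult_1_right]
    ab[of 4 3, unfolded power_0 power_one_right mult_1_left mult_1_right]
    ab[of 6 0, unfolded power_0 power_one_right mult_1_left mult_1_right]
    ab[of 6 1, unfolded power_0 power_one_right mult_1_left mult_1_right]
    ab[of 6 2, unfolded power_0 power_one_right mult_1_left mult_1_right]
    ab[of 6 3, unfolded power_0 power_one_right mult_1_left mult_1_right]
  show ?thesis
    unfolding resid_poly_def abs_le_iff by (intro conjI; use m in linarith)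
qed

lemma rr_mono: "0 < x \<Longrightarrow> x \<le> y \<Longrightarrow> rr t x \<le> rr t y"
  by (simp add: rr_def dd_def)

text \<open>A relative bound on the increment, free of \<open>t\<close>: \<open>dd\<close> grows by
  at most its derivative 6 / \<open>dd\<close>, and \<open>ww\<close> is at most 2 / x. It allows
  values of \<open>rr\<close> at neighbouring points to be exchanged at the cost of a constant
  factor.\<close>

lemma rr_Suc_le: assumes "x > 0" shows "rr t (x + 1) \<le> rr t x * (1 + 1 / x)"
proof -
  have d: "dd t x > 0" by (rule dd_pos[OF assms])
  have "dd t (x + 1) \<le> dd t x + 6 / dd t x"
    unfolding dd_def[of t "x + 1"]
  proof (rule real_le_lsqrt)
    have "(dd t x + 6 / dd t x)^2 = dd t x ^ 2 + 12 + 36 / dd t x ^ 2"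
      using d by (simp add: power2_eq_square field_simps)
    then show "t^2 + 12 * (x + 1) \<le> (dd t x + 6 / dd t x)^2"
      using dd_sq[OF assms, of t] zero_le_power2[of "dd t x"] by simp
  qed (use d assms in \<open>auto intro: add_nonneg_nonneg\<close>)
  then have "rr t (x + 1) \<le> rr t x + 1 / (2 * dd t x)" by (simp add: rr_def field_simps)
  also have "1 / (2 * dd t x) = rr t x * (ww t x / 2)" using rr_ww[OF assms, of t] by simp
  also have "\<dots> \<le> rr t x * (1 / x)"
    using ww_le[OF assms, of t] rr_pos[OF assms, of t] by (intro mult_left_mono) auto
  finally show ?thesis by (simp add: algebra_simps)
qed

text \<open>The error is measured relative to \<open>rr\<close>: within distance 1 the factor
  \<open>rr\<close> at most doubles, and the order x^-6 comes from the polynomial factor.\<close>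

lemma rcoeff_approx_second_difference:
  fixes t x :: real
  assumes x: "x \<ge> 4"
  defines "B \<equiv> \<lambda>k. b_diffs (ww t x) (ee t x) (rho t x) ! k"
  shows "\<bar>rcoeff_approx t (x + 1) + rcoeff_approx t (x - 1) - rr t x * (2 * B 0 + B 2 + B 4 / 12)\<bar> \<le> rr t x * (10^14 * (4 / x)^6)"
proof -
  define g where "g = (\<lambda>m x. rr t x * b_diffs (ww t x) (ee t x) (rho t x) ! m)"
  have "\<bar>g 0 (x + 1) + g 0 (x - 1) - (\<Sum>j<3. 2 * g (2 * j) x / fact (2 * j))\<bar>
     \<le> 2 * (2 * rr t x * (10^16 * (4 / x)^6)) / fact (2 * 3)"
  proof (rule second_difference_taylor)
    fix s assume s: "\<bar>s - x\<bar> \<le> 1"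
    then have s0: "s > 0" using x by auto
    show "(g m has_real_derivative g (Suc m) s) (at s)" if "m < 2 * 3" for m
      using b_diffs_deriv[OF s0, of m t] that by (simp add: g_def)
    have "rr t s \<le> rr t (x + 1)" using s s0 by (intro rr_mono) auto
    also have "\<dots> \<le> rr t x * (1 + 1 / x)" using x by (intro rr_Suc_le) auto
    also have "\<dots> \<le> rr t x * 2" using x rr_pos[of x t] by (intro mult_left_mono) auto
    finally have "rr t s \<le> 2 * rr t x" by simp
    then have "rr t s * \<bar>b_diffs (ww t s) (ee t s) (rho t s) ! 6\<bar> \<le> 2 * rr t x * (10^16 * (4 / x)^6)"
      using b_diffs_bound[OF weh_bounds[of x s t]] s x rr_pos[of x t] by (intro mult_mono) auto
    then show "\<bar>g (2 * 3) s\<bar> \<le> 2 * rr t x * (10^16 * (4 / x)^6)"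
      using rr_pos[OF s0, of t] by (simp add: g_def abs_mult)
  qed
  also have "\<dots> \<le> rr t x * (10^14 * (4 / x)^6)" using x rr_pos[of x t] by (simp add: fact_numeral)
  also have "(\<Sum>j<3. 2 * g (2 * j) x / fact (2 * j)) = rr t x * (2 * B 0 + B 2 + B 4 / 12)"
    by (simp add: eval_nat_numeral(2,3) g_def B_def fact_numeral lessThan_Suc algebra_simps)
  finally show ?thesis by (simp add: g_def rcoeff_approx_def)
qed

text \<open>The threshold 17/200 lies slightly above 1/12, the limit of \<open>rho\<close> for fixed
  \<open>t\<close>, and keeps the divisor \<open>1 - 6 * rho\<close> at least 49/100.\<close>

lemma string_residual:
  assumes x: "x \<ge> 100" and h: "rho t x \<le> 17 / 200"
  shows "\<bar>4 * rcoeff_approx t x * (rcoeff_approx t (x - 1) + rcoeff_approx t x + rcoeff_approx t (x + 1) - t / 2) / x - 1\<bar> \<le> 10^16 * (4 / x)^6"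
proof -
  define B where "B = (\<lambda>k. b_diffs (ww t x) (ee t x) (rho t x) ! k)"
  define R where "R = rcoeff_approx t (x + 1) + rcoeff_approx t (x - 1) - rr t x * (2 * B 0 + B 2 + B 4 / 12)"
  let ?r = "rr t x" and ?d = "dd t x" and ?h = "rho t x"
  define X where "X = (4 / x)^6"
  have x0: "x > 0" using x by simp
  have p: "?r > 0" "?d > 0" "?h > 0" using rr_pos dd_pos rho_pos x0 by auto
  have R: "\<bar>R\<bar> \<le> ?r * (100000000000000 * X)"
    using rcoeff_approx_second_difference[of x t] x unfolding R_def B_def X_def by simp
  have B0: "1 \<le> B 0" "B 0 \<le> 2" using b_diffs_0_bounds(1,3)[OF x, of t] by (auto simp: B_def)
  have xd: "x = 2 * ?r * ?d * (1 - 6 * ?h)"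
    by (subst x_eq[OF x0, of t]) (use p in \<open>simp add: rho_def power2_eq_square field_simps\<close>)
  have dh: "?d * ?h = ?r" using p by (simp add: rho_def)
  have bbx: "rcoeff_approx t x = ?r * B 0" by (simp add: rcoeff_approx_def B_def)
  define S where "S = 3 * B 0 + B 2 + B 4 / 12"
  define Z where "Z = 2 * ?h * S - 12 * ?h + 1"
  have sum: "rcoeff_approx t (x - 1) + rcoeff_approx t x + rcoeff_approx t (x + 1) - t / 2 = ?d / 2 * (Z + 2 * R / ?d)"
  proof -
    have "rcoeff_approx t (x - 1) + rcoeff_approx t x + rcoeff_approx t (x + 1) - t / 2 = R + ?r * S - 6 * ?r + ?d / 2"
      unfolding R_def bbx S_def using t_eq[of t x] by (simp add: algebra_simps)
    also have "\<dots> = R + (?d * ?h) * S - 6 * (?d * ?h) + ?d / 2" unfolding dh ..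
    also have "\<dots> = ?d / 2 * (Z + 2 * R / ?d)" using p unfolding Z_def by (simp add: field_simps)
    finally show ?thesis .
  qed
  have Z: "B 0 * Z = (1 - 6 * ?h) + ee t x ^ 6 * resid_poly (ee t x) ?h"
    using string_residual_identity[OF x0, of t] unfolding Z_def S_def B_def by linarith
  let ?Y = "ee t x ^ 6 * resid_poly (ee t x) ?h + B 0 * (2 * R / ?d)"
  have "4 * rcoeff_approx t x * (rcoeff_approx t (x - 1) + rcoeff_approx t x + rcoeff_approx t (x + 1) - t / 2) = 4 * (?r * B 0) * (?d / 2 * (Z + 2 * R / ?d))"
    unfolding sum unfolding bbx ..
  also have "\<dots> = 2 * ?r * ?d * (B 0 * Z + B 0 * (2 * R / ?d))" by (simp add: algebra_simps)
  also have "\<dots> = (2 * ?r * ?d * (1 - 6 * ?h)) + (2 * ?r * ?d * (1 - 6 * ?h)) * (?Y / (1 - 6 * ?h))"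
  proof -
    have "(2 * ?r * ?d * (1 - 6 * ?h)) * (?Y / (1 - 6 * ?h)) = 2 * ?r * ?d * ?Y" using h by simp
    then show ?thesis unfolding Z by (simp add: algebra_simps)
  qed
  also have "\<dots> = x + x * (?Y / (1 - 6 * ?h))"
    unfolding xd[symmetric] ..
  finally have *: "4 * rcoeff_approx t x * (rcoeff_approx t (x - 1) + rcoeff_approx t x + rcoeff_approx t (x + 1) - t / 2) = x + x * (?Y / (1 - 6 * ?h))" .
  have **: "4 * rcoeff_approx t x * (rcoeff_approx t (x - 1) + rcoeff_approx t x + rcoeff_approx t (x + 1) - t / 2) / x - 1 = ?Y / (1 - 6 * ?h)"
  proof -
    have "q / x - 1 = c" if "q = x + x * c" for q c using x0 that by (simp add: field_simps)
    then show ?thesis using * .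
  qed
  have e: "0 \<le> ee t x" "ee t x \<le> 4 / x" using weh_bounds[of x x t] x by auto
  have "4 / x \<le> 1" using x by simp
  then have e1: "ee t x \<le> 1" using e(2) by linarith
  have X0: "0 \<le> X" by (simp add: X_def)
  have h1: "?h \<le> 1" using h by simp
  have "\<bar>ee t x ^ 6 * resid_poly (ee t x) ?h\<bar> \<le> X * 1000000000000000"
    unfolding abs_mult using resid_poly_bound[of "ee t x" ?h] e e1 h1 p unfolding X_def by (intro mult_mono) (auto intro!: power_mono)
  moreover have "\<bar>B 0 * (2 * R / ?d)\<bar> \<le> X * 1000000000000000"
  proof -
    have "\<bar>B 0 * (2 * R / ?d)\<bar> = B 0 * (2 * \<bar>R\<bar> / ?d)" using B0 p by (simp add: abs_mult)
    also have "\<dots> \<le> 2 * (2 * (?r * (100000000000000 * X)) / ?d)"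
      using B0 R p by (intro mult_mono divide_right_mono) auto
    also have "\<dots> = (4 * 100000000000000 * X) * ?h" by (simp add: rho_def)
    also have "\<dots> \<le> (4 * 100000000000000 * X) * 1" using h1 X0 by (intro mult_left_mono) auto
    finally show ?thesis by (rule order.trans) (use X0 in simp)
  qed
  ultimately have "\<bar>?Y\<bar> \<le> X * 1000000000000000 + X * 1000000000000000"
    by (intro order.trans[OF abs_triangle_ineq] add_mono)
  then have Y: "\<bar>?Y\<bar> \<le> 2000000000000000 * X" by simp
  have "\<bar>?Y / (1 - 6 * ?h)\<bar> = \<bar>?Y\<bar> / (1 - 6 * ?h)" using h by simp
  also have "\<dots> \<le> (2000000000000000 * X) / (49 / 100)" using Y h X0 by (intro frac_le) auto
  also have "\<dots> \<le> 10^16 * X" using X0 by simp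
  finally show ?thesis unfolding ** X_def .
qed

section \<open>Errors of the recurrence coefficients and of the determinants\<close>

text \<open>The bound at \<open>n\<close> involves both neighbours, so it cannot be solved upwards
  from initial data. Iterating it \<open>m\<close> times uses indices from \<open>n - m\<close> on;
  each round gains a factor \<open>\<theta>\<close>, and the a priori bound 1 is enough to start.
  The source terms sum to a geometric series.\<close>

lemma max_contraction_decay:
  fixes a :: "nat \<Rightarrow> real"
  assumes th: "0 \<le> \<theta>" "\<theta> < 1" and K: "K \<ge> 0" and N: "N \<ge> 1"
    and le1: "\<And>n. n \<ge> N \<Longrightarrow> a n \<le> 1"
    and step: "\<And>n. n > N \<Longrightarrow> a n \<le> K / real n ^ 6 + \<theta> * max (a (n - 1)) (a (n + 1))"
  shows "n \<ge> N + m \<Longrightarrow> a n \<le> K / real (n - m) ^ 6 / (1 - \<theta>) + \<theta> ^ m"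
proof (induction m arbitrary: n)
  case 0
  have "0 \<le> K / real n ^ 6 / (1 - \<theta>)" using th K by simp
  then show ?case using le1[of n] 0 by simp
next
  case (Suc m)
  define Q where "Q = K / real (n - Suc m) ^ 6"
  have pos: "n - Suc m \<ge> 1" using Suc.prems N by auto
  have mono: "K / real k ^ 6 \<le> Q" if "k \<ge> n - Suc m" for k
    unfolding Q_def using that pos K by (intro divide_left_mono power_mono) auto
  have b: "a k \<le> Q / (1 - \<theta>) + \<theta> ^ m" if "k = n - 1 \<or> k = n + 1" for k
  proof -
    have "a k \<le> K / real (k - m) ^ 6 / (1 - \<theta>) + \<theta> ^ m" using that Suc.prems by (intro Suc.IH) auto
    also have "K / real (k - m) ^ 6 / (1 - \<theta>) \<le> Q / (1 - \<theta>)"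
      using th that Suc.prems by (intro divide_right_mono mono) auto
    finally show ?thesis by simp
  qed
  have "a n \<le> K / real n ^ 6 + \<theta> * max (a (n - 1)) (a (n + 1))" using Suc.prems by (intro step) auto
  also have "\<dots> \<le> Q + \<theta> * (Q / (1 - \<theta>) + \<theta> ^ m)"
    using b th by (intro add_mono mono mult_left_mono) auto
  also have "\<dots> = Q / (1 - \<theta>) + \<theta> ^ Suc m" using th by (simp add: field_simps)
  finally show ?case by (simp add: Q_def)
qed

text \<open>The lower bound on \<open>x\<close> gives dd \<ge> 50 T, and 1/12 + 1/600 = 17/200. Only
  an upper bound on \<open>t\<close> is involved, since negative \<open>t\<close> make
  \<open>rho\<close> smaller than 1/12.\<close>

lemma rho_le:
  assumes T: "T \<ge> 0" "t \<le> T" and x: "x \<ge> 250 * T^2 + 1000"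
  shows "rho t x \<le> 17 / 200"
proof -
  have x0: "x > 0" using x zero_le_power2[of T] by linarith
  have d: "dd t x > 0" by (rule dd_pos[OF x0])
  have "(50 * T)^2 \<le> dd t x ^ 2"
  proof -
    have "(50 * T)^2 = 2500 * T^2" by (simp add: power_mult_distrib)
    then show ?thesis unfolding dd_sq[OF x0] using x zero_le_power2[of t] zero_le_power2[of T] by linarith
  qed
  then have "50 * T \<le> dd t x" using d by (elim power2_le_imp_le) auto
  then have "50 * t \<le> dd t x" using T by linarith
  then have "t / (12 * dd t x) \<le> 1 / 600" using d by (simp add: field_simps)
  then show ?thesis unfolding rho_eq[OF x0] by simp
qed

lemma rcoeff_approx_le_rr: assumes "x \<ge> 100" shows "rr t x \<le> rcoeff_approx t x" "rcoeff_approx t x \<le> rr t x * (1001 / 1000)"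
proof -
  have r: "rr t x > 0" using assms by (intro rr_pos) auto
  note B = b_diffs_0_bounds(1,3)[OF assms, of t]
  have "rr t x * 1 \<le> rcoeff_approx t x" unfolding rcoeff_approx_def using B r by (intro mult_left_mono) auto
  then show "rr t x \<le> rcoeff_approx t x" by simp
  show "rcoeff_approx t x \<le> rr t x * (1001 / 1000)" unfolding rcoeff_approx_def using B r by (intro mult_left_mono) auto
qed

lemma x_rho: assumes "x > 0" shows "x = 2 * rr t x * dd t x * (1 - 6 * rho t x)"
  by (subst x_eq[OF assms, of t]) (use dd_pos[OF assms, of t] in \<open>simp add: rho_def power2_eq_square field_simps\<close>)

text \<open>The inputs of the contraction. Up to the factor 1001/1000, the first quantity is 2
  \<open>rho\<close> / (1 - 6 \<open>rho\<close>), which is 1/3 at \<open>rho\<close> = 1/12; the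
  bound 2/5 leaves room.\<close>

lemma rcoeff_approx_ratio:
  assumes x: "x \<ge> 1000" and h: "rho t x \<le> 17 / 200"
  shows "4 * rcoeff_approx t x ^ 2 / x \<le> 2 / 5" "rcoeff_approx t (x + 1) \<le> 101 / 100 * rcoeff_approx t x" "rcoeff_approx t (x - 1) \<le> 101 / 100 * rcoeff_approx t x"
proof -
  have x0: "x > 0" using x by simp
  have p: "rr t x > 0" "dd t x > 0" using x0 by (auto intro: rr_pos dd_pos)
  have "rcoeff_approx t x ^ 2 \<le> (rr t x * (1001 / 1000))^2"
    using rcoeff_approx_le_rr[of x t] x p by (intro power_mono) auto
  then have "4 * rcoeff_approx t x ^ 2 / x \<le> 4 * (rr t x * (1001 / 1000))^2 / x"
    using x0 by (intro divide_right_mono) auto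
  also have "\<dots> = 4 * (1001 / 1000)^2 * rr t x ^ 2 / x"
    by (simp add: power2_eq_square)
  also have "\<dots> = 4 * (1001 / 1000)^2 * rr t x ^ 2 / (2 * rr t x * dd t x * (1 - 6 * rho t x))"
    by (rule arg_cong[OF x_rho[OF x0, of t], of "\<lambda>z. 4 * (1001 / 1000)^2 * rr t x ^ 2 / z"])
  also have "\<dots> = 2 * (1001 / 1000)^2 * rho t x / (1 - 6 * rho t x)"
    using p by (simp add: power2_eq_square rho_def)
  also have "\<dots> \<le> 2 * (1001 / 1000)^2 * (17 / 200) / (1 - 6 * (17 / 200))"
    using h rho_pos[OF x0, of t] by (intro frac_le mult_left_mono) auto
  also have "\<dots> \<le> 2 / 5" by (simp add: power2_eq_square)
  finally show "4 * rcoeff_approx t x ^ 2 / x \<le> 2 / 5" .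
  have "rcoeff_approx t (x + 1) \<le> rr t (x + 1) * (1001 / 1000)" using x by (intro rcoeff_approx_le_rr) auto
  also have "\<dots> \<le> (rr t x * (1 + 1 / x)) * (1001 / 1000)" using rr_Suc_le[OF x0, of t] by simp
  also have "\<dots> \<le> (rr t x * (1 + 1 / 1000)) * (1001 / 1000)"
    using x p by (intro mult_right_mono mult_left_mono add_left_mono divide_left_mono) auto
  also have "\<dots> \<le> 101 / 100 * rr t x" using p by simp
  also have "\<dots> \<le> 101 / 100 * rcoeff_approx t x" using rcoeff_approx_le_rr(1)[of x t] x by simp
  finally show "rcoeff_approx t (x + 1) \<le> 101 / 100 * rcoeff_approx t x" .
  have "rcoeff_approx t (x - 1) \<le> rr t (x - 1) * (1001 / 1000)" using x by (intro rcoeff_approx_le_rr) auto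
  also have "\<dots> \<le> rr t x * (1001 / 1000)" using x by (intro mult_right_mono rr_mono) auto
  also have "\<dots> \<le> 101 / 100 * rr t x" using p by simp
  also have "\<dots> \<le> 101 / 100 * rcoeff_approx t x" using rcoeff_approx_le_rr(1)[of x t] x by simp
  finally show "rcoeff_approx t (x - 1) \<le> 101 / 100 * rcoeff_approx t x" .
qed

text \<open>The a priori bound for the contraction. Dropping the nonnegative neighbours from the
  string equation leaves 4 y (y - t/2) \<le> x, whereas y > 2 b would push the left side beyond
  \<open>x\<close> as long as \<open>rho\<close> is at most 1/10.\<close>

lemma rcoeff_le_2bb:
  assumes n: "real n \<ge> 1000" and h: "rho t (real n) \<le> 17 / 200"
  shows "rcoeff t n \<le> 2 * rcoeff_approx t (real n)"
proof (rule ccontr)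
  define x where "x = real n"
  define b where "b = rcoeff_approx t x"
  define y where "y = rcoeff t n"
  assume "\<not> rcoeff t n \<le> 2 * rcoeff_approx t (real n)"
  then have y: "y > 2 * b" by (simp add: y_def b_def x_def)
  have x0: "x > 0" using n by (simp add: x_def)
  have p: "rr t x > 0" "dd t x > 0" using x0 by (auto intro: rr_pos dd_pos)
  have br: "b \<ge> rr t x" using rcoeff_approx_le_rr(1)[of x t] n by (simp add: x_def b_def)
  have h': "rho t x \<le> 17 / 200" "rho t x * dd t x = rr t x" using h p by (auto simp: x_def rho_def)
  have c: "2 * b - t / 2 \<ge> dd t x / 2 * (1 - 8 * rho t x)"
    using br t_eq[of t x] h'(2) by (simp add: algebra_simps)
  have c0: "dd t x / 2 * (1 - 8 * rho t x) \<ge> dd t x / 2 * (32 / 100)"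
    using h' p by (intro mult_left_mono) auto
  have "4 * (2 * rr t x) * (dd t x / 2 * (1 - 8 * rho t x)) \<le> 4 * (2 * b) * (2 * b - t / 2)"
    using br c c0 p by (intro mult_mono) auto
  also have "\<dots> < 4 * y * (y - t / 2)"
  proof -
    have "2 * b - t / 2 > 0" using c c0 p by linarith
    then have "4 * (2 * b) * (2 * b - t / 2) < 4 * y * (2 * b - t / 2)"
      using y by (intro mult_strict_right_mono) auto
    also have "\<dots> \<le> 4 * y * (y - t / 2)" using y p br by (intro mult_left_mono) auto
    finally show ?thesis .
  qed
  also have "\<dots> \<le> 4 * y * (rcoeff t (n - 1) + y + rcoeff t (n + 1) - t / 2)"
    using rcoeff_nonneg[of t] by (intro mult_left_mono) (auto simp: y_def)
  also have "\<dots> = x" using string_equation[of n t] n unfolding y_def x_def by simp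
  also have "x = 2 * rr t x * dd t x * (1 - 6 * rho t x)" by (rule x_rho[OF x0])
  finally have "2 * rr t x * dd t x * (2 * (1 - 8 * rho t x)) < 2 * rr t x * dd t x * (1 - 6 * rho t x)"
    by (simp add: algebra_simps)
  then have "2 * (1 - 8 * rho t x) < 1 - 6 * rho t x" using p by (subst (asm) mult_less_cancel_left_pos) auto
  then show False using h' by simp
qed

text \<open>The two string equations are divided by their leading coefficient and subtracted. The
  difference of the reciprocals contributes d / (1 + d) with the same sign as the diagonal term p d,
  so both help; \<open>y \<le> 2 * b\<close> gives 1 / (1 + d) \<ge> 1/2 without any
  linearization.\<close>

lemma relative_error_step:
  fixes b b1 b2 y y1 y2 x t :: real
  assumes pos: "b > 0" "b1 > 0" "b2 > 0" "y > 0" "x > 0"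
    and eqy: "4 * y * (y1 + y + y2 - t / 2) = x"
    and eqb: "4 * b * (b1 + b + b2 - t / 2) / x - 1 = \<kappa>"
    and le: "4 * b^2 / x \<le> 2 / 5" "b1 \<le> 101 / 100 * b" "b2 \<le> 101 / 100 * b" "y \<le> 2 * b"
  shows "\<bar>y / b - 1\<bar> \<le> 2 * \<bar>\<kappa>\<bar> + 9 / 10 * max \<bar>y1 / b1 - 1\<bar> \<bar>y2 / b2 - 1\<bar>"
proof -
  define d d1 d2 where "d = y / b - 1" and "d1 = y1 / b1 - 1" and "d2 = y2 / b2 - 1"
  define p where "p = 4 * b^2 / x"
  define M where "M = max \<bar>d1\<bar> \<bar>d2\<bar>"
  have y: "y = b * (1 + d)" "y1 = b1 * (1 + d1)" "y2 = b2 * (1 + d2)"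
    using pos by (simp_all add: d_def d1_def d2_def)
  have d1': "0 < 1 + d" "1 + d \<le> 2" using pos le by (auto simp: d_def field_simps)
  have p0: "p \<ge> 0" "p \<le> 2 / 5" using pos le by (auto simp: p_def)
  have eqy': "y1 + y + y2 - t / 2 = x / (4 * y)" using eqy pos by (simp add: field_simps)
  have eqb': "b1 + b + b2 - t / 2 = x * (1 + \<kappa>) / (4 * b)" using eqb pos by (simp add: field_simps)
  have "b1 * d1 + b * d + b2 * d2 = x / (4 * y) - x * (1 + \<kappa>) / (4 * b)"
  proof -
    have "b1 * d1 + b * d + b2 * d2 = (y1 + y + y2 - t / 2) - (b1 + b + b2 - t / 2)"
      by (simp add: y algebra_simps)
    then show ?thesis unfolding eqy' eqb' .
  qed
  also have "\<dots> = x / (4 * b) * (1 / (1 + d) - 1 - \<kappa>)"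
  proof -
    have "x / (4 * y) = x / (4 * b) * (1 / (1 + d))" unfolding y(1) by simp
    moreover have "x * (1 + \<kappa>) / (4 * b) = x / (4 * b) * (1 + \<kappa>)" by simp
    ultimately show ?thesis by (simp only: right_diff_distrib distrib_left diff_diff_eq)
  qed
  also have "1 / (1 + d) - 1 = - (d / (1 + d))" using d1' by (simp add: field_simps)
  finally have "4 * b / x * (b1 * d1 + b * d + b2 * d2) = 4 * b / x * (x / (4 * b) * (- (d / (1 + d)) - \<kappa>))" by simp
  also have "\<dots> = - (d / (1 + d)) - \<kappa>" using pos by simp
  finally have main: "d / (1 + d) + p * d = - \<kappa> - 4 * b / x * (b1 * d1 + b2 * d2)"
    using pos by (simp add: p_def power2_eq_square algebra_simps)
  have "\<bar>d\<bar> * (1 / 2 + p) \<le> \<bar>d\<bar> * (1 / (1 + d) + p)"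
    using d1' by (intro mult_left_mono add_right_mono) (auto simp: field_simps)
  also have "\<dots> = \<bar>d / (1 + d) + p * d\<bar>"
  proof -
    have "\<bar>d\<bar> * (1 / (1 + d) + p) = \<bar>d\<bar> * \<bar>1 / (1 + d) + p\<bar>" using d1' p0 by simp
    also have "\<dots> = \<bar>d * (1 / (1 + d) + p)\<bar>" by (simp only: abs_mult)
    finally show ?thesis by (simp add: algebra_simps)
  qed
  also have "\<dots> \<le> \<bar>\<kappa>\<bar> + \<bar>4 * b / x * (b1 * d1 + b2 * d2)\<bar>" unfolding main by linarith
  also have "\<bar>4 * b / x * (b1 * d1 + b2 * d2)\<bar> \<le> 4 * b / x * (2 * (101 / 100 * b * M))"
  proof -
    have "\<bar>b1 * d1\<bar> \<le> 101 / 100 * b * M" unfolding abs_mult using pos le by (intro mult_mono) (auto simp: M_def)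
    moreover have "\<bar>b2 * d2\<bar> \<le> 101 / 100 * b * M" unfolding abs_mult using pos le by (intro mult_mono) (auto simp: M_def)
    ultimately have "\<bar>b1 * d1 + b2 * d2\<bar> \<le> 2 * (101 / 100 * b * M)"
      using abs_triangle_ineq[of "b1 * d1" "b2 * d2"] by linarith
    then have "4 * b / x * \<bar>b1 * d1 + b2 * d2\<bar> \<le> 4 * b / x * (2 * (101 / 100 * b * M))"
      using pos by (intro mult_left_mono) auto
    then show ?thesis using pos by (simp add: abs_mult)
  qed
  also have "4 * b / x * (2 * (101 / 100 * b * M)) = 202 / 100 * p * M" by (simp add: p_def power2_eq_square)
  \<comment> \<open>The factor 9/10 is sufficient because 202/100 p \<le> 9/10 (1/2 + p) amounts to
    112/100 p \<le> 45/100, and p is at most 2/5.\<close>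
  also have "\<bar>\<kappa>\<bar> + 202 / 100 * p * M \<le> (2 * \<bar>\<kappa>\<bar> + 9 / 10 * M) * (1 / 2 + p)"
  proof -
    have "112 / 100 * p * M \<le> 45 / 100 * M" using p0 by (intro mult_right_mono) (auto simp: M_def)
    moreover have "0 \<le> \<bar>\<kappa>\<bar> * p" using p0 by simp
    moreover have "(2 * \<bar>\<kappa>\<bar> + 9 / 10 * M) * (1 / 2 + p) = \<bar>\<kappa>\<bar> + 2 * (\<bar>\<kappa>\<bar> * p) + 45 / 100 * M + 90 / 100 * p * M"
      by (simp add: field_simps)
    ultimately show ?thesis by linarith
  qed
  finally have "\<bar>d\<bar> \<le> 2 * \<bar>\<kappa>\<bar> + 9 / 10 * M" using p0 by (simp add: mult_le_cancel_right)
  then show ?thesis by (simp add: d_def M_def d1_def d2_def)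
qed

lemma rcoeff_relative_error:
  assumes T: "T \<ge> 0"
  obtains C N where "N \<ge> 1" "\<And>t n. t \<le> T \<Longrightarrow> n \<ge> N \<Longrightarrow> \<bar>rcoeff t n / rcoeff_approx t (real n) - 1\<bar> \<le> C / real n ^ 6"
proof -
  define N where "N = nat \<lceil>250 * T^2 + 1000\<rceil>"
  have N: "real n \<ge> 250 * T^2 + 1000" if "n \<ge> N" for n using that unfolding N_def by linarith
  have "real N \<ge> 1000" using N[of N] zero_le_power2[of T] by linarith
  then have N1: "N \<ge> 1000" by simp
  define K where "K = (2::real) * (10^16 * 4^6)"
  have "Bseq (\<lambda>n. real n ^ 6 * (9/10) ^ (n div 2))"
  proof -
    have "(\<lambda>n. real n ^ 6 * (9/10) powr (real n / 2 - 1)) \<longlonglongrightarrow> 0" by real_asymp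
    then have "Bseq (\<lambda>n. real n ^ 6 * (9/10) powr (real n / 2 - 1))" by (intro convergent_imp_Bseq convergentI)
    then obtain B where B: "\<And>n. norm (real n ^ 6 * (9/10) powr (real n / 2 - 1)) \<le> B" by (auto simp: Bseq_def)
    have "norm (real n ^ 6 * (9/10) ^ (n div 2)) \<le> B" for n
    proof -
      have "(9/10::real) ^ (n div 2) = (9/10) powr real (n div 2)" by (simp add: powr_realpow)
      also have "\<dots> \<le> (9/10) powr (real n / 2 - 1)" by (intro powr_mono') auto
      finally have "real n ^ 6 * (9/10) ^ (n div 2) \<le> real n ^ 6 * (9/10) powr (real n / 2 - 1)" by (intro mult_left_mono) auto
      also have "\<dots> \<le> B" using B[of n] by simp
      finally show ?thesis by simp
    qed
    then show ?thesis by (intro BseqI') auto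
  qed
  then obtain B where B: "\<And>n. norm (real n ^ 6 * (9/10) ^ (n div 2)) \<le> B" by (auto simp: Bseq_def)
  have "\<bar>rcoeff t n / rcoeff_approx t (real n) - 1\<bar> \<le> (640 * K + B) / real n ^ 6" if t: "t \<le> T" and n: "n \<ge> 2 * N" for t n
  proof -
    define a where "a n = \<bar>rcoeff t n / rcoeff_approx t (real n) - 1\<bar>" for n
    have bpos: "rcoeff_approx t (real n) > 0" if "n \<ge> N" for n using that N1 by (intro rcoeff_approx_pos) auto
    have h: "rho t (real n) \<le> 17 / 200" if "n \<ge> N" for n using rho_le[OF T t N[OF that]] .
    have "a n \<le> 1" if "n \<ge> N" for n
    proof -
      have "rcoeff t n \<le> 2 * rcoeff_approx t (real n)" using that N1 h[OF that] by (intro rcoeff_le_2bb) auto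
      then have "rcoeff t n / rcoeff_approx t (real n) \<le> 2" using bpos[OF that] by (simp add: field_simps)
      moreover have "0 \<le> rcoeff t n / rcoeff_approx t (real n)" using bpos[OF that] rcoeff_nonneg[of t n] by simp
      ultimately show ?thesis unfolding a_def by linarith
    qed
    moreover have "a n \<le> K / real n ^ 6 + 9 / 10 * max (a (n - 1)) (a (n + 1))" if n: "n > N" for n
    proof -
      let ?k = "4 * rcoeff_approx t (real n) * (rcoeff_approx t (real n - 1) + rcoeff_approx t (real n) + rcoeff_approx t (real n + 1) - t / 2) / real n - 1"
      have r: "real (n - 1) = real n - 1" "real (n + 1) = real n + 1" using n by auto
      have pos: "rcoeff_approx t (real n - 1) > 0" "rcoeff_approx t (real n + 1) > 0"
        using bpos[of "n - 1"] bpos[of "n + 1"] n unfolding r by auto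
      have nN: "n \<ge> N" and x0: "real n \<ge> 1000" and n0: "real n > 0" using n N1 by auto
      have y0: "rcoeff t n > 0" using n by (intro rcoeff_pos) auto
      have se: "4 * rcoeff t n * (rcoeff t (n - 1) + rcoeff t n + rcoeff t (n + 1) - t / 2) = real n"
        using n by (intro string_equation) auto
      have k: "\<bar>?k\<bar> \<le> 10^16 * (4 / real n)^6" using x0 by (intro string_residual h nN) auto
      have "a n \<le> 2 * \<bar>?k\<bar> + 9 / 10 * max (a (n - 1)) (a (n + 1))"
        unfolding a_def r(1) r(2)
        by (rule relative_error_step[OF bpos[OF nN] pos y0 n0 se refl rcoeff_approx_ratio(1)[OF x0 h[OF nN]]
              rcoeff_approx_ratio(3)[OF x0 h[OF nN]] rcoeff_approx_ratio(2)[OF x0 h[OF nN]] rcoeff_le_2bb[OF x0 h[OF nN]]])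
      also have "2 * \<bar>?k\<bar> \<le> K / real n ^ 6" using k by (simp add: K_def power_divide)
      finally show ?thesis by simp
    qed
    \<comment> \<open>With n div 2 iterations the source term is taken at indices not below n / 2,
      which costs 2^6, while the power of 9/10 beats n^-6. The factor 640 is 2^6 divided by 1 -
      9/10.\<close>
    ultimately have "a n \<le> K / real (n - n div 2) ^ 6 / (1 - 9 / 10) + (9 / 10) ^ (n div 2)"
      using n N1 by (intro max_contraction_decay[where N = N]) (auto simp: K_def)
    also have "K / real (n - n div 2) ^ 6 \<le> K / (real n / 2) ^ 6"
      using n N1 by (intro divide_left_mono power_mono) (auto simp: K_def)
    also have "(9 / 10) ^ (n div 2) \<le> B / real n ^ 6"
      using B[of n] n N1 by (simp add: field_simps)
    finally show ?thesis unfolding a_def by (simp add: power_divide add_divide_distrib)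
  qed
  then show ?thesis using N1 by (intro that[of "2 * N" "640 * K + B"]) auto
qed

section \<open>From recurrence coefficients to determinants\<close>

definition det_error :: "real \<Rightarrow> nat \<Rightarrow> real" where
  "det_error t n = ln (hankel_det n t) - det_approx t (real n)"

lemma abs_ln_le:
  fixes d :: real
  assumes "\<bar>d\<bar> \<le> 1 / 2" shows "\<bar>ln (1 + d)\<bar> \<le> 2 * \<bar>d\<bar>"
proof -
  have "\<bar>ln (1 + d) - d\<bar> \<le> 2 * d^2" by (rule abs_ln_one_plus_x_minus_x_bound[OF assms])
  moreover have "2 * d^2 \<le> \<bar>d\<bar>"
  proof -
    have "\<bar>d\<bar> * \<bar>d\<bar> \<le> \<bar>d\<bar> * (1 / 2)" using assms by (intro mult_left_mono) auto
    then show ?thesis by (simp add: power2_eq_square)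
  qed
  ultimately show ?thesis by linarith
qed

lemma det_error_second_difference:
  assumes T: "T \<ge> 0"
  obtains C N where "N \<ge> 2" "C \<ge> 0"
    "\<And>t n. t \<le> T \<Longrightarrow> n \<ge> N \<Longrightarrow> \<bar>det_error t (n + 1) + det_error t (n - 1) - 2 * det_error t n\<bar> \<le> C / real n ^ 6"
proof -
  obtain C N where N: "N \<ge> 1" and C: "\<And>t n. t \<le> T \<Longrightarrow> n \<ge> N \<Longrightarrow> \<bar>rcoeff t n / rcoeff_approx t (real n) - 1\<bar> \<le> C / real n ^ 6"
    by (rule rcoeff_relative_error[OF T], rule that)
  have "0 \<le> C / real N ^ 6" using order.trans[OF abs_ge_zero C[of 0 N]] T by simp
  then have C0: "C \<ge> 0" using N by (simp add: zero_le_divide_iff)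
  \<comment> \<open>The three thresholds provide the rate, the range of the approximations, and a
    relative error of at most 1/2 for the logarithm.\<close>
  define M where "M = max N (max 100 (nat \<lceil>2 * C\<rceil>))"
  have main: "\<bar>det_error t (n + 1) + det_error t (n - 1) - 2 * det_error t n\<bar> \<le> (2 * C + 10^11 * 4^6) / real n ^ 6"
    if t: "t \<le> T" and n: "n \<ge> M" for t n
  proof -
    have n100: "n \<ge> 100" "n \<ge> N" and nC': "n \<ge> nat \<lceil>2 * C\<rceil>" using n by (simp_all add: M_def)
    have nC: "real n \<ge> 2 * C" using nC' by linarith
    define x where "x = real n"
    define d where "d = rcoeff t n / rcoeff_approx t x - 1"
    have x: "x \<ge> 100" "real (n + 1) = x + 1" "real (n - 1) = x - 1" using n100 by (auto simp: x_def)
    have b: "rcoeff_approx t x > 0" using x by (intro rcoeff_approx_pos)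
    have d: "\<bar>d\<bar> \<le> C / real n ^ 6" using C[OF t n100(2)] by (simp add: d_def x_def)
    also have "\<dots> \<le> 1 / 2"
    proof -
      have "x ^ 1 \<le> x ^ 6" using x by (intro power_increasing) auto
      then have "x \<le> x ^ 6" by (simp only: power_one_right)
      moreover have "2 * C \<le> x" using nC by (simp add: x_def)
      ultimately have "2 * C \<le> x ^ 6" by (rule order.trans[rotated])
      then show ?thesis using x by (simp add: x_def field_simps)
    qed
    finally have ln: "\<bar>ln (1 + d)\<bar> \<le> 2 * \<bar>d\<bar>" by (rule abs_ln_le)
    have "rcoeff t n = rcoeff_approx t x * (1 + d)" using b by (simp add: d_def)
    moreover have "rcoeff t n > 0" using n100 by (intro rcoeff_pos) auto
    ultimately have lnr: "ln (rcoeff t n) = ln (rcoeff_approx t x) + ln (1 + d)"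
      using b by (simp add: ln_mult zero_less_mult_iff)
    obtain m where m: "n = Suc m" using n100 by (cases n) auto
    have dd: "ln (hankel_det (n + 1) t) + ln (hankel_det (n - 1) t) - 2 * ln (hankel_det n t) = ln (rcoeff t n)"
      using ln_hankel_det_second_difference[of m t] by (simp add: m)
    have "det_error t (n + 1) + det_error t (n - 1) - 2 * det_error t n
      = ln (1 + d) - (det_approx t (x + 1) + det_approx t (x - 1) - 2 * det_approx t x - ln (rcoeff_approx t x))"
      using dd unfolding lnr det_error_def x x_def[symmetric] by (simp add: algebra_simps)
    then have "\<bar>det_error t (n + 1) + det_error t (n - 1) - 2 * det_error t n\<bar>
      \<le> \<bar>ln (1 + d)\<bar> + \<bar>det_approx t (x + 1) + det_approx t (x - 1) - 2 * det_approx t x - ln (rcoeff_approx t x)\<bar>" by linarith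
    also have "\<dots> \<le> 2 * (C / real n ^ 6) + 10^11 * (4 / x)^6"
      using ln d det_approx_second_difference[OF x(1), of t] by (intro add_mono) auto
    finally show ?thesis by (simp add: x_def power_divide add_divide_distrib)
  qed
  show ?thesis
  proof (rule that[of M "2 * C + 10^11 * 4^6"])
    show "M \<ge> 2" unfolding M_def by simp
    show "0 \<le> 2 * C + 10^11 * 4^6" using C0 by simp
  qed (rule main)
qed

text \<open>The increments are dominated by those of the telescoping sequence C / (k - 1)^p, so the
  sequence converges with this sequence as its rate: one power is lost by summation.\<close>

lemma summable_differences_limit:
  fixes a :: "nat \<Rightarrow> real"
  assumes C: "C \<ge> 0" and p: "p \<ge> 1" and N: "N \<ge> 2"
    and d: "\<And>k. k \<ge> N \<Longrightarrow> \<bar>a (Suc k) - a k\<bar> \<le> C / real k ^ Suc p"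
  shows "\<exists>c. \<forall>k\<ge>N. \<bar>a k - c\<bar> \<le> C / (real k - 1) ^ p"
proof -
  define q where "q k = C / (real k - 1) ^ p" for k :: nat
  have qstep: "C / real k ^ Suc p \<le> q k - q (Suc k)" if k: "k \<ge> N" for k
  proof -
    define x where "x = real k"
    have x: "x \<ge> 2" using k N by (simp add: x_def)
    obtain m where m: "p = Suc m" using p by (cases p) auto
    have "(x - 1) ^ m \<le> x ^ m" using x by (intro power_mono) auto
    then have "1 / x ^ m \<le> 1 / (x - 1) ^ m" using x by (intro divide_left_mono) auto
    then have "1 / x ^ m * (1 / (x - 1)) \<le> 1 / (x - 1) ^ m * (1 / (x - 1))" using x by (intro mult_right_mono) auto
    then have "1 / (x ^ m * (x - 1)) - 1 / x ^ p \<le> 1 / (x - 1) ^ p - 1 / x ^ p" by (simp add: m mult.commute)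
    moreover have "1 / (x ^ m * (x - 1)) - 1 / x ^ p = 1 / (x ^ p * (x - 1))"
    proof -
      have "1 / (x - 1) - 1 / x = 1 / (x * (x - 1))" using x by (simp add: field_simps)
      then have "1 / x ^ m * (1 / (x - 1) - 1 / x) = 1 / x ^ m * (1 / (x * (x - 1)))" by simp
      then show ?thesis by (simp add: m right_diff_distrib left_diff_distrib mult_ac)
    qed
    moreover have "1 / x ^ Suc p \<le> 1 / (x ^ p * (x - 1))" using x by (intro divide_left_mono) (auto simp: mult.commute)
    ultimately have "1 / x ^ Suc p \<le> 1 / (x - 1) ^ p - 1 / x ^ p" by linarith
    then have "C * (1 / x ^ Suc p) \<le> C * (1 / (x - 1) ^ p - 1 / x ^ p)" using C by (rule mult_left_mono)
    then show ?thesis by (simp add: q_def x_def right_diff_distrib)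
  qed
  have qnn: "q k \<ge> 0" if "k \<ge> N" for k using that N C by (auto simp: q_def)
  have diff: "\<bar>a (k + j) - a k\<bar> \<le> q k - q (k + j)" if "k \<ge> N" for k j
  proof (induction j)
    case (Suc j)
    have "\<bar>a (Suc (k + j)) - a (k + j)\<bar> \<le> q (k + j) - q (Suc (k + j))"
      using d[of "k + j"] qstep[of "k + j"] that by linarith
    then show ?case using Suc by simp
  qed simp
  have q0: "q \<longlonglongrightarrow> 0"
  proof -
    obtain m where m: "p = Suc m" using p by (cases p) auto
    have "(\<lambda>k. 1 / (real k - 1)) \<longlonglongrightarrow> 0" by real_asymp
    then have "(\<lambda>k. C * (1 / (real k - 1)) ^ p) \<longlonglongrightarrow> C * 0 ^ p" by (intro tendsto_intros)
    then show ?thesis using p by (simp add: q_def[abs_def] power_one_over m)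
  qed
  have "Cauchy a"
  proof (rule metric_CauchyI)
    fix e :: real assume "e > 0"
    then obtain M where M: "\<And>k. k \<ge> M \<Longrightarrow> \<bar>q k\<bar> < e / 2" using LIMSEQ_D[OF q0, of "e / 2"] by auto
    define M' where "M' = max M N"
    have *: "\<bar>a k - a M'\<bar> < e / 2" if "k \<ge> M'" for k
      using diff[of M' "k - M'"] qnn[of k] that M[of M'] by (simp add: M'_def)
    have "dist (a k) (a l) < e" if "k \<ge> M'" "l \<ge> M'" for k l
      using *[OF that(1)] *[OF that(2)] unfolding dist_real_def by linarith
    then show "\<exists>M. \<forall>m\<ge>M. \<forall>n\<ge>M. dist (a m) (a n) < e" by blast
  qed
  then obtain c where c: "a \<longlonglongrightarrow> c" using Cauchy_convergent convergent_def by blast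
  have "\<bar>a k - c\<bar> \<le> q k" if k: "k \<ge> N" for k
  proof -
    have "(\<lambda>j. \<bar>a k - a (j + k)\<bar>) \<longlonglongrightarrow> \<bar>a k - c\<bar>" using LIMSEQ_ignore_initial_segment[OF c] by (intro tendsto_intros)
    then show ?thesis
    proof (rule LIMSEQ_le_const2, intro exI[of _ 0] allI impI)
      fix j
      have "0 \<le> q (k + j)" using k by (intro qnn) auto
      then show "\<bar>a k - a (j + k)\<bar> \<le> q k"
        using diff[OF k, of j] by (simp add: abs_minus_commute add.commute)
    qed
  qed
  then show ?thesis unfolding q_def by blast
qed

text \<open>Two summations turn n^-6 into n^-4: the first differences converge to \<open>c1\<close>,
  and after removal of the linear part the sequence itself converges to \<open>c0\<close>. The rate
  and the threshold depend on \<open>T\<close> only; the coefficients are then chosen for each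
  \<open>t\<close>.\<close>

lemma det_error_affine:
  assumes T: "T \<ge> 0"
  obtains C N c1 c0 where "N \<ge> 1" "\<And>t n. t \<le> T \<Longrightarrow> n \<ge> N \<Longrightarrow> \<bar>det_error t n - (c1 t * real n + c0 t)\<bar> \<le> C / real n ^ 4"
proof -
  obtain C N where N: "N \<ge> 2" and C: "C \<ge> 0" and
    d: "\<And>t n. t \<le> T \<Longrightarrow> n \<ge> N \<Longrightarrow> \<bar>det_error t (n + 1) + det_error t (n - 1) - 2 * det_error t n\<bar> \<le> C / real n ^ 6"
    by (rule det_error_second_difference[OF T], rule that)
  have ex: "\<exists>c1 c0. \<forall>n\<ge>N + 4. \<bar>det_error t n - (c1 * real n + c0)\<bar> \<le> (16 * C) / real n ^ 4" if t: "t \<le> T" for t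
  proof -
    define a where "a n = det_error t (Suc n) - det_error t n" for n
    have "\<bar>a (Suc k) - a k\<bar> \<le> C / real k ^ Suc 5" if k: "k \<ge> N" for k
    proof -
      have "\<bar>a (Suc k) - a k\<bar> \<le> C / real (Suc k) ^ 6" using d[OF t, of "Suc k"] k by (simp add: a_def algebra_simps)
      also have "\<dots> \<le> C / real k ^ 6" using k N C by (intro divide_left_mono power_mono) auto
      finally show ?thesis by simp
    qed
    then obtain c1 where c1: "\<And>k. k \<ge> N \<Longrightarrow> \<bar>a k - c1\<bar> \<le> C / (real k - 1) ^ 5"
      using summable_differences_limit[OF C _ N, of 5 a] by auto
    \<comment> \<open>The shift by one index turns the bound for the increments of \<open>b\<close>
      into C / k^5, the form needed for the second summation.\<close>
    define b where "b k = det_error t (Suc k) - c1 * real (Suc k)" for k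
    have "\<bar>b (Suc k) - b k\<bar> \<le> C / real k ^ Suc 4" if "k \<ge> N" for k
      using c1[of "Suc k"] that by (simp add: b_def a_def algebra_simps)
    then obtain c0 where c0: "\<And>k. k \<ge> N \<Longrightarrow> \<bar>b k - c0\<bar> \<le> C / (real k - 1) ^ 4"
      using summable_differences_limit[OF C _ N, of 4 b] by auto
    have "\<bar>det_error t n - (c1 * real n + c0)\<bar> \<le> (16 * C) / real n ^ 4" if n: "n \<ge> N + 4" for n
    proof -
      have "\<bar>det_error t n - (c1 * real n + c0)\<bar> \<le> C / (real n - 2) ^ 4"
        using c0[of "n - 1"] n by (simp add: b_def algebra_simps of_nat_diff)
      also have "\<dots> \<le> C / (real n / 2) ^ 4" using n C by (intro divide_left_mono power_mono) auto
      finally show ?thesis by (simp add: power_divide mult.commute)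
    qed
    then show ?thesis by blast
  qed
  have "\<forall>t. \<exists>c. t \<le> T \<longrightarrow> (\<forall>n\<ge>N + 4. \<bar>det_error t n - (fst c * real n + snd c)\<bar> \<le> (16 * C) / real n ^ 4)"
  proof (intro allI)
    fix t
    obtain c1 c0 where "t \<le> T \<longrightarrow> (\<forall>n\<ge>N + 4. \<bar>det_error t n - (c1 * real n + c0)\<bar> \<le> (16 * C) / real n ^ 4)"
      using ex[of t] by blast
    then show "\<exists>c. t \<le> T \<longrightarrow> (\<forall>n\<ge>N + 4. \<bar>det_error t n - (fst c * real n + snd c)\<bar> \<le> (16 * C) / real n ^ 4)"
      by (intro exI[of _ "(c1, c0)"]) simp
  qed
  from choice[OF this] obtain c where
    c: "\<forall>t. t \<le> T \<longrightarrow> (\<forall>n\<ge>N + 4. \<bar>det_error t n - (fst (c t) * real n + snd (c t))\<bar> \<le> (16 * C) / real n ^ 4)" ..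
  show ?thesis
  proof (rule that[of "N + 4" "\<lambda>t. fst (c t)" "\<lambda>t. snd (c t)" "16 * C"])
    show "\<bar>det_error t n - (fst (c t) * real n + snd (c t))\<bar> \<le> (16 * C) / real n ^ 4" if "t \<le> T" "n \<ge> N + 4" for t n
      using c that by blast
  qed simp
qed

section \<open>The Toda equation to leading order\<close>

lemma rcoeff_rr:
  assumes T: "T \<ge> 0"
  obtains C N where "N \<ge> 100" "C \<ge> 0"
    "\<And>t n. t \<le> T \<Longrightarrow> n \<ge> N \<Longrightarrow> \<bar>rcoeff t n - rr t (real n)\<bar> \<le> C / real n ^ 2 * rr t (real n)"
proof -
  obtain C N where N: "N \<ge> 1" and C: "\<And>t n. t \<le> T \<Longrightarrow> n \<ge> N \<Longrightarrow> \<bar>rcoeff t n / rcoeff_approx t (real n) - 1\<bar> \<le> C / real n ^ 6"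
    by (rule rcoeff_relative_error[OF T], rule that)
  have "0 \<le> C / real N ^ 6" using order.trans[OF abs_ge_zero C[of 0 N]] T by simp
  then have C0: "C \<ge> 0" using N by (simp add: zero_le_divide_iff)
  have main: "\<bar>rcoeff t n - rr t (real n)\<bar> \<le> (8 + 2 * C) / real n ^ 2 * rr t (real n)"
    if t: "t \<le> T" and n: "n \<ge> max N 100" for t n
  proof -
    define x where "x = real n"
    have x: "x \<ge> 100" using n by (simp add: x_def)
    define d where "d = rcoeff t n / rcoeff_approx t x - 1"
    define y where "y = b_diffs (ww t x) (ee t x) (rho t x) ! 0 - 1"
    have r: "rr t x > 0" using x by (intro rr_pos) auto
    have b: "rcoeff_approx t x > 0" using x by (intro rcoeff_approx_pos) auto
    have y: "0 \<le> y" "y \<le> 1140 * ee t x ^ 2" "y \<le> 1 / 1000"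
      unfolding y_def using b_diffs_0_bounds(1-3)[OF x, of t] by auto
    have "ee t x ^ 2 \<le> (1 / (12 * x))^2" using ee_le[of x t] ee_pos[of x t] x by (intro power_mono) auto
    then have "ee t x ^ 2 \<le> (1 / 144) * (1 / x^2)" by (simp add: power_divide power_mult_distrib)
    moreover have "0 \<le> 1 / x^2" by simp
    \<comment> \<open>The 8 is 1140 / 144 rounded up.\<close>
    ultimately have "y \<le> 8 * (1 / x^2)" using y(2) by linarith
    then have y8: "y \<le> 8 / x^2" by simp
    have "\<bar>d\<bar> \<le> C / x ^ 6" using C[OF t, of n] n by (simp add: d_def x_def)
    also have "\<dots> \<le> C / x ^ 2" using x C0 by (intro divide_left_mono power_increasing) auto
    finally have d: "\<bar>d\<bar> \<le> C / x ^ 2" .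
    have "rcoeff t n = rcoeff_approx t x * (1 + d)" using b by (simp add: d_def)
    also have "rcoeff_approx t x = rr t x * (1 + y)" by (simp add: rcoeff_approx_def y_def)
    finally have "rcoeff t n - rr t x = (y + (1 + y) * d) * rr t x" by (simp add: algebra_simps)
    then have "\<bar>rcoeff t n - rr t x\<bar> = \<bar>y + (1 + y) * d\<bar> * rr t x" using r by (simp add: abs_mult)
    also have "\<bar>y + (1 + y) * d\<bar> \<le> y + (1 + y) * \<bar>d\<bar>"
      using abs_triangle_ineq[of y "(1 + y) * d"] y by (simp add: abs_mult)
    also have "\<dots> \<le> 8 / x^2 + 2 * (C / x^2)" using y8 y d by (intro add_mono mult_mono) auto
    also have "\<dots> = (8 + 2 * C) / x^2" by (simp add: add_divide_distrib)
    finally show ?thesis using r by (simp add: x_def mult_right_mono)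
  qed
  show ?thesis
  proof (rule that[of "max N 100" "8 + 2 * C"])
    show "0 \<le> 8 + 2 * C" using C0 by simp
  qed (simp, rule main)
qed

lemma rr_second_difference:
  assumes x: "x \<ge> 4"
  shows "\<bar>rr t (x + 1) + rr t (x - 1) - 2 * rr t x\<bar> \<le> 96 / x^2 * rr t x"
proof -
  define g where "g = (\<lambda>m::nat. if m = 0 then rr t else if m = 1 then (\<lambda>x. rr t x * (ww t x / 2)) else
     (\<lambda>x. - 3 * rr t x * ee t x * ww t x))"
  have "\<bar>g 0 (x + 1) + g 0 (x - 1) - (\<Sum>j<1. 2 * g (2 * j) x / fact (2 * j))\<bar> \<le> 2 * (96 / x^2 * rr t x) / fact (2 * 1)"
  proof (rule second_difference_taylor)
    fix s assume s: "\<bar>s - x\<bar> \<le> 1"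
    then have s0: "s > 0" using x by auto
    have d1: "((\<lambda>x. rr t x * (ww t x / 2)) has_real_derivative - 3 * rr t s * ee t s * ww t s) (at s)"
      by (rule DERIV_cong, rule DERIV_mult[OF rr_deriv[OF s0] DERIV_cdivide[OF ww_deriv[OF s0]]])
         (simp add: power2_eq_square field_simps)
    show "(g m has_real_derivative g (Suc m) s) (at s)" if "m < 2 * 1" for m
      using that rr_deriv[OF s0, of t UNIV] d1 by (cases "m = 0") (auto simp: g_def)
    have r: "rr t s \<le> 2 * rr t x"
    proof -
      have "rr t s \<le> rr t (x + 1)" using s s0 by (intro rr_mono) auto
      also have "\<dots> \<le> rr t x * (1 + 1 / x)" using x by (intro rr_Suc_le) auto
      also have "\<dots> \<le> rr t x * 2" using x rr_pos[of x t] by (intro mult_left_mono) auto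
      finally show ?thesis by simp
    qed
    have wb: "0 \<le> ww t s" "ww t s \<le> 4 / x" "0 \<le> ee t s" "ee t s \<le> 4 / x"
      using weh_bounds[of x s t] s x by auto
    have "3 * rr t s * ee t s * ww t s \<le> 3 * (2 * rr t x) * (4 / x) * (4 / x)"
      using wb r rr_pos[OF s0, of t] x by (intro mult_mono) auto
    then show "\<bar>g (2 * 1) s\<bar> \<le> 96 / x^2 * rr t x"
      using wb rr_pos[OF s0, of t] by (simp add: g_def abs_mult power2_eq_square)
  qed
  then show ?thesis by (simp add: g_def)
qed

text \<open>Each of the three coefficients is \<open>rr t n\<close> up to a relative error of order
  n^-2, the second difference of \<open>rr\<close> included, and the square of \<open>rr\<close> is
  at most \<open>n\<close>. The last point needs a two-sided bound on \<open>t\<close>, which is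
  harmless because the Toda equation is used only near one \<open>t\<close> at a time.\<close>

lemma toda_bound:
  assumes T: "T \<ge> 0"
  obtains C N where "N \<ge> 1"
    "\<And>t n. \<bar>t\<bar> \<le> T \<Longrightarrow> n \<ge> N \<Longrightarrow>
      \<bar>rcoeff t n * (rcoeff t (n + 1) + rcoeff t (n - 1)) - 2 * rr t (real n) ^ 2\<bar> \<le> C / real n"
proof -
  obtain C N where N: "N \<ge> 100" and C: "C \<ge> 0" and
    e: "\<And>t n. t \<le> T \<Longrightarrow> n \<ge> N \<Longrightarrow> \<bar>rcoeff t n - rr t (real n)\<bar> \<le> C / real n ^ 2 * rr t (real n)"
    by (rule rcoeff_rr[OF T], rule that)
  define M where "M = max (N + 1) (nat \<lceil>T^2\<rceil>)"
  define K where "K = 16 * C + 96"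
  have main: "\<bar>rcoeff t n * (rcoeff t (n + 1) + rcoeff t (n - 1)) - 2 * rr t (real n) ^ 2\<bar> \<le> (K + C * (2 + K)) / real n"
    if t: "\<bar>t\<bar> \<le> T" and n: "n \<ge> M" for t n
  proof -
    define x where "x = real n"
    define r where "r = rr t x"
    have tT: "t \<le> T" using t by simp
    have nN: "n \<ge> N" "n - 1 \<ge> N" "n + 1 \<ge> N" and nT: "n \<ge> nat \<lceil>T^2\<rceil>" using n by (auto simp: M_def)
    have x: "x \<ge> 100" "x \<ge> T^2" using nN N nT unfolding x_def by linarith+
    have rx: "real (n + 1) = x + 1" "real (n - 1) = x - 1" using nN N by (auto simp: x_def)
    have r0: "r > 0" unfolding r_def using x by (intro rr_pos) auto
    have rp: "rr t (x + 1) \<le> 2 * r" "rr t (x - 1) \<le> 2 * r" "rr t (x - 1) > 0" "rr t (x + 1) > 0"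
    proof -
      have "rr t (x + 1) \<le> r * (1 + 1 / x)" unfolding r_def using x by (intro rr_Suc_le) auto
      also have "\<dots> \<le> r * 2" using x r0 by (intro mult_left_mono) auto
      finally show "rr t (x + 1) \<le> 2 * r" by simp
      have "rr t (x - 1) \<le> r" unfolding r_def using x by (intro rr_mono) auto
      then show "rr t (x - 1) \<le> 2 * r" using r0 by simp
    qed (use x in \<open>auto intro!: rr_pos\<close>)
    have e1: "\<bar>rcoeff t (n + 1) - rr t (x + 1)\<bar> \<le> 4 * C / x^2 * (2 * r)"
    proof -
      have "\<bar>rcoeff t (n + 1) - rr t (x + 1)\<bar> \<le> C / (x + 1)^2 * rr t (x + 1)"
        using e[OF tT nN(3)] unfolding rx .
      also have "\<dots> \<le> 4 * C / x^2 * (2 * r)"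
      proof (intro mult_mono)
        have "C / (x + 1)^2 \<le> C / x^2" using x C by (intro divide_left_mono power_mono) auto
        also have "\<dots> \<le> 4 * C / x^2" using x C by (intro divide_right_mono) auto
        finally show "C / (x + 1)^2 \<le> 4 * C / x^2" .
      qed (use rp C in auto)
      finally show ?thesis .
    qed
    have e2: "\<bar>rcoeff t (n - 1) - rr t (x - 1)\<bar> \<le> 4 * C / x^2 * (2 * r)"
    proof -
      have "\<bar>rcoeff t (n - 1) - rr t (x - 1)\<bar> \<le> C / (x - 1)^2 * rr t (x - 1)"
        using e[OF tT nN(2)] unfolding rx .
      also have "\<dots> \<le> 4 * C / x^2 * (2 * r)"
      proof (intro mult_mono)
        have "C / (x - 1)^2 \<le> C / (x / 2)^2" using x C by (intro divide_left_mono power_mono) auto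
        also have "\<dots> = 4 * C / x^2" by (simp add: power2_eq_square)
        finally show "C / (x - 1)^2 \<le> 4 * C / x^2" .
      qed (use rp C in auto)
      finally show ?thesis .
    qed
    define E where "E = rcoeff t (n + 1) + rcoeff t (n - 1) - 2 * r"
    define \<epsilon> where "\<epsilon> = rcoeff t n - r"
    have s: "\<bar>rr t (x + 1) + rr t (x - 1) - 2 * r\<bar> \<le> 96 / x^2 * r"
      unfolding r_def using x by (intro rr_second_difference) auto
    have "\<bar>E\<bar> \<le> \<bar>rcoeff t (n + 1) - rr t (x + 1)\<bar> + \<bar>rcoeff t (n - 1) - rr t (x - 1)\<bar> + \<bar>rr t (x + 1) + rr t (x - 1) - 2 * r\<bar>"
      unfolding E_def by linarith
    also have "\<dots> \<le> 4 * C / x^2 * (2 * r) + 4 * C / x^2 * (2 * r) + 96 / x^2 * r"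
      using e1 e2 s by (intro add_mono)
    also have "\<dots> = K / x^2 * r" by (simp add: K_def add_divide_distrib algebra_simps)
    finally have E: "\<bar>E\<bar> \<le> K / x^2 * r" .
    have ep: "\<bar>\<epsilon>\<bar> \<le> C / x^2 * r" using e[OF tT nN(1)] by (simp add: \<epsilon>_def r_def x_def)
    have K0: "K \<ge> 0" using C by (simp add: K_def)
    have "1 \<le> x^2" using x by (simp add: one_le_power)
    then have "K / x^2 \<le> K / 1" using K0 by (intro divide_left_mono) auto
    then have E': "\<bar>E\<bar> \<le> K * r" using E r0 mult_right_mono[of "K / x^2" K r] by simp
    have "rcoeff t n * (rcoeff t (n + 1) + rcoeff t (n - 1)) - 2 * r^2 = r * E + \<epsilon> * (2 * r + E)"
      by (simp add: E_def \<epsilon>_def power2_eq_square algebra_simps)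
    then have "\<bar>rcoeff t n * (rcoeff t (n + 1) + rcoeff t (n - 1)) - 2 * r^2\<bar> \<le> r * \<bar>E\<bar> + \<bar>\<epsilon>\<bar> * (2 * r + \<bar>E\<bar>)"
    proof -
      have "\<bar>r * E + \<epsilon> * (2 * r + E)\<bar> \<le> \<bar>r * E\<bar> + \<bar>\<epsilon> * (2 * r + E)\<bar>" by (rule abs_triangle_ineq)
      also have "\<bar>\<epsilon> * (2 * r + E)\<bar> \<le> \<bar>\<epsilon>\<bar> * (2 * r + \<bar>E\<bar>)" unfolding abs_mult using r0 by (intro mult_left_mono) auto
      finally show ?thesis using r0 \<open>_ = r * E + \<epsilon> * (2 * r + E)\<close> by (simp add: abs_mult)
    qed
    also have "\<dots> \<le> r * (K / x^2 * r) + C / x^2 * r * (2 * r + K * r)"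
      using E E' ep r0 C by (intro add_mono mult_mono) auto
    also have "\<dots> = (K + C * (2 + K)) / x^2 * r^2" by (simp add: power2_eq_square add_divide_distrib algebra_simps)
    also have "\<dots> \<le> (K + C * (2 + K)) / x^2 * x"
    proof (intro mult_left_mono)
      have d: "dd t x > \<bar>t\<bar>" using x by (intro dd_gt) auto
      then have "r \<le> dd t x / 6" by (simp add: r_def rr_def)
      then have "r^2 \<le> (dd t x / 6)^2" using r0 by (intro power_mono) auto
      also have "\<dots> = (t^2 + 12 * x) / 36" using dd_sq[of x t] x by (simp add: power_divide)
      also have "\<dots> \<le> x"
      proof -
        have "t^2 \<le> T^2" using t T by (metis abs_le_square_iff abs_of_nonneg)
        then show ?thesis using x by simp
      qed
      finally show "r^2 \<le> x" .
    qed (use C K0 x in auto)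
    also have "\<dots> = (K + C * (2 + K)) / x" using x by (simp add: power2_eq_square)
    finally show ?thesis by (simp add: r_def x_def)
  qed
  show ?thesis
    by (rule that[of M "K + C * (2 + K)"]) (simp add: M_def, rule main)
qed

text \<open>The error of the Barnes asymptotics for \<open>(2\<pi>)\<^bsup>n/2\<^esup> \<Prod>j<n. j!\<close>, without its constant term.\<close>
definition barnes_error :: "nat \<Rightarrow> real" where
  "barnes_error n = real n / 2 * ln (2 * pi) + (\<Sum>j<n. ln (fact j)) - (real n ^ 2 / 2 * ln (real n) - 3 / 4 * real n ^ 2
     + real n * ln (2 * pi) - ln (real n) / 12 - 1 / (240 * real n ^ 2))"

text \<open>For \<open>t = - a\<close> the summands of \<open>rr\<close> nearly cancel, so
  \<open>rr\<close> is rewritten as x / (dd + a). Then \<open>q\<close> = dd / a tends to 1 and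
  \<open>ra\<close> = a rr to x / 2, and everything except the logarithm of 2 a is continuous in
  these two and 1 / a. In the limit \<open>ww\<close> is 2 / x, while \<open>ee\<close>
  vanishes.\<close>

lemma det_approx_limit:
  assumes x: "x > 0"
  shows "((\<lambda>a. det_approx (- a) x + x^2 / 2 * ln (2 * a)) \<longlongrightarrow>
    x^2 / 2 * ln x - 3 / 4 * x^2 + x * ln (2 * pi) - ln x / 12 - 1 / (240 * x^2)) at_top"
proof -
  define q where "q a = dd (- a) x / a" for a
  have inv: "((\<lambda>a::real. 1 / a) \<longlongrightarrow> 0) at_top" by real_asymp
  have "((\<lambda>a. sqrt (1 + 12 * x * (1 / a)^2)) \<longlongrightarrow> sqrt (1 + 12 * x * 0^2)) at_top"
    by (intro tendsto_intros inv)
  moreover have "\<forall>\<^sub>F a in at_top. sqrt (1 + 12 * x * (1 / a)^2) = q a"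
    using eventually_gt_at_top[of 0]
  proof eventually_elim
    case (elim a)
    have "1 + 12 * x * (1 / a)^2 = (a^2 + 12 * x) / a^2" using elim by (simp add: field_simps)
    then show ?case using elim by (simp add: q_def dd_def real_sqrt_divide)
  qed
  ultimately have q: "(q \<longlongrightarrow> 1) at_top" using tendsto_cong by fastforce
  define ra where "ra a = x / (q a + 1)" for a
  have ra: "(ra \<longlongrightarrow> x / 2) at_top"
    using tendsto_divide[OF tendsto_const[of x] tendsto_add[OF q tendsto_const[of 1]]] by (simp add: ra_def[abs_def])
  have rr_a: "rr (- a) x = ra a * (1 / a)" if "a > 0" for a
  proof -
    have d: "dd (- a) x > 0" using x by (rule dd_pos)
    have "x = rr (- a) x * (dd (- a) x + a)"
      using x_eq[OF x, of "- a"] t_eq[of "- a" x] by (simp add: power2_eq_square algebra_simps)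
    moreover have "q a + 1 = (dd (- a) x + a) / a" using that by (simp add: q_def field_simps)
    ultimately show ?thesis using that d by (simp add: ra_def field_simps)
  qed
  have q0: "q a > 0" if "a > 0" for a using that dd_pos[OF x, of "- a"] by (simp add: q_def)
  have ra0: "ra a > 0" if "a > 0" for a using that q0[OF that] x by (simp add: ra_def)
  let ?G = "\<lambda>a. x^2 / 2 * ln (2 * ra a) - 3 * (ra a * q a)^2 + 44 * (ra a * (1/a))^2 * (ra a * q a)
     - 150 * (ra a * (1/a))^4 + x * ln (2 * pi) - (ln 2 + ln (ra a * q a)) / 12
     + f2_diffs (1 / (ra a * q a)) ((1 / a)^2 / (q a)^2) (ra a * (1 / a)^2 / q a) ! 0"
  have "(?G \<longlongrightarrow> x^2 / 2 * ln (2 * (x / 2)) - 3 * (x / 2 * 1)^2 + 44 * (x / 2 * 0)^2 * (x / 2 * 1)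
     - 150 * (x / 2 * 0)^4 + x * ln (2 * pi) - (ln 2 + ln (x / 2 * 1)) / 12
     + f2_diffs (1 / (x / 2 * 1)) (0^2 / 1^2) (x / 2 * 0^2 / 1) ! 0) at_top"
    unfolding f2_diffs_def nth_Cons_0 by (intro tendsto_intros q ra inv) (use x in auto)
  also have "x^2 / 2 * ln (2 * (x / 2)) - 3 * (x / 2 * 1)^2 + 44 * (x / 2 * 0)^2 * (x / 2 * 1)
     - 150 * (x / 2 * 0)^4 + x * ln (2 * pi) - (ln 2 + ln (x / 2 * 1)) / 12
     + f2_diffs (1 / (x / 2 * 1)) (0^2 / 1^2) (x / 2 * 0^2 / 1) ! 0
     = x^2 / 2 * ln x - 3 / 4 * x^2 + x * ln (2 * pi) - ln x / 12 - 1 / (240 * x^2)"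
    using x by (simp add: f2_diffs_def ln_div power2_eq_square)
  finally have G: "(?G \<longlongrightarrow> x^2 / 2 * ln x - 3 / 4 * x^2 + x * ln (2 * pi) - ln x / 12 - 1 / (240 * x^2)) at_top" .
  have "\<forall>\<^sub>F a in at_top. ?G a = det_approx (- a) x + x^2 / 2 * ln (2 * a)"
    using eventually_gt_at_top[of 0]
  proof eventually_elim
    case (elim a)
    note r = rr_a[OF elim] and q = q0[OF elim] and ra = ra0[OF elim]
    have d: "dd (- a) x = q a * a" using elim by (simp add: q_def)
    have "ln (2 * ra a) = ln (rr (- a) x) + ln (2 * a)"
      using ra elim unfolding r by (simp add: ln_mult ln_div)
    then have "x^2 / 2 * ln (2 * ra a) = x^2 / 2 * ln (rr (- a) x) + x^2 / 2 * ln (2 * a)"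
      by (simp only: distrib_left)
    moreover have "ln (ra a * q a) = ln (rr (- a) x) + ln (dd (- a) x)"
      using ra q elim unfolding r d by (simp add: ln_mult ln_div)
    moreover have "ww (- a) x = 1 / (ra a * q a)" "ee (- a) x = (1 / a)^2 / (q a)^2"
      "rho (- a) x = ra a * (1 / a)^2 / q a"
      unfolding ww_def ee_def rho_def r d using ra q elim by (simp_all add: power2_eq_square)
    moreover have "3 * rr (- a) x ^ 2 * dd (- a) x ^ 2 = 3 * (ra a * q a)^2"
      "44 * rr (- a) x ^ 3 * dd (- a) x = 44 * (ra a * (1/a))^2 * (ra a * q a)"
      "150 * rr (- a) x ^ 4 = 150 * (ra a * (1/a))^4"
      unfolding r d using elim by (simp_all add: power2_eq_square power3_eq_cube)
    moreover have "- (ln 2 + (ln (rr (- a) x) + ln (dd (- a) x))) / 12 = - ((ln 2 + (ln (rr (- a) x) + ln (dd (- a) x))) / 12)"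
      by (rule minus_divide_left[symmetric])
    ultimately show ?case
      unfolding det_approx_def f0_def f1_def by (simp only: add.assoc)
  qed
  then show ?thesis using G tendsto_cong by fastforce
qed

lemma det_error_limit:
  assumes n: "n > 0" shows "((\<lambda>a. det_error (- a) n) \<longlongrightarrow> barnes_error n) at_top"
proof -
  have "((\<lambda>a. (ln (hankel_det n (- a)) + real n ^ 2 / 2 * ln (2 * a)) - (det_approx (- a) (real n) + real n ^ 2 / 2 * ln (2 * a)))
    \<longlongrightarrow> barnes_error n) at_top"
    unfolding barnes_error_def using n by (intro tendsto_diff ln_hankel_det_limit det_approx_limit) auto
  then show ?thesis by (simp add: det_error_def)
qed

section \<open>Dependence of the approximation on \<open>t\<close>\<close>

lemma dd_deriv_t: assumes "x > 0" shows "((\<lambda>t. dd t x) has_real_derivative t / dd t x) (at t)"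
proof -
  have "t^2 + 12 * x > 0" using assms by (simp add: add_nonneg_pos)
  then show ?thesis unfolding dd_def by (auto intro!: derivative_eq_intros simp: field_simps)
qed

lemma rr_deriv_t: assumes "x > 0" shows "((\<lambda>t. rr t x) has_real_derivative rr t x / dd t x) (at t)"
proof -
  have "((\<lambda>t. (t + dd t x) / 12) has_real_derivative (1 + t / dd t x) / 12) (at t)"
    by (intro DERIV_cdivide DERIV_add DERIV_ident dd_deriv_t assms)
  moreover have "(1 + t / dd t x) / 12 = rr t x / dd t x"
    using dd_pos[OF assms, of t] by (simp add: rr_def field_simps)
  ultimately show ?thesis by (simp only: rr_def)
qed

lemma f0_deriv_t:
  assumes x: "x > 0"
  shows "((\<lambda>t. f0 t x) has_real_derivative 2 * rr t x ^ 2 * dd t x - 8 * rr t x ^ 3) (at t)"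
proof -
  let ?r = "rr t x" and ?d = "dd t x"
  have p: "?r > 0" "?d > 0" using rr_pos dd_pos x by auto
  have td: "t / ?d = 12 * (?r / ?d) - 1" using t_eq[of t x] p by (simp add: field_simps)
  have "((\<lambda>t. f0 t x) has_real_derivative
     (x^2 / 2 * (?r / ?d / ?r) - 3 * (2 * ?r * (?r / ?d) * ?d^2 + ?r^2 * (2 * ?d * (t / ?d)))
      + 44 * (3 * ?r^2 * (?r / ?d) * ?d + ?r^3 * (t / ?d)) - 150 * (4 * ?r^3 * (?r / ?d)))) (at t)"
    unfolding f0_def[abs_def] using p
    by (auto intro!: derivative_eq_intros rr_deriv_t dd_deriv_t x simp: algebra_simps)
  moreover have "x^2 / 2 * (?r / ?d / ?r) - 3 * (2 * ?r * (?r / ?d) * ?d^2 + ?r^2 * (2 * ?d * (t / ?d)))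
      + 44 * (3 * ?r^2 * (?r / ?d) * ?d + ?r^3 * (t / ?d)) - 150 * (4 * ?r^3 * (?r / ?d))
      = 2 * ?r ^ 2 * ?d - 8 * ?r ^ 3"
  proof -
    have "x^2 = (2 * ?r * ?d - 12 * ?r ^ 2)^2" by (rule arg_cong[OF x_eq[OF x, of t]])
    then have xx: "x^2 / 2 * (?r / ?d / ?r) = (2 * ?r * ?d - 12 * ?r ^ 2)^2 / (2 * ?d)" using p by simp
    show ?thesis unfolding xx td using p by (simp add: field_simps eval_nat_numeral)
  qed
  ultimately show ?thesis by (simp only:)
qed

text \<open>The value \<open>2 * rr t x ^ 2\<close> is the right side of the Toda equation with all
  coefficients replaced by \<open>rr\<close>, so \<open>f0\<close> absorbs its growing part.\<close>

lemma f0_deriv2_t: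
  assumes x: "x > 0"
  shows "((\<lambda>t. 2 * rr t x ^ 2 * dd t x - 8 * rr t x ^ 3) has_real_derivative 2 * rr t x ^ 2) (at t)"
proof -
  let ?r = "rr t x" and ?d = "dd t x"
  have p: "?r > 0" "?d > 0" using rr_pos dd_pos x by auto
  have td: "t / ?d = 12 * (?r / ?d) - 1" using t_eq[of t x] p by (simp add: field_simps)
  have "((\<lambda>t. 2 * rr t x ^ 2 * dd t x - 8 * rr t x ^ 3) has_real_derivative
    (2 * (2 * ?r * (?r / ?d) * ?d + ?r^2 * (t / ?d)) - 8 * (3 * ?r^2 * (?r / ?d)))) (at t)"
    by (auto intro!: derivative_eq_intros rr_deriv_t dd_deriv_t x simp: algebra_simps)
  moreover have "2 * (2 * ?r * (?r / ?d) * ?d + ?r^2 * (t / ?d)) - 8 * (3 * ?r^2 * (?r / ?d)) = 2 * ?r^2"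
    unfolding td using p by (simp add: field_simps eval_nat_numeral)
  ultimately show ?thesis by (simp only:)
qed

lemma rho_limit: "(\<lambda>n. rho t (real n)) \<longlonglongrightarrow> 1 / 12"
proof -
  have "(\<lambda>n. 1 / 12 + t / 12 * (1 / dd t (real n))) \<longlonglongrightarrow> 1 / 12 + t / 12 * 0"
    unfolding dd_def by (intro tendsto_intros) real_asymp
  moreover have "\<forall>\<^sub>F n in sequentially. 1 / 12 + t / 12 * (1 / dd t (real n)) = rho t (real n)"
    using eventually_gt_at_top[of 0] by eventually_elim (simp add: rho_eq)
  ultimately show ?thesis using tendsto_cong by fastforce
qed

lemma f1_limit: "(\<lambda>n. f1 t (real n) + ln (real n) / 12) \<longlonglongrightarrow> - ln 2 / 12"
proof -
  have "(\<lambda>n. - (ln 2 - ln (2 * (1 - 6 * rho t (real n)))) / 12) \<longlonglongrightarrow> - (ln 2 - ln (2 * (1 - 6 * (1 / 12)))) / 12"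
    by (intro tendsto_intros rho_limit) auto
  moreover have "\<forall>\<^sub>F n in sequentially. - (ln 2 - ln (2 * (1 - 6 * rho t (real n)))) / 12 = f1 t (real n) + ln (real n) / 12"
    using eventually_gt_at_top[of 0]
  proof eventually_elim
    case (elim n)
    then have x: "real n > 0" by simp
    have "ln (real n) = ln (rr t (real n) * dd t (real n) * (2 * (1 - 6 * rho t (real n))))"
      by (rule arg_cong[of _ _ ln], subst x_rho[OF x, of t]) simp
    also have "\<dots> = ln (rr t (real n)) + ln (dd t (real n)) + ln (2 * (1 - 6 * rho t (real n)))"
      using rr_pos[OF x, of t] dd_pos[OF x, of t] rho_less[OF x, of t] by (simp add: ln_mult)
    finally show ?case by (simp add: f1_def field_simps)
  qed
  ultimately show ?thesis using tendsto_cong by fastforce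
qed

lemma f2_limit: "(\<lambda>n. f2_diffs (ww t (real n)) (ee t (real n)) (rho t (real n)) ! 0) \<longlonglongrightarrow> 0"
proof -
  have i: "(\<lambda>n. 1 / real n) \<longlonglongrightarrow> 0" by real_asymp
  have e: "(\<lambda>n. ee t (real n)) \<longlonglongrightarrow> 0" unfolding ee_def dd_def by real_asymp
  have "(\<lambda>n. 2 * (1 - 6 * rho t (real n)) * (1 / real n)) \<longlonglongrightarrow> 2 * (1 - 6 * (1 / 12)) * 0"
    by (intro tendsto_intros rho_limit i)
  moreover have "\<forall>\<^sub>F n in sequentially. 2 * (1 - 6 * rho t (real n)) * (1 / real n) = ww t (real n)"
    using eventually_gt_at_top[of 0] by eventually_elim (simp add: ww_eq)
  ultimately have w: "(\<lambda>n. ww t (real n)) \<longlonglongrightarrow> 0" using tendsto_cong by fastforce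
  have "(\<lambda>n. f2_diffs (ww t (real n)) (ee t (real n)) (rho t (real n)) ! 0) \<longlonglongrightarrow> f2_diffs 0 0 (1 / 12) ! 0"
    unfolding f2_diffs_def nth_Cons_0 by (intro tendsto_intros w e rho_limit)
  then show ?thesis by (simp add: f2_diffs_def)
qed

text \<open>A Taylor expansion in \<open>t\<close> is needed only for the part with
  \<open>f0\<close>, where the Toda equation bounds the second derivative by C / n. The other terms
  converge, after adding ln n / 12, to limits that do not depend on \<open>t\<close>, so their
  second difference in \<open>t\<close> vanishes in the limit without any derivative.\<close>

lemma det_error_second_difference_t:
  "(\<lambda>n. det_error (t + 1) n + det_error (t - 1) n - 2 * det_error t n) \<longlonglongrightarrow> 0"
proof -
  define T where "T = \<bar>t\<bar> + 1"
  have T: "T \<ge> 0" by (simp add: T_def)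
  obtain C N where N: "N \<ge> 1" and
    C: "\<And>t n. \<bar>t\<bar> \<le> T \<Longrightarrow> n \<ge> N \<Longrightarrow>
      \<bar>rcoeff t n * (rcoeff t (n + 1) + rcoeff t (n - 1)) - 2 * rr t (real n) ^ 2\<bar> \<le> C / real n"
    by (rule toda_bound[OF T], rule that)
  define U where "U n s = ln (hankel_det n s) - f0 s (real n)" for n s
  have U: "\<bar>U n (t + 1) + U n (t - 1) - 2 * U n t\<bar> \<le> C / real n" if n: "n \<ge> N" for n
  proof -
    have x: "real n > 0" using n N by simp
    define g where "g = (\<lambda>m::nat. if m = 0 then U n else if m = 1 then
       (\<lambda>s. ln_hankel_t s n - (2 * rr s (real n) ^ 2 * dd s (real n) - 8 * rr s (real n) ^ 3)) else
       (\<lambda>s. rcoeff s n * (rcoeff s (n + 1) + rcoeff s (n - 1)) - 2 * rr s (real n) ^ 2))"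
    have "\<bar>g 0 (t + 1) + g 0 (t - 1) - (\<Sum>j<1. 2 * g (2 * j) t / fact (2 * j))\<bar> \<le> 2 * (C / real n) / fact (2 * 1)"
    proof (rule second_difference_taylor)
      fix s assume s: "\<bar>s - t\<bar> \<le> 1"
      have d0: "(U n has_real_derivative ln_hankel_t s n - (2 * rr s (real n) ^ 2 * dd s (real n) - 8 * rr s (real n) ^ 3)) (at s)"
        unfolding U_def[abs_def] by (intro DERIV_diff ln_hankel_det_deriv f0_deriv_t x)
      have d1: "((\<lambda>s. ln_hankel_t s n - (2 * rr s (real n) ^ 2 * dd s (real n) - 8 * rr s (real n) ^ 3)) has_real_derivative
         rcoeff s n * (rcoeff s (n + 1) + rcoeff s (n - 1)) - 2 * rr s (real n) ^ 2) (at s)"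
        by (intro DERIV_diff ln_hankel_t_deriv f0_deriv2_t x)
      show "(g m has_real_derivative g (Suc m) s) (at s)" if "m < 2 * 1" for m
        using that d0 d1 by (cases "m = 0") (auto simp: g_def)
      have "\<bar>s\<bar> \<le> T" using s unfolding T_def by linarith
      then show "\<bar>g (2 * 1) s\<bar> \<le> C / real n" using C[of s n] n by (simp add: g_def)
    qed
    then show ?thesis by (simp add: g_def)
  qed
  have "(\<lambda>n. C / real n) \<longlonglongrightarrow> 0" by real_asymp
  then have U0: "(\<lambda>n. U n (t + 1) + U n (t - 1) - 2 * U n t) \<longlonglongrightarrow> 0"
    by (rule Lim_null_comparison[rotated]) (use U in \<open>auto simp: eventually_sequentially intro!: exI[of _ N]\<close>)
  define V where "V n s = f1 s (real n) + ln (real n) / 12 + f2_diffs (ww s (real n)) (ee s (real n)) (rho s (real n)) ! 0" for n s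
  have V: "(\<lambda>n. V n s) \<longlonglongrightarrow> - ln 2 / 12 + 0" for s
    unfolding V_def by (intro tendsto_add f1_limit f2_limit)
  have "(\<lambda>n. (U n (t + 1) + U n (t - 1) - 2 * U n t) - (V n (t + 1) + V n (t - 1) - 2 * V n t)) \<longlonglongrightarrow>
     0 - ((- ln 2 / 12 + 0) + (- ln 2 / 12 + 0) - 2 * (- ln 2 / 12 + 0))"
    by (intro tendsto_diff tendsto_add tendsto_mult U0 V tendsto_const)
  moreover have "(U n (t + 1) + U n (t - 1) - 2 * U n t) - (V n (t + 1) + V n (t - 1) - 2 * V n t)
      = det_error (t + 1) n + det_error (t - 1) n - 2 * det_error t n" for n
    by (simp add: U_def V_def det_error_def det_approx_def algebra_simps)
  ultimately show ?thesis by simp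
qed

lemma affine_sequence_eq_0:
  fixes p q :: real
  assumes "(\<lambda>n. p * real n + q) \<longlonglongrightarrow> 0"
  shows "p = 0 \<and> q = 0"
proof -
  have "(\<lambda>n. (p * real (Suc n) + q) - (p * real n + q)) \<longlonglongrightarrow> 0 - 0"
    by (intro tendsto_diff LIMSEQ_Suc assms)
  then have "(\<lambda>n::nat. p) \<longlonglongrightarrow> 0" by (simp add: algebra_simps)
  then have p: "p = 0" by (simp add: LIMSEQ_const_iff)
  then show ?thesis using assms by (simp add: LIMSEQ_const_iff)
qed

lemma bounded_arithmetic_progression:
  fixes p q :: real
  assumes "\<And>k. k \<ge> K \<Longrightarrow> \<bar>p + real k * q\<bar> \<le> B"
  shows "q = 0"
proof (rule ccontr)
  assume q: "q \<noteq> 0"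
  define k where "k = max K (nat \<lceil>(B + \<bar>p\<bar>) / \<bar>q\<bar>\<rceil> + 1)"
  have "real k > (B + \<bar>p\<bar>) / \<bar>q\<bar>" unfolding k_def by linarith
  then have "real k * \<bar>q\<bar> > B + \<bar>p\<bar>" using q by (simp add: field_simps)
  moreover have "\<bar>real k * q\<bar> = real k * \<bar>q\<bar>" by (simp add: abs_mult)
  moreover have "\<bar>p + real k * q\<bar> \<le> B" by (rule assms) (simp add: k_def)
  ultimately show False by linarith
qed

lemma second_difference_0_imp_arithmetic:
  fixes c :: "nat \<Rightarrow> real"
  assumes "\<And>k. c k + c (k + 2) - 2 * c (k + 1) = 0"
  shows "c k = c 0 + real k * (c 1 - c 0)"
proof (induction k rule: less_induct)
  case (less k)
  consider "k = 0" | "k = 1" | j where "k = j + 2"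
    by (metis One_nat_def Suc_1 add.commute add_2_eq_Suc not0_implies_Suc)
  then show ?case
  proof cases
    case 3
    then show ?thesis using less[of j] less[of "j + 1"] assms[of j] by (simp add: algebra_simps)
  qed auto
qed

text \<open>The constants of the affine ambiguity are affine functions of \<open>t\<close> by the Toda equation, and
  they converge as \<open>t\<close> tends to \<open>-\<infinity>\<close>; so they can be read off from the Gaussian case.\<close>
lemma det_error_asymptotics:
  assumes Z: "barnes_error \<longlonglongrightarrow> Z"
  obtains C N where "N \<ge> 1" "\<And>n. n \<ge> N \<Longrightarrow> \<bar>det_error t n - Z\<bar> \<le> C / real n ^ 4"
proof -
  define T where "T = \<bar>t\<bar> + 1"
  have T: "T \<ge> 0" by (simp add: T_def)
  obtain C N c1 c0 where N: "N \<ge> 1" and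
    R: "\<And>t n. t \<le> T \<Longrightarrow> n \<ge> N \<Longrightarrow> \<bar>det_error t n - (c1 t * real n + c0 t)\<bar> \<le> C / real n ^ 4"
    by (rule det_error_affine[OF T], rule that)
  have lim0: "(\<lambda>n. C / real n ^ 4) \<longlonglongrightarrow> 0" by real_asymp
  have Rlim: "(\<lambda>n. det_error s n - (c1 s * real n + c0 s)) \<longlonglongrightarrow> 0" if "s \<le> T" for s
    by (rule Lim_null_comparison[OF _ lim0]) (use R[OF that] in \<open>auto simp: eventually_sequentially intro!: exI[of _ N]\<close>)
  have second: "c1 (s + 1) + c1 (s - 1) - 2 * c1 s = 0 \<and> c0 (s + 1) + c0 (s - 1) - 2 * c0 s = 0" if s: "s + 1 \<le> T" for s
  proof (rule affine_sequence_eq_0)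
    have "(\<lambda>n. (det_error (s + 1) n + det_error (s - 1) n - 2 * det_error s n) - ((det_error (s + 1) n - (c1 (s + 1) * real n + c0 (s + 1)))
       + (det_error (s - 1) n - (c1 (s - 1) * real n + c0 (s - 1))) - 2 * (det_error s n - (c1 s * real n + c0 s)))) \<longlonglongrightarrow> 0 - (0 + 0 - 2 * 0)"
      using s by (intro tendsto_diff tendsto_add tendsto_mult det_error_second_difference_t Rlim tendsto_const) auto
    then show "(\<lambda>n. (c1 (s + 1) + c1 (s - 1) - 2 * c1 s) * real n + (c0 (s + 1) + c0 (s - 1) - 2 * c0 s)) \<longlonglongrightarrow> 0"
      by (simp add: algebra_simps)
  qed
  have bound: "\<bar>c1 t * real n + c0 t - barnes_error n\<bar> \<le> C / real n ^ 4 + 1 / real n" if n: "n \<ge> N" for n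
  proof -
    have n0: "n > 0" using n N by simp
    \<comment> \<open>Here \<open>n\<close> is fixed and \<open>v\<close> follows the affine part
      along t - k. It is arithmetic in \<open>k\<close> by \<open>second\<close>, and bounded since
      \<open>R\<close> holds uniformly and \<open>det_error\<close> converges as \<open>k\<close>
      grows; hence it is constant.\<close>
    define v where "v k = c1 (t - real k) * real n + c0 (t - real k)" for k
    have v2: "v k + v (k + 2) - 2 * v (k + 1) = 0" for k
    proof -
      have "t - real (k + 1) + 1 \<le> T" by (simp add: T_def)
      from second[OF this] have
        1: "c1 (t - real (k + 1) + 1) + c1 (t - real (k + 1) - 1) - 2 * c1 (t - real (k + 1)) = 0" and
        0: "c0 (t - real (k + 1) + 1) + c0 (t - real (k + 1) - 1) - 2 * c0 (t - real (k + 1)) = 0" by auto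
      have e: "t - real (k + 1) + 1 = t - real k" "t - real (k + 1) - 1 = t - real (k + 2)" by auto
      have "v k + v (k + 2) - 2 * v (k + 1)
         = (c1 (t - real k) + c1 (t - real (k + 2)) - 2 * c1 (t - real (k + 1))) * real n
          + (c0 (t - real k) + c0 (t - real (k + 2)) - 2 * c0 (t - real (k + 1)))"
        by (simp only: v_def algebra_simps)
      then show ?thesis using 0 1 unfolding e by simp
    qed
    have arith: "v k = v 0 + real k * (v 1 - v 0)" for k
      by (rule second_difference_0_imp_arithmetic[OF v2])
    have fl: "filterlim (\<lambda>k. real k - t) at_top sequentially" by real_asymp
    have "(\<lambda>k. det_error (- (real k - t)) n) \<longlonglongrightarrow> barnes_error n"
      by (rule filterlim_compose[OF det_error_limit[OF n0] fl])
    then have "(\<lambda>k. det_error (t - real k) n) \<longlonglongrightarrow> barnes_error n" by simp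
    \<comment> \<open>The tolerance may depend on the fixed \<open>n\<close>; 1 / n leaves an error
      that vanishes in the final limit over \<open>n\<close>.\<close>
    from LIMSEQ_D[OF this, of "1 / real n"] obtain K where
      K: "\<And>k. k \<ge> K \<Longrightarrow> \<bar>det_error (t - real k) n - barnes_error n\<bar> < 1 / real n" using n0 by auto
    have vb: "\<bar>v k - barnes_error n\<bar> \<le> C / real n ^ 4 + 1 / real n" if k: "k \<ge> K" for k
    proof -
      have "t - real k \<le> T" by (simp add: T_def)
      from R[OF this n] K[OF k] show ?thesis unfolding v_def by linarith
    qed
    have "v 1 - v 0 = 0"
    proof (rule bounded_arithmetic_progression)
      fix k assume "k \<ge> K"
      from vb[OF this] show "\<bar>(v 0 - barnes_error n) + real k * (v 1 - v 0)\<bar> \<le> C / real n ^ 4 + 1 / real n"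
        unfolding arith[of k] by (simp add: algebra_simps)
    qed
    then have "v K = v 0" using arith[of K] by simp
    then show ?thesis using vb[of K] by (simp add: v_def)
  qed
  have "(\<lambda>n. (c1 t * real n + c0 t - barnes_error n) + (barnes_error n - Z)) \<longlonglongrightarrow> 0 + 0"
  proof (rule tendsto_add)
    have l: "(\<lambda>n. C / real n ^ 4 + 1 / real n) \<longlonglongrightarrow> 0" by real_asymp
    show "(\<lambda>n. c1 t * real n + c0 t - barnes_error n) \<longlonglongrightarrow> 0"
      by (rule Lim_null_comparison[OF _ l]) (use bound in \<open>auto simp: eventually_sequentially intro!: exI[of _ N]\<close>)
    show "(\<lambda>n. barnes_error n - Z) \<longlonglongrightarrow> 0" using Z by (simp add: LIM_zero)
  qed
  then have "(\<lambda>n. c1 t * real n + (c0 t - Z)) \<longlonglongrightarrow> 0" by (simp add: algebra_simps)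
  from affine_sequence_eq_0[OF this] have c: "c1 t = 0" "c0 t = Z" by auto
  show ?thesis
  proof (rule that[OF N])
    show "\<bar>det_error t n - Z\<bar> \<le> C / real n ^ 4" if "n \<ge> N" for n
      using R[of t n] that c by (simp add: T_def)
  qed
qed

section \<open>The approximation for fixed \<open>t\<close>\<close>

text \<open>In terms of \<open>s = t / sqrt (12 x)\<close> one has \<open>dd = sqrt (12 x) sqrt (1 + s\<^sup>2)\<close> and
  \<open>rr = sqrt (12 x) (s + sqrt (1 + s\<^sup>2)) / 12\<close>, which splits off the powers of \<open>x\<close>.\<close>
definition Aser :: "real \<Rightarrow> real" where
  "Aser s = ln (s + sqrt (1 + s^2)) / 2 - 3 * (s + sqrt (1 + s^2))^2 * (1 + s^2)
     + 11 / 3 * (s + sqrt (1 + s^2))^3 * sqrt (1 + s^2) - 25 / 24 * (s + sqrt (1 + s^2))^4"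

definition Bser :: "real \<Rightarrow> real" where
  "Bser s = ln (s + sqrt (1 + s^2)) + ln (1 + s^2) / 2"

definition Gser :: "real \<Rightarrow> real" where
  "Gser s = f2_diffs (1 / ((s + sqrt (1 + s^2)) * sqrt (1 + s^2))) (1 / (12 * (1 + s^2)))
     ((s + sqrt (1 + s^2)) / (12 * sqrt (1 + s^2))) ! 0"

text \<open>The variable \<open>s\<close> has order n^-1/2 and \<open>Aser\<close> is multiplied by
  n^2, so the error s^9 becomes n^-5/2. For the same precision \<open>Bser\<close>, with a constant
  factor, needs the error s^5, and \<open>Gser\<close>, divided by n^2, only its value at 0.\<close>

lemma Aser_expansion:
  "(\<lambda>s. Aser s - (4 / 3 * s - 3 / 8 + s^2 + 2 / 3 * s^3 + s^4 / 3 + s^5 / 10 - s^7 / 84)) \<in> O[at 0](\<lambda>s. s^9)"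
  unfolding Aser_def by real_asymp

lemma Bser_expansion:
  "(\<lambda>s. Bser s - (s + s^2 / 2 - s^3 / 6 - s^4 / 4)) \<in> O[at 0](\<lambda>s. s^5)"
  unfolding Bser_def by real_asymp

lemma Gser_expansion:
  "(\<lambda>s. Gser s + 267 / 34560) \<in> O[at 0](\<lambda>s. s)"
proof -
  have g: "f2_diffs (1 / (p * u)) (1 / (12 * u^2)) (p / (12 * u)) ! 0
      = - (1 / (960 * p^2 * u^2)) - 1 / (960 * p * u^3) - 1 / (1280 * u^4) - 7 * p / (1440 * u^5)" for p u :: real
    by (simp add: f2_diffs_def power_mult_distrib power_divide eval_nat_numeral mult_ac)
  have e: "Gser s + 267 / 34560 = 267 / 34560 - 1 / (960 * (s + sqrt (1 + s^2))^2 * sqrt (1 + s^2)^2)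
      - 1 / (960 * (s + sqrt (1 + s^2)) * sqrt (1 + s^2)^3)
      - 1 / (1280 * sqrt (1 + s^2)^4) - 7 * (s + sqrt (1 + s^2)) / (1440 * sqrt (1 + s^2)^5)" for s :: real
  proof -
    have "1 + s^2 = sqrt (1 + s^2)^2" by simp
    then show ?thesis using g[of "s + sqrt (1 + s^2)" "sqrt (1 + s^2)"] unfolding Gser_def by simp
  qed
  show ?thesis unfolding e by real_asymp
qed

text \<open>The filter \<open>at 0\<close> ignores the point 0 itself, but for \<open>t = 0\<close>
  the argument t / sqrt (12 n) is constantly 0. The assumption \<open>f 0 = 0\<close> covers this
  case.\<close>

lemma local_bound_at_0:
  fixes f g :: "real \<Rightarrow> real"
  assumes "f \<in> O[at 0](g)" "f 0 = 0"
  obtains c d where "d > 0" "c > 0" "\<And>s. \<bar>s\<bar> < d \<Longrightarrow> \<bar>f s\<bar> \<le> c * \<bar>g s\<bar>"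
proof -
  from assms(1) obtain c where c: "c > 0" "\<forall>\<^sub>F s in at 0. norm (f s) \<le> c * norm (g s)"
    by (rule landau_o.bigE)
  from c(2) obtain d where d: "d > 0" "\<forall>s\<in>UNIV. s \<noteq> 0 \<and> dist s 0 < d \<longrightarrow> norm (f s) \<le> c * norm (g s)"
    unfolding eventually_at by blast
  show ?thesis
  proof (rule that[OF d(1) c(1)])
    show "\<bar>f s\<bar> \<le> c * \<bar>g s\<bar>" if "\<bar>s\<bar> < d" for s
      using d(2) that c(1) assms(2) by (cases "s = 0") (auto simp: dist_real_def)
  qed
qed

lemma bigo_compose_scaled:
  fixes f :: "real \<Rightarrow> real"
  assumes f: "f \<in> O[at 0](\<lambda>s. s ^ k)" "f 0 = 0"
  shows "(\<lambda>n. f (t / sqrt (12 * real n))) \<in> O(\<lambda>n. real n powr (- real k / 2))"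
proof -
  obtain c d where d: "d > 0" "c > 0" and b: "\<And>s. \<bar>s\<bar> < d \<Longrightarrow> \<bar>f s\<bar> \<le> c * \<bar>s ^ k\<bar>"
    by (rule local_bound_at_0[OF f], rule that)
  have "(\<lambda>n. t / sqrt (12 * real n)) \<longlonglongrightarrow> 0" by real_asymp
  from tendstoD[OF this d(1)] have "\<forall>\<^sub>F n in sequentially. \<bar>t / sqrt (12 * real n)\<bar> < d"
    by (simp add: dist_real_def)
  then have "\<forall>\<^sub>F n in sequentially. norm (f (t / sqrt (12 * real n))) \<le> (c * \<bar>t / sqrt 12\<bar> ^ k) * norm (real n powr (- real k / 2))"
    using eventually_gt_at_top[of 0]
  proof eventually_elim
    case (elim n)
    have "\<bar>f (t / sqrt (12 * real n))\<bar> \<le> c * \<bar>t / sqrt (12 * real n)\<bar> ^ k"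
      using b[OF elim(1)] by (simp add: power_abs)
    also have "\<bar>t / sqrt (12 * real n)\<bar> = \<bar>t / sqrt 12\<bar> * (1 / sqrt (real n))"
      by (simp add: real_sqrt_mult abs_mult)
    also have "1 / sqrt (real n) = real n powr (- 1 / 2)"
    proof -
      have "real n powr (- 1 / 2) = real n powr (- (1 / 2))" by simp
      also have "\<dots> = inverse (real n powr (1 / 2))" by (rule powr_minus)
      also have "\<dots> = 1 / sqrt (real n)" by (simp only: powr_half_sqrt of_nat_0_le_iff inverse_eq_divide)
      finally show ?thesis ..
    qed
    also have "(\<bar>t / sqrt 12\<bar> * real n powr (- 1 / 2)) ^ k = \<bar>t / sqrt 12\<bar> ^ k * real n powr (- real k / 2)"
    proof -
      have "(real n powr (- 1 / 2)) ^ k = real n powr (real k * (- 1 / 2))"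
        using elim by (intro powr_power) simp
      also have "real k * (- 1 / 2) = - real k / 2" by simp
      finally show ?thesis by (simp only: power_mult_distrib)
    qed
    finally show ?case by (simp add: mult.assoc)
  qed
  then show ?thesis by (rule bigoI)
qed

lemma f2_diffs_scale: "f2_diffs (w / x) (e / x) h ! 0 = f2_diffs w e h ! 0 / x^2"
  by (simp add: f2_diffs_def power2_eq_square add_divide_distrib diff_divide_distrib)

lemma det_approx_scaled:
  fixes t x :: real
  assumes n: "x > 0"
  defines "s \<equiv> t / sqrt (12 * x)"
  shows "det_approx t x = x^2 * (ln (x / 12) / 4) + x^2 * Aser s + x * ln (2 * pi) - ln (2 * x) / 12 - Bser s / 12 + Gser s / x^2"
proof -
  define u where "u = sqrt (1 + s^2)"
  define q where "q = sqrt (12 * x)"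
  have q: "q > 0" "q^2 = 12 * x" using n by (auto simp: q_def)
  have u: "u > 0" "u^2 = 1 + s^2" by (auto simp: u_def add_pos_nonneg)
  have ts: "t = s * q" using q by (simp add: s_def q_def)
  have d: "dd t x = q * u"
  proof -
    have "t^2 + 12 * x = q^2 * (1 + s^2)" using q(2) unfolding ts by (simp add: power_mult_distrib algebra_simps)
    then have "dd t x = sqrt (q^2 * (1 + s^2))" by (simp only: dd_def)
    also have "\<dots> = q * u" using q(1) by (simp add: u_def real_sqrt_mult)
    finally show ?thesis .
  qed
  have "rr t x = (t + q * u) / 12" unfolding rr_def d ..
  also have "\<dots> = q * (s + u) / 12" by (subst ts) (simp add: algebra_simps)
  finally have r: "rr t x = q * (s + u) / 12" .
  have su: "s + u > 0"
    using rr_pos[OF n, of t] q(1) unfolding r by (simp add: zero_less_mult_iff zero_less_divide_iff)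
  have lq: "ln q = ln (12 * x) / 2" using n by (simp add: q_def ln_sqrt)
  have lu: "ln u = ln (1 + s^2) / 2" by (simp add: u_def ln_sqrt)
  have lr: "ln (rr t x) = ln (x / 12) / 2 + ln (s + u)"
    unfolding r using q su n by (simp add: ln_mult ln_div lq)
  have ld: "ln (dd t x) = ln (12 * x) / 2 + ln (1 + s^2) / 2"
    unfolding d using q u by (simp add: ln_mult lq lu)
  have f1: "f1 t x = - ln (2 * x) / 12 - Bser s / 12"
  proof -
    have l: "ln (x / 12) = ln x - ln 12" "ln (12 * x) = ln 12 + ln x" "ln (2 * x) = ln 2 + ln x"
      using n by (simp_all add: ln_mult ln_div)
    show ?thesis unfolding f1_def lr ld Bser_def u_def[symmetric] l by (simp add: field_simps)
  qed
  have q4: "q^4 = 144 * x^2"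
  proof -
    have "q^4 = (q^2)^2" by simp
    then show ?thesis unfolding q(2) by (simp add: power_mult_distrib)
  qed
  have f0: "f0 t x = x^2 * (ln (x / 12) / 4) + x^2 * Aser s + x * ln (2 * pi)"
  proof -
    have A: "Aser s = ln (s + u) / 2 - 3 * (s + u)^2 * u^2 + 11 / 3 * (s + u)^3 * u - 25 / 24 * (s + u)^4"
      unfolding Aser_def u_def by simp
    have f: "3 * rr t x ^ 2 * dd t x ^ 2 = q^4 * (s + u)^2 * u^2 / 48"
      "44 * rr t x ^ 3 * dd t x = q^4 * (11 / 432) * (s + u)^3 * u"
      "150 * rr t x ^ 4 = q^4 * (25 / 3456) * (s + u)^4"
      unfolding r d by (simp_all add: power_mult_distrib power_divide eval_nat_numeral)
    show ?thesis unfolding f0_def lr A f q4 by (simp add: field_simps)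
  qed
  have w: "ww t x = (1 / ((s + u) * u)) / x" and e: "ee t x = (1 / (12 * (1 + s^2))) / x"
    and h: "rho t x = (s + u) / (12 * u)"
  proof -
    have "dd t x * rr t x = q^2 * ((s + u) * u / 12)"
      unfolding r d by (simp add: power2_eq_square algebra_simps)
    then have "dd t x * rr t x = x * ((s + u) * u)" unfolding q(2) by simp
    then show "ww t x = (1 / ((s + u) * u)) / x"
      unfolding ww_def by (simp add: mult.commute)
    show "ee t x = (1 / (12 * (1 + s^2))) / x"
      unfolding ee_def d power_mult_distrib u(2) q(2) by simp
    show "rho t x = (s + u) / (12 * u)" unfolding rho_def r d using q u by simp
  qed
  have f2: "f2_diffs (ww t x) (ee t x) (rho t x) ! 0 = Gser s / x^2"
    unfolding w e h Gser_def u_def[symmetric] by (rule f2_diffs_scale)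
  show ?thesis unfolding det_approx_def f0 f1 f2 by simp
qed

lemma det_approx_expansion:
  "(\<lambda>n :: nat. det_approx t (real n) -
     ( (real n)^2 * ln (real n) / 4
     - (3 / 8 + ln 12 / 4) * (real n)^2
     + 2 * real n powr (3 / 2) * t / (3 * sqrt 3)
     + (t^2 / 12 + ln (2 * pi)) * real n
     + real n powr (1 / 2) * t^3 / (36 * sqrt 3)
     - ln (real n) / 12
     + t^4 / 432
     - ln 2 / 12
     + t * (t^4 - 120) / (2880 * sqrt 3 * real n powr (1 / 2))
     - t^2 / (288 * real n)
     - t^3 * (t^4 - 168) / (290304 * sqrt 3 * real n powr (3 / 2))
     + (5 * t^4 - 267) / (34560 * (real n)^2)))
   \<in> O(\<lambda>n. real n powr (- 5 / 2))" (is "(\<lambda>n. det_approx t (real n) - ?L n) \<in> _")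
proof -
  define A where "A s = Aser s - (4 / 3 * s - 3 / 8 + s^2 + 2 / 3 * s^3 + s^4 / 3 + s^5 / 10 - s^7 / 84)" for s
  define B where "B s = Bser s - (s + s^2 / 2 - s^3 / 6 - s^4 / 4)" for s
  define G where "G s = Gser s + 267 / 34560" for s
  define \<sigma> where "\<sigma> n = t / sqrt (12 * real n)" for n
  have A: "(\<lambda>n. A (\<sigma> n)) \<in> O(\<lambda>n. real n powr (- real 9 / 2))"
    unfolding \<sigma>_def by (rule bigo_compose_scaled) (use Aser_expansion in \<open>simp_all add: A_def[abs_def] Aser_def\<close>)
  have B: "(\<lambda>n. B (\<sigma> n)) \<in> O(\<lambda>n. real n powr (- real 5 / 2))"
    unfolding \<sigma>_def by (rule bigo_compose_scaled) (use Bser_expansion in \<open>simp_all add: B_def[abs_def] Bser_def\<close>)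
  have G: "(\<lambda>n. G (\<sigma> n)) \<in> O(\<lambda>n. real n powr (- real 1 / 2))"
    unfolding \<sigma>_def
  proof (rule bigo_compose_scaled)
    show "G \<in> O[at 0](\<lambda>s. s ^ 1)" using Gser_expansion by (simp add: G_def[abs_def])
    show "G 0 = 0" by (simp add: G_def Gser_def f2_diffs_def power_divide)
  qed
  have eq: "det_approx t (real n) - ?L n = (real n)^2 * A (\<sigma> n) - B (\<sigma> n) / 12 + G (\<sigma> n) / (real n)^2" if n: "n > 0" for n
  proof -
    define q where "q = sqrt (real n)"
    define c where "c = sqrt (3::real)"
    define s where "s = \<sigma> n"
    have q: "q > 0" "real n = q^2" using n by (auto simp: q_def)
    have c: "c > 0" "c^2 = 3" by (auto simp: c_def)
    have p: "real n powr (1 / 2) = q" "real n powr (3 / 2) = q^3"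
    proof -
      show h: "real n powr (1 / 2) = q" by (simp add: q_def powr_half_sqrt)
      have "real n powr (3 / 2) = real n powr (1 + 1 / 2)" by simp
      also have "\<dots> = q^2 * q" using n by (simp only: powr_add h) (use q in simp)
      finally show "real n powr (3 / 2) = q^3" by (simp add: power2_eq_square power3_eq_cube)
    qed
    have "s = t / (2 * c * q)"
    proof -
      have "sqrt (4 * 3 :: real) = sqrt 4 * sqrt 3" by (rule real_sqrt_mult)
      then have s12: "sqrt (12::real) = 2 * c" by (simp add: c_def)
      show ?thesis unfolding s_def \<sigma>_def real_sqrt_mult s12 q_def ..
    qed
    then have t: "t = 2 * c * q * s" using c q by simp
    have nz: "c \<noteq> 0" "q \<noteq> 0" using c q by auto
    have c3: "c^3 = c * 3" "c^4 = 9"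
    proof -
      have "c^3 = c * c^2" "c^4 = (c^2)^2" by (simp_all add: power2_eq_square power3_eq_cube power4_eq_xxxx)
      then show "c^3 = c * 3" "c^4 = 9" unfolding c by simp_all
    qed
    have tp: "t^2 = 12 * q^2 * s^2" "t^3 = 24 * c * q^3 * s^3" "t^4 = 144 * q^4 * s^4"
      unfolding t by (simp_all add: power_mult_distrib c c3)
    \<comment> \<open>Terms with q^4 stem from \<open>Aser\<close>, the bare powers of
      \<open>s\<close> from \<open>Bser\<close>, and 267/34560 from \<open>Gser\<close>. In the last
      terms of the expansion these contributions share a power of \<open>n\<close>, which explains
      brackets such as t^4 - 120.\<close>
    have terms: "2 * q^3 * t / (3 * c) = q^4 * (4 / 3 * s)"
      "t^2 / 12 * q^2 = q^4 * s^2"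
      "q * t^3 / (36 * c) = q^4 * (2 / 3 * s^3)"
      "t^4 / 432 = q^4 * (s^4 / 3)"
      "t * (t^4 - 120) / (2880 * c * q) = q^4 * (s^5 / 10) - s / 12"
      "t^2 / (288 * q^2) = s^2 / 24"
      "t^3 * (t^4 - 168) / (290304 * c * q^3) = q^4 * (s^7 / 84) - s^3 / 72"
      "(5 * t^4 - 267) / (34560 * (q^2)^2) = s^4 / 48 - 267 / 34560 / (q^2)^2"
      unfolding tp using nz by (simp_all add: t field_simps eval_nat_numeral)
    have ln: "ln (real n / 12) = ln (real n) - ln 12" "ln (2 * real n) = ln 2 + ln (real n)"
      using n by (simp_all add: ln_div ln_mult)
    have det_approx: "det_approx t (real n) = (real n)^2 * (ln (real n / 12) / 4) + (real n)^2 * Aser s + real n * ln (2 * pi)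
        - ln (2 * real n) / 12 - Bser s / 12 + Gser s / (real n)^2"
      unfolding s_def \<sigma>_def using n by (intro det_approx_scaled) auto
    have A: "Aser s = A s + (4 / 3 * s - 3 / 8 + s^2 + 2 / 3 * s^3 + s^4 / 3 + s^5 / 10 - s^7 / 84)"
      and B: "Bser s = B s + (s + s^2 / 2 - s^3 / 6 - s^4 / 4)" and G: "Gser s = G s - 267 / 34560"
      by (simp_all add: A_def B_def G_def)
    have L: "?L n = (real n)^2 * ln (real n) / 4 - (3 / 8 + ln 12 / 4) * (real n)^2 + q^4 * (4 / 3 * s)
      + (q^4 * s^2 + ln (2 * pi) * real n) + q^4 * (2 / 3 * s^3) - ln (real n) / 12 + q^4 * (s^4 / 3) - ln 2 / 12
      + (q^4 * (s^5 / 10) - s / 12) - s^2 / 24 - (q^4 * (s^7 / 84) - s^3 / 72)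
      + (s^4 / 48 - 267 / 34560 / (q^2)^2)"
      unfolding p c_def[symmetric] terms(1,3,4,5,7)[symmetric]
      using terms(2,6,8) unfolding q(2) by (simp only: distrib_right)
    have n2: "(real n)^2 = q^4" unfolding q(2) by simp
    \<comment> \<open>Treating n^2 as an atom makes the remaining identity linear, so that no powers
      of \<open>q\<close> need to be matched.\<close>
    obtain Q where Q: "q^4 = Q" "(q^2)^2 = Q" by simp
    have Q0: "Q \<noteq> 0" using nz Q by auto
    show ?thesis
      unfolding L unfolding det_approx unfolding ln A B G n2 s_def[symmetric] Q
      using Q0 by (simp add: field_simps)
  qed
  have "(\<lambda>n. (real n)^2 * A (\<sigma> n)) \<in> O(\<lambda>n. real n ^ 2 * real n powr (- real 9 / 2))"
    by (intro landau_o.big.mult_left A)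
  also have "(\<lambda>n. real n ^ 2 * real n powr (- real 9 / 2)) \<in> O(\<lambda>n. real n powr (- 5 / 2))" by real_asymp
  finally have 1: "(\<lambda>n. (real n)^2 * A (\<sigma> n)) \<in> O(\<lambda>n. real n powr (- 5 / 2))" .
  have 2: "(\<lambda>n. B (\<sigma> n) / 12) \<in> O(\<lambda>n. real n powr (- 5 / 2))" using B by simp
  have "(\<lambda>n. G (\<sigma> n) / (real n)^2) \<in> O(\<lambda>n. real n powr (- real 1 / 2) / real n ^ 2)"
    by (intro landau_o.big.divide_right G eventually_mono[OF eventually_gt_at_top[of 0]]) auto
  also have "(\<lambda>n. real n powr (- real 1 / 2) / real n ^ 2) \<in> O(\<lambda>n. real n powr (- 5 / 2))" by real_asymp
  finally have 3: "(\<lambda>n. G (\<sigma> n) / (real n)^2) \<in> O(\<lambda>n. real n powr (- 5 / 2))" .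
  have "(\<lambda>n. (real n)^2 * A (\<sigma> n) - B (\<sigma> n) / 12 + G (\<sigma> n) / (real n)^2) \<in> O(\<lambda>n. real n powr (- 5 / 2))"
    by (intro sum_in_bigo 1 2 3)
  then show ?thesis
    by (rule landau_o.big.in_cong[THEN iffD1, rotated]) (use eq in \<open>auto simp: eventually_at_top_linorder intro!: exI[of _ 1]\<close>)
qed

section \<open>Analytic continuation of the zeta function\<close>

definition npow :: "nat \<Rightarrow> complex \<Rightarrow> complex" where
  "npow k w = of_nat (Suc k) powr w"

definition falling :: "complex \<Rightarrow> nat \<Rightarrow> complex" where
  "falling a i = (\<Prod>j<i. a - of_nat j)"

text \<open>The remainder at k + 2 of the Taylor polynomial of z^a of degree \<open>K\<close> about
  k + 1. It is a finite combination of powers, so it is entire in \<open>a\<close>.\<close>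

definition taylor_rem :: "nat \<Rightarrow> nat \<Rightarrow> complex \<Rightarrow> complex" where
  "taylor_rem K k a = npow (Suc k) a - (\<Sum>i\<le>K. falling a i * npow k (a - of_nat i) / fact i)"

lemma norm_npow: "norm (npow k w) = real (Suc k) powr Re w"
  unfolding npow_def by (subst norm_powr_real_powr) auto

lemma npow_holomorphic [holomorphic_intros]: "f holomorphic_on S \<Longrightarrow> (\<lambda>s. npow k (f s)) holomorphic_on S"
  unfolding npow_def by (intro holomorphic_intros) auto

lemma falling_holomorphic [holomorphic_intros]: "f holomorphic_on S \<Longrightarrow> (\<lambda>s. falling (f s) i) holomorphic_on S"
  unfolding falling_def by (intro holomorphic_intros)

lemma taylor_rem_holomorphic [holomorphic_intros]:
  "f holomorphic_on S \<Longrightarrow> (\<lambda>s. taylor_rem K k (f s)) holomorphic_on S"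
  unfolding taylor_rem_def by (intro holomorphic_intros) auto

lemma norm_falling_le: "norm (falling a i) \<le> (norm a + real i) ^ i"
proof -
  have "norm (falling a i) = (\<Prod>j<i. norm (a - of_nat j))" unfolding falling_def by (simp add: prod_norm)
  also have "\<dots> \<le> (\<Prod>j<i. norm a + real i)"
  proof (rule prod_mono)
    fix j assume "j \<in> {..<i}"
    moreover have "norm (a - of_nat j) \<le> norm a + norm (of_nat j :: complex)" by (rule norm_triangle_ineq4)
    ultimately show "0 \<le> norm (a - of_nat j) \<and> norm (a - of_nat j) \<le> norm a + real i" by simp
  qed
  finally show ?thesis by simp
qed

text \<open>The complex Taylor theorem is applied on the real ray from k + 1, a convex set that
  avoids the branch cut. The condition on \<open>Re a\<close> makes the modulus of the derivative of
  order K + 1 largest at the left end.\<close>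

lemma taylor_rem_bound:
  assumes "Re a \<le> real (Suc K)"
  shows "norm (taylor_rem K k a) \<le> (norm a + real (Suc K)) ^ Suc K * real (Suc k) powr (Re a - real (Suc K))"
proof -
  define S where "S = {z :: complex. Im z = 0 \<and> real (Suc k) \<le> Re z}"
  have S: "convex S" unfolding S_def
  proof (rule convexI)
    fix x y :: complex and u v :: real
    assume xy: "x \<in> {z. Im z = 0 \<and> real (Suc k) \<le> Re z}" "y \<in> {z. Im z = 0 \<and> real (Suc k) \<le> Re z}"
      and uv: "0 \<le> u" "0 \<le> v" "u + v = 1"
    have "u * real (Suc k) + v * real (Suc k) \<le> u * Re x + v * Re y"
      using xy uv by (intro add_mono mult_left_mono) auto
    moreover have "u * real (Suc k) + v * real (Suc k) = real (Suc k)"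
      unfolding distrib_right[symmetric] uv(3) by simp
    ultimately show "u *\<^sub>R x + v *\<^sub>R y \<in> {z. Im z = 0 \<and> real (Suc k) \<le> Re z}" using xy by simp
  qed
  define f where "f i z = falling a i * z powr (a - of_nat i)" for i :: nat and z
  have der: "(f i has_field_derivative f (Suc i) x) (at x within S)" if "x \<in> S" for i x
  proof -
    have "x \<notin> \<real>\<^sub>\<le>\<^sub>0" using that by (auto simp: S_def complex_nonpos_Reals_iff)
    then have "((\<lambda>z. z powr (a - of_nat i)) has_field_derivative (a - of_nat i) * x powr (a - of_nat i - 1)) (at x)"
      by (rule has_field_derivative_powr)
    then have "((\<lambda>z. falling a i * z powr (a - of_nat i)) has_field_derivative falling a i * ((a - of_nat i) * x powr (a - of_nat i - 1))) (at x within S)"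
      by (rule has_field_derivative_at_within[OF DERIV_cmult])
    moreover have "falling a i * ((a - of_nat i) * x powr (a - of_nat i - 1)) = f (Suc i) x"
      by (simp add: f_def falling_def diff_diff_eq add.commute)
    ultimately show ?thesis unfolding f_def[abs_def] by simp
  qed
  define B where "B = (norm a + real (Suc K)) ^ Suc K * real (Suc k) powr (Re a - real (Suc K))"
  have B0: "B \<ge> 0" by (simp add: B_def)
  have bd: "norm (f (Suc K) x) \<le> B" if "x \<in> S" for x
  proof -
    have x: "x \<in> \<real>" "real (Suc k) \<le> Re x" using that by (auto simp: S_def complex_is_Real_iff)
    have "norm (x powr (a - of_nat (Suc K))) = Re x powr (Re a - real (Suc K))"
      using x by (subst norm_powr_real_powr) auto
    also have "\<dots> \<le> real (Suc k) powr (Re a - real (Suc K))"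
      using x assms by (intro powr_mono2') auto
    finally show ?thesis unfolding f_def B_def norm_mult by (intro mult_mono norm_falling_le) auto
  qed
  have wz: "of_nat (Suc k) \<in> S" "of_nat (Suc (Suc k)) \<in> S" by (auto simp: S_def)
  have "norm (f 0 (of_nat (Suc (Suc k))) - (\<Sum>i\<le>K. f i (of_nat (Suc k)) * (of_nat (Suc (Suc k)) - of_nat (Suc k)) ^ i / fact i))
     \<le> B * norm (of_nat (Suc (Suc k)) - of_nat (Suc k) :: complex) ^ Suc K / fact K"
  proof (rule field_Taylor[where S = S and f = f])
    show "(f i has_field_derivative f (Suc i) x) (at x within S)" if "x \<in> S" for i x
      using that by (rule der)
    show "norm (f (Suc K) x) \<le> B" if "x \<in> S" for x
      using that by (rule bd)
  qed (fact S wz)+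
  moreover have d1: "of_nat (Suc (Suc k)) - of_nat (Suc k) = (1 :: complex)" by simp
  moreover have "falling a 0 = 1" by (simp add: falling_def)
  ultimately have "norm (taylor_rem K k a) \<le> B / fact K"
    unfolding d1 taylor_rem_def f_def npow_def
    by (simp only: power_one norm_one mult_1_right mult_1_left of_nat_0 diff_zero)
  also have "\<dots> \<le> B / 1" using B0 by (intro divide_left_mono) (auto simp: fact_ge_1)
  finally show ?thesis by (simp add: B_def)
qed

text \<open>Weierstrass' theorem with local summable majorants. The termwise derivatives are
  recorded because the value of the zeta derivative is read off from a differentiated
  series.\<close>

lemma holomorphic_series:
  fixes f :: "nat \<Rightarrow> complex \<Rightarrow> complex"
  assumes S: "open S" and hol: "\<And>k. f k holomorphic_on S"
    and bd: "\<And>x. x \<in> S \<Longrightarrow> \<exists>d h. 0 < d \<and> summable h \<and> (\<forall>k. \<forall>y\<in>ball x d \<inter> S. norm (f k y) \<le> h k)"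
  obtains g where "g holomorphic_on S" "\<And>x. x \<in> S \<Longrightarrow> (\<lambda>k. f k x) sums g x"
    "\<And>x. x \<in> S \<Longrightarrow> (\<lambda>k. deriv (f k) x) sums deriv g x"
proof -
  have "\<exists>g g'. \<forall>x\<in>S. ((\<lambda>k. f k x) sums g x) \<and> ((\<lambda>k. deriv (f k) x) sums g' x) \<and> (g has_field_derivative g' x) (at x)"
  proof (rule series_and_derivative_comparison_local[OF S])
    show "(f k has_field_derivative deriv (f k) x) (at x)" if "x \<in> S" for k x
      using hol S that by (rule holomorphic_derivI)
    show "\<exists>d h. 0 < d \<and> summable h \<and> (\<forall>\<^sub>F k in sequentially. \<forall>y\<in>ball x d \<inter> S. norm (f k y) \<le> h k)" if x: "x \<in> S" for x
    proof -
      obtain d h where "0 < d" "summable h" "\<forall>k. \<forall>y\<in>ball x d \<inter> S. norm (f k y) \<le> h k"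
        using bd[OF x] by blast
      then show ?thesis by (intro exI[of _ d] exI[of _ h] conjI always_eventually) auto
    qed
  qed
  then obtain g g' where g: "\<And>x. x \<in> S \<Longrightarrow> (\<lambda>k. f k x) sums g x" "\<And>x. x \<in> S \<Longrightarrow> (\<lambda>k. deriv (f k) x) sums g' x"
    "\<And>x. x \<in> S \<Longrightarrow> (g has_field_derivative g' x) (at x)" by blast
  show ?thesis
  proof (rule that)
    show "g holomorphic_on S" using g(3) S by (auto simp: holomorphic_on_open)
    show "(\<lambda>k. f k x) sums g x" if "x \<in> S" for x using g(1)[OF that] .
    show "(\<lambda>k. deriv (f k) x) sums deriv g x" if "x \<in> S" for x
      using g(2)[OF that] DERIV_imp_deriv[OF g(3)[OF that]] by simp
  qed
qed

lemma summable_Suc_powr: "p < - 1 \<Longrightarrow> summable (\<lambda>k. real (Suc k) powr p)"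
  using summable_Suc_iff[of "\<lambda>k. real k powr p"] summable_real_powr_iff[of p] by simp

text \<open>Within half the distance \<open>2 * d\<close> from \<open>x\<close> to the boundary
  line, the exponent stays below -1 - d and the polynomial factor is bounded, which gives one
  summable majorant for the whole ball.\<close>

lemma halfplane_bound:
  fixes f :: "nat \<Rightarrow> complex \<Rightarrow> complex"
  assumes bd: "\<And>k s. \<sigma> < Re s \<Longrightarrow> norm (f k s) \<le> (norm s + c) ^ m * real (Suc k) powr (\<sigma> - 1 - Re s)"
    and x: "x \<in> {s. \<sigma> < Re s}" and c: "c \<ge> 0"
  shows "\<exists>d h. 0 < d \<and> summable h \<and> (\<forall>k. \<forall>y\<in>ball x d \<inter> {s. \<sigma> < Re s}. norm (f k y) \<le> h k)"
proof -
  define d where "d = (Re x - \<sigma>) / 2"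
  have d: "d > 0" using x by (simp add: d_def)
  have "norm (f k y) \<le> (norm x + d + c) ^ m * real (Suc k) powr (- 1 - d)" if y: "y \<in> ball x d \<inter> {s. \<sigma> < Re s}" for k y
  proof -
    have xy: "norm (x - y) < d" using y by (simp add: dist_norm)
    have "norm y \<le> norm x + d" using xy norm_triangle_ineq4[of x "x - y"] by simp
    then have "(norm y + c) ^ m \<le> (norm x + d + c) ^ m" using c by (intro power_mono) auto
    moreover have "Re x - Re y < d" using xy abs_Re_le_cmod[of "x - y"] by simp
    then have "\<sigma> - 1 - Re y \<le> - 1 - d" unfolding d_def by (simp add: field_simps)
    then have "real (Suc k) powr (\<sigma> - 1 - Re y) \<le> real (Suc k) powr (- 1 - d)"
      by (intro powr_mono) auto
    ultimately have "(norm y + c) ^ m * real (Suc k) powr (\<sigma> - 1 - Re y) \<le> (norm x + d + c) ^ m * real (Suc k) powr (- 1 - d)"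
      using c d by (intro mult_mono) auto
    with bd[of y k] y show ?thesis by simp
  qed
  moreover have "summable (\<lambda>k. (norm x + d + c) ^ m * real (Suc k) powr (- 1 - d))"
    using d by (intro summable_mult summable_Suc_powr) auto
  ultimately show ?thesis using d by blast
qed

lemma open_halfplane: "open {s. \<sigma> < Re s}"
  by (rule open_halfspace_Re_gt)

lemma dirichlet_zeta:
  obtains \<zeta> where "\<zeta> holomorphic_on {s. 1 < Re s}" "\<And>s. 1 < Re s \<Longrightarrow> (\<lambda>k. npow k (- s)) sums \<zeta> s"
proof -
  have bd: "\<exists>d h. 0 < d \<and> summable h \<and> (\<forall>k. \<forall>y\<in>ball x d \<inter> {s. 1 < Re s}. norm (npow k (- y)) \<le> h k)"
    if "x \<in> {s. 1 < Re s}" for x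
  proof (rule halfplane_bound[of 1 _ 0 0])
    show "x \<in> {s. 1 < Re s}" by (rule that)
  qed (simp_all add: norm_npow)
  have hol: "(\<lambda>s. npow k (- s)) holomorphic_on {s. 1 < Re s}" for k by (intro holomorphic_intros)
  show ?thesis
  proof (rule holomorphic_series[OF open_halfplane hol bd])
    fix g assume g: "g holomorphic_on {s. 1 < Re s}" "\<And>x. x \<in> {s. 1 < Re s} \<Longrightarrow> (\<lambda>k. npow k (- x)) sums g x"
    show ?thesis by (rule that[OF g(1)]) (rule g(2), simp)
  qed
qed

lemma npow_tendsto_0: "Re w < 0 \<Longrightarrow> (\<lambda>k. npow k w) \<longlonglongrightarrow> 0"
proof (rule tendsto_norm_zero_cancel)
  assume w: "Re w < 0"
  have "(\<lambda>k. real (Suc k) powr Re w) \<longlonglongrightarrow> 0"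
    by (rule LIMSEQ_Suc, rule tendsto_neg_powr[OF w]) (rule filterlim_real_sequentially)
  then show "(\<lambda>k. norm (npow k w)) \<longlonglongrightarrow> 0" by (simp only: norm_npow)
qed

text \<open>The factor s - 1 removes the pole, so the continuation can proceed through full
  half-planes, which are convex and hence suited to the identity theorem.\<close>

definition is_zeta_numerator :: "nat \<Rightarrow> (complex \<Rightarrow> complex) \<Rightarrow> bool" where
  "is_zeta_numerator m A \<longleftrightarrow> A holomorphic_on {s. 1 - real m < Re s} \<and>
     (\<forall>s. 1 < Re s \<longrightarrow> (\<lambda>k. (s - 1) * npow k (- s)) sums A s)"

lemma is_zeta_numerator_0: "\<exists>A. is_zeta_numerator 0 A"
proof (rule dirichlet_zeta)
  fix \<zeta> assume z: "\<zeta> holomorphic_on {s. 1 < Re s}" "\<And>s. 1 < Re s \<Longrightarrow> (\<lambda>k. npow k (- s)) sums \<zeta> s"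
  have "is_zeta_numerator 0 (\<lambda>s. (s - 1) * \<zeta> s)"
    unfolding is_zeta_numerator_def using z by (auto intro!: holomorphic_intros sums_mult)
  then show ?thesis by blast
qed

text \<open>Summing the Taylor expansion of \<open>(k + 1)\<^sup>1\<^sup>-\<^sup>s - k\<^sup>1\<^sup>-\<^sup>s\<close> over \<open>k\<close> expresses \<open>(s - 1) \<zeta>(s)\<close> through
  values further to the right, up to a series that converges in a larger half-plane.\<close>
lemma is_zeta_numerator_Suc:
  assumes "is_zeta_numerator m A" shows "\<exists>A'. is_zeta_numerator (Suc m) A'"
proof -
  define K where "K = Suc m"
  define U where "U = {s. 1 - real K < Re s}"
  have A: "A holomorphic_on {s. 1 - real m < Re s}" "\<And>s. 1 < Re s \<Longrightarrow> (\<lambda>k. (s - 1) * npow k (- s)) sums A s"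
    using assms by (auto simp: is_zeta_numerator_def)
  have hol: "(\<lambda>s. taylor_rem K k (1 - s)) holomorphic_on U" for k by (intro holomorphic_intros)
  have bd: "\<exists>d h. 0 < d \<and> summable h \<and> (\<forall>k. \<forall>y\<in>ball x d \<inter> U. norm (taylor_rem K k (1 - y)) \<le> h k)" if x: "x \<in> U" for x
    unfolding U_def
  proof (rule halfplane_bound[where c = "1 + real (Suc K)" and m = "Suc K"])
    show "x \<in> {s. 1 - real K < Re s}" using x by (simp add: U_def)
    fix k s assume s: "1 - real K < Re s"
    have "norm (taylor_rem K k (1 - s)) \<le> (norm (1 - s) + real (Suc K)) ^ Suc K * real (Suc k) powr (Re (1 - s) - real (Suc K))"
      using s by (intro taylor_rem_bound) auto
    also have "Re (1 - s) - real (Suc K) = 1 - real K - 1 - Re s" by simp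
    also have "(norm (1 - s) + real (Suc K)) ^ Suc K * real (Suc k) powr (1 - real K - 1 - Re s)
      \<le> (norm s + (1 + real (Suc K))) ^ Suc K * real (Suc k) powr (1 - real K - 1 - Re s)"
    proof (intro mult_right_mono power_mono)
      show "norm (1 - s) + real (Suc K) \<le> norm s + (1 + real (Suc K))"
        using norm_triangle_ineq4[of 1 s] by simp
    qed auto
    finally show "norm (taylor_rem K k (1 - s)) \<le> (norm s + (1 + real (Suc K))) ^ Suc K * real (Suc k) powr (1 - real K - 1 - Re s)" .
  qed auto
  have oU: "open U" unfolding U_def by (rule open_halfplane)
  show ?thesis
  proof (rule holomorphic_series[OF oU hol bd])
    fix H assume H: "H holomorphic_on U" "\<And>x. x \<in> U \<Longrightarrow> (\<lambda>k. taylor_rem K k (1 - x)) sums H x"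
    \<comment> \<open>In the summed expansion the term of index 1 is the numerator at
      \<open>s\<close> itself and the later ones are its values at s + 1, s + 2, ... Solving for the
      former leaves arguments at least one unit further right, and so gains a strip of width
      1.\<close>
    define A' where "A' s = 1 + H s - (\<Sum>i=1..<K. falling (1 - s) i / (fact i * of_nat (Suc i)) * A (s + of_nat i))" for s
    have "is_zeta_numerator K A'"
      unfolding is_zeta_numerator_def
    proof (intro conjI allI impI)
      have "(\<lambda>s. A (s + of_nat i)) holomorphic_on U" if "i \<in> {1..<K}" for i
      proof -
        have "(A \<circ> (\<lambda>s. s + of_nat i)) holomorphic_on U"
        proof (rule holomorphic_on_compose_gen[OF _ A(1)])
          show "(\<lambda>s. s + of_nat i) ` U \<subseteq> {s. 1 - real m < Re s}"
            using that by (auto simp: U_def K_def)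
        qed (intro holomorphic_intros)
        then show ?thesis by (simp add: o_def)
      qed
      then have "A' holomorphic_on U" unfolding A'_def
        by (intro holomorphic_intros H) auto
      then show "A' holomorphic_on {s. 1 - real K < Re s}" by (simp add: U_def)
    next
      fix s :: complex assume s: "1 < Re s"
      have sU: "s \<in> U" using s by (simp add: U_def)
      \<comment> \<open>The falling factorial of index j + 1 contains 1 - s - j = -(s + j - 1),
        exactly the factor that the numerator carries at s + j.\<close>
      have shift: "(\<lambda>k. falling (1 - s) i * npow k (1 - s - of_nat i) / fact i)
          sums (- (falling (1 - s) (i - 1) / (fact (i - 1) * of_nat i) * A (s + of_nat (i - 1))))" if i: "i \<ge> 1" for i
      proof -
        obtain j where j: "i = Suc j" using i by (cases i) auto
        have "(\<lambda>k. (s + of_nat j - 1) * npow k (- (s + of_nat j))) sums A (s + of_nat j)"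
          using s by (intro A(2)) auto
        then have "(\<lambda>k. - (falling (1 - s) j / (fact j * of_nat (Suc j))) * ((s + of_nat j - 1) * npow k (- (s + of_nat j))))
           sums (- (falling (1 - s) j / (fact j * of_nat (Suc j))) * A (s + of_nat j))" by (rule sums_mult)
        moreover have "- (falling (1 - s) j / (fact j * of_nat (Suc j))) * ((s + of_nat j - 1) * npow k (- (s + of_nat j)))
           = falling (1 - s) i * npow k (1 - s - of_nat i) / fact i" for k
        proof -
          define X where "X = s + of_nat j - 1"
          have "falling (1 - s) i = falling (1 - s) j * (- X)"
            unfolding j falling_def X_def by (simp add: algebra_simps)
          moreover have "npow k (1 - s - of_nat i) = npow k (- (s + of_nat j))" unfolding j by (simp add: algebra_simps)
          moreover have "(fact i :: complex) = fact j * of_nat (Suc j)" unfolding j by simp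
          ultimately show ?thesis unfolding X_def[symmetric] by simp
        qed
        ultimately show ?thesis by (simp add: j)
      qed
      have "(\<lambda>k. npow (Suc k) (1 - s) - npow k (1 - s)) sums (0 - npow 0 (1 - s))"
        using s by (intro telescope_sums npow_tendsto_0) auto
      then have tel: "(\<lambda>k. npow (Suc k) (1 - s) - npow k (1 - s)) sums (- 1)" by (simp add: npow_def)
      define R where "R i = - (falling (1 - s) (i - 1) / (fact (i - 1) * of_nat i) * A (s + of_nat (i - 1)))" for i
      have "(\<lambda>k. (npow (Suc k) (1 - s) - npow k (1 - s)) - (\<Sum>i=1..K. falling (1 - s) i * npow k (1 - s - of_nat i) / fact i))
         sums (- 1 - (\<Sum>i=1..K. R i))"
        unfolding R_def by (intro sums_diff tel sums_sum shift) auto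
      moreover have "taylor_rem K k (1 - s) = (npow (Suc k) (1 - s) - npow k (1 - s)) - (\<Sum>i=1..K. falling (1 - s) i * npow k (1 - s - of_nat i) / fact i)" for k
      proof -
        have "{..K} = insert 0 {1..K}" by auto
        then show ?thesis unfolding taylor_rem_def by (simp add: falling_def)
      qed
      ultimately have "(\<lambda>k. taylor_rem K k (1 - s)) sums (- 1 - (\<Sum>i=1..K. R i))" by simp
      then have Hs: "H s = - 1 - (\<Sum>i=1..K. R i)" using H(2)[OF sU] by (rule sums_unique2[symmetric])
      have "(\<Sum>i=1..K. R i) = R 1 + (\<Sum>i=2..K. R i)"
      proof -
        have "{1..K} = insert 1 {2..K}" by (auto simp: K_def)
        then show ?thesis by simp
      qed
      also have "(\<Sum>i=2..K. R i) = (\<Sum>i=1..<K. R (Suc i))"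
        by (rule sum.reindex_bij_witness[of _ Suc "\<lambda>i. i - 1"]) auto
      also have "R 1 = - A s" by (simp add: R_def falling_def)
      finally have "H s = - 1 + A s - (\<Sum>i=1..<K. R (Suc i))" using Hs by simp
      moreover have "(\<Sum>i=1..<K. R (Suc i)) = - (\<Sum>i=1..<K. falling (1 - s) i / (fact i * of_nat (Suc i)) * A (s + of_nat i))"
        by (simp add: R_def sum_negf)
      ultimately have "A' s = A s" by (simp add: A'_def)
      then show "(\<lambda>k. (s - 1) * npow k (- s)) sums A' s" using A(2)[OF s] by simp
    qed
    then show ?thesis by (auto simp: K_def)
  qed
qed

lemma is_zeta_numerator_ex: "\<exists>A. is_zeta_numerator m A"
  by (induction m) (use is_zeta_numerator_0 is_zeta_numerator_Suc in blast)+

lemma is_zeta_numerator_unique: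
  assumes A: "is_zeta_numerator m A" "is_zeta_numerator n B" and s: "1 - real m < Re s" "1 - real n < Re s"
  shows "A s = B s"
proof (rule analytic_continuation_open[of "{s. 1 < Re s}" "{s. 1 - real (min m n) < Re s}" A B])
  show "open {s. 1 < Re s}" "open {s. 1 - real (min m n) < Re s}" by (rule open_halfplane)+
  show "{s. 1 < Re s} \<noteq> {}" by (auto intro!: exI[of _ "2 :: complex"])
  show "connected {s. 1 - real (min m n) < Re s}" by (intro convex_connected convex_halfspace_Re_gt)
  show "A holomorphic_on {s. 1 - real (min m n) < Re s}" "B holomorphic_on {s. 1 - real (min m n) < Re s}"
    using A by (auto simp: is_zeta_numerator_def elim!: holomorphic_on_subset)
  show "A z = B z" if "z \<in> {s. 1 < Re s}" for z
    using A that by (auto simp: is_zeta_numerator_def intro: sums_unique2)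
qed (use s in auto)

text \<open>The continuations to the half-planes agree on overlaps, so they glue; the index
  \<open>nat \<lceil>2 - Re s\<rceil>\<close> selects a half-plane that contains
  \<open>s\<close>.\<close>

lemma zeta_numerator_entire:
  obtains A where "A holomorphic_on UNIV" "\<And>s. 1 < Re s \<Longrightarrow> (\<lambda>k. (s - 1) * npow k (- s)) sums A s"
proof -
  have "\<forall>m. \<exists>A. is_zeta_numerator m A" using is_zeta_numerator_ex by blast
  from choice[OF this] obtain B where B: "\<And>m. is_zeta_numerator m (B m)" by blast
  define A where "A s = B (nat \<lceil>2 - Re s\<rceil>) s" for s
  have AB: "A s = B m s" if "1 - real m < Re s" for m s
    unfolding A_def by (rule is_zeta_numerator_unique[OF B B _ that]) linarith
  show ?thesis
  proof (rule that)
    have "A field_differentiable (at s)" for s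
    proof -
      define m where "m = nat \<lceil>2 - Re s\<rceil>"
      have s: "s \<in> {s. 1 - real m < Re s}" unfolding m_def by simp linarith
      have "A holomorphic_on {s. 1 - real m < Re s}"
      proof (rule holomorphic_transform)
        show "B m holomorphic_on {s. 1 - real m < Re s}" using B[of m] by (simp add: is_zeta_numerator_def)
        show "B m x = A x" if "x \<in> {s. 1 - real m < Re s}" for x using AB[of m x] that by simp
      qed
      then show ?thesis using s open_halfplane by (auto simp: holomorphic_on_open field_differentiable_def)
    qed
    then show "A holomorphic_on UNIV" by (simp add: holomorphic_on_def field_differentiable_at_within)
    show "(\<lambda>k. (s - 1) * npow k (- s)) sums A s" if "1 < Re s" for s
      using B[of 0] AB[of 0 s] that by (simp add: is_zeta_numerator_def)
  qed
qed

text \<open>Existence of the continuation, without which the choice in the definition of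
  \<open>riemann_zeta\<close> would carry no information.\<close>

lemma is_riemann_zeta_riemann_zeta: "is_riemann_zeta riemann_zeta"
proof (rule zeta_numerator_entire)
  fix A assume A: "A holomorphic_on UNIV" "\<And>s. 1 < Re s \<Longrightarrow> (\<lambda>k. (s - 1) * npow k (- s)) sums A s"
  have "is_riemann_zeta (\<lambda>s. A s / (s - 1))"
    unfolding is_riemann_zeta_def
  proof (intro conjI allI impI)
    show "(\<lambda>s. A s / (s - 1)) holomorphic_on - {1}"
      by (intro holomorphic_intros holomorphic_on_subset[OF A(1)]) auto
    fix s :: complex assume s: "1 < Re s"
    then have "s - 1 \<noteq> 0" by auto
    then have "(s - 1) * npow n (- s) / (s - 1) = 1 / of_nat (Suc n) powr s" for n
      by (simp add: npow_def powr_minus divide_inverse)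
    then show "(\<lambda>n. 1 / of_nat (Suc n) powr s) sums (A s / (s - 1))"
      using sums_divide[OF A(2)[OF s], of "s - 1"] by simp
  qed
  then show ?thesis unfolding riemann_zeta_def by (rule someI[of is_riemann_zeta])
qed

section \<open>The value of \<open>\<zeta>'(-1)\<close> and the Barnes asymptotics\<close>

lemma npow_of_nat: "npow k (of_nat m) = of_nat (Suc k) ^ m"
  unfolding npow_def by (rule powr_nat') (simp del: of_nat_Suc)

lemma npow_deriv:
  assumes "(f has_field_derivative f') (at s)"
  shows "((\<lambda>s. npow k (f s)) has_field_derivative of_real (ln (real (Suc k))) * npow k (f s) * f') (at s)"
proof -
  have "((\<lambda>z. of_nat (Suc k) powr z) has_field_derivative Ln (of_nat (Suc k)) * of_nat (Suc k) powr f s) (at (f s))"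
    by (rule has_field_derivative_powr_right) (simp del: of_nat_Suc)
  from DERIV_chain2[OF this assms] show ?thesis
    unfolding npow_def by (simp add: Ln_of_nat del: of_nat_Suc)
qed

text \<open>Euler-Maclaurin summation of \<open>(s - 1) (k + 1)\<^sup>-\<^sup>s\<close>, convergent for \<open>Re s > -2\<close>.\<close>
definition em_tail :: "nat \<Rightarrow> complex \<Rightarrow> complex" where
  "em_tail k s = npow k (1 - s) + (s - 1) / 2 * npow k (- s) + s * (s - 1) / 12 * npow k (- s - 1)"

definition em_term :: "nat \<Rightarrow> complex \<Rightarrow> complex" where
  "em_term k s = (s - 1) * npow k (- s) + em_tail (Suc k) s - em_tail k s"

text \<open>The Euler-Maclaurin coefficients 1, 1/2 and 1/12 make the main terms of the three Taylor
  expansions cancel. The remainders all have order (k + 1)^(-3 - Re s), summable for Re s > -2, a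
  half-plane that contains -1.\<close>

lemma em_term_taylor: "em_term k s = taylor_rem 3 k (1 - s) + (s - 1) / 2 * taylor_rem 2 k (- s)
   + s * (s - 1) / 12 * taylor_rem 1 k (- s - 1)"
proof -
  have e: "1 - s - 1 = - s" "1 - s - 2 = - s - 1" "1 - s - 3 = - s - 2" "- s - 1 - 1 = - s - 2"
    by simp_all
  have f: "falling a 0 = 1" "falling a 1 = a" "falling a 2 = a * (a - 1)" "falling a 3 = a * (a - 1) * (a - 2)" for a
    by (simp_all add: falling_def eval_nat_numeral)
  have T: "taylor_rem 3 k a = npow (Suc k) a - (falling a 0 * npow k a + falling a 1 * npow k (a - 1)
      + falling a 2 * npow k (a - 2) / 2 + falling a 3 * npow k (a - 3) / 6)"
    "taylor_rem 2 k a = npow (Suc k) a - (falling a 0 * npow k a + falling a 1 * npow k (a - 1)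
      + falling a 2 * npow k (a - 2) / 2)"
    "taylor_rem 1 k a = npow (Suc k) a - (falling a 0 * npow k a + falling a 1 * npow k (a - 1))" for a
    by (simp_all add: taylor_rem_def atMost_Suc numeral_3_eq_3 numeral_2_eq_2 algebra_simps)
  show ?thesis
    unfolding em_term_def em_tail_def T f e by (simp add: field_simps)
qed

lemma em_term_bound:
  assumes s: "- 2 < Re s"
  shows "norm (em_term k s) \<le> (norm s + 5) ^ 5 * real (Suc k) powr (- 2 - 1 - Re s)"
proof -
  define X where "X = norm s + 5"
  define P where "P = real (Suc k) powr (- 2 - 1 - Re s)"
  have X: "X \<ge> 5" and P: "P \<ge> 0" by (auto simp: X_def P_def)
  have s1: "norm (s - 1) \<le> X" "norm s \<le> X" using norm_triangle_ineq4[of s 1] by (auto simp: X_def)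
  have "norm (taylor_rem 3 k (1 - s)) \<le> (norm (1 - s) + real (Suc 3)) ^ Suc 3 * real (Suc k) powr (Re (1 - s) - real (Suc 3))"
    using s by (intro taylor_rem_bound) auto
  also have "Re (1 - s) - real (Suc 3) = - 2 - 1 - Re s" by simp
  also have "(norm (1 - s) + real (Suc 3)) ^ Suc 3 * real (Suc k) powr (- 2 - 1 - Re s) \<le> X ^ 4 * P"
    unfolding P_def[symmetric] using P norm_triangle_ineq4[of 1 s] by (intro mult_right_mono) (auto simp: X_def intro!: power_mono)
  finally have 1: "norm (taylor_rem 3 k (1 - s)) \<le> X ^ 4 * P" .
  have "norm (taylor_rem 2 k (- s)) \<le> (norm (- s) + real (Suc 2)) ^ Suc 2 * real (Suc k) powr (Re (- s) - real (Suc 2))"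
    using s by (intro taylor_rem_bound) auto
  also have "Re (- s) - real (Suc 2) = - 2 - 1 - Re s" by simp
  also have "(norm (- s) + real (Suc 2)) ^ Suc 2 * real (Suc k) powr (- 2 - 1 - Re s) \<le> X ^ 3 * P"
    unfolding P_def[symmetric] using P by (intro mult_right_mono) (auto simp: X_def intro!: power_mono)
  finally have 2: "norm (taylor_rem 2 k (- s)) \<le> X ^ 3 * P" .
  have "norm (taylor_rem 1 k (- s - 1)) \<le> (norm (- s - 1) + real (Suc 1)) ^ Suc 1 * real (Suc k) powr (Re (- s - 1) - real (Suc 1))"
    using s by (intro taylor_rem_bound) auto
  also have "Re (- s - 1) - real (Suc 1) = - 2 - 1 - Re s" by simp
  also have "(norm (- s - 1) + real (Suc 1)) ^ Suc 1 * real (Suc k) powr (- 2 - 1 - Re s) \<le> X ^ 2 * P"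
    unfolding P_def[symmetric] using P norm_triangle_ineq4[of "- s" 1]
    unfolding Suc_1 by (intro mult_right_mono power_mono) (auto simp: X_def)
  finally have 3: "norm (taylor_rem 1 k (- s - 1)) \<le> X ^ 2 * P" .
  have "norm (em_term k s) \<le> norm (taylor_rem 3 k (1 - s)) + norm ((s - 1) / 2 * taylor_rem 2 k (- s))
      + norm (s * (s - 1) / 12 * taylor_rem 1 k (- s - 1))"
    unfolding em_term_taylor by (intro order.trans[OF norm_triangle_ineq] add_mono norm_triangle_ineq order.refl)
  also have "norm ((s - 1) / 2 * taylor_rem 2 k (- s)) \<le> X * (X ^ 3 * P)"
    unfolding norm_mult using s1 2 X P by (intro mult_mono) (auto simp: norm_divide)
  also have "norm (s * (s - 1) / 12 * taylor_rem 1 k (- s - 1)) \<le> (X * X) * (X ^ 2 * P)"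
  proof -
    have "norm (s * (s - 1) / 12) \<le> norm s * norm (s - 1)" by (simp add: norm_divide norm_mult)
    also have "\<dots> \<le> X * X" using s1 X by (intro mult_mono) auto
    finally show ?thesis unfolding norm_mult[of "s * (s - 1) / 12"] using 3 X P by (intro mult_mono) auto
  qed
  also have "norm (taylor_rem 3 k (1 - s)) + X * (X ^ 3 * P) + X * X * (X ^ 2 * P) \<le> 3 * (X ^ 4 * P)"
    using 1 by (simp add: eval_nat_numeral algebra_simps)
  also have "\<dots> \<le> X * (X ^ 4 * P)" using X P by (intro mult_right_mono) auto
  also have "\<dots> = X ^ 5 * P" by (simp add: eval_nat_numeral)
  finally show ?thesis by (simp add: X_def P_def)
qed

text \<open>\<open>V k\<close> is the derivative of \<open>em_tail k\<close> at -1, where the powers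
  have the exponents 2, 1 and 0. It enters as a difference, so the sum over \<open>k\<close>
  telescopes.\<close>

lemma em_term_deriv:
  defines "V \<equiv> \<lambda>k. (let N = of_nat (Suc k); L = of_real (ln (real (Suc k))) in
     - L * N^2 + N / 2 + L * N - 1 / 4 - L / 6) :: complex"
  shows "deriv (em_term k) (- 1) = of_nat (Suc k) + 2 * of_nat (Suc k) * of_real (ln (real (Suc k))) + V (Suc k) - V k"
proof -
  have npow_vals: "npow k 2 = of_nat (Suc k) ^ 2" "npow k 1 = of_nat (Suc k)" "npow k 0 = 1" for k
    using npow_of_nat[of k 2] npow_of_nat[of k 1] npow_of_nat[of k 0] by (simp_all only: of_nat_numeral of_nat_1 of_nat_0 power_one_right power_0)
  have t: "(em_tail k has_field_derivative V k) (at (- 1))" for k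
  proof -
    let ?L = "of_real (ln (real (Suc k))) :: complex"
    have "(em_tail k has_field_derivative (?L * npow k (1 - (-1)) * (- 1)
       + (1 / 2 * npow k (- (-1)) + ((-1) - 1) / 2 * (?L * npow k (- (-1)) * (- 1)))
       + ((2 * (-1) - 1) / 12 * npow k (- (-1) - 1) + (-1) * ((-1) - 1) / 12 * (?L * npow k (- (-1) - 1) * (- 1))))) (at (- 1))"
      unfolding em_tail_def[abs_def] by (auto intro!: derivative_eq_intros npow_deriv simp: field_simps)
    then show ?thesis
      by (rule DERIV_cong) (use npow_vals[of k] in \<open>simp add: V_def Let_def power2_eq_square del: of_nat_Suc\<close>)
  qed
  have "((\<lambda>s. (s - 1) * npow k (- s)) has_field_derivative
     (npow k (- (-1)) + ((-1) - 1) * (of_real (ln (real (Suc k))) * npow k (- (-1)) * (- 1)))) (at (- 1))"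
    by (auto intro!: derivative_eq_intros npow_deriv)
  then have "((\<lambda>s. (s - 1) * npow k (- s)) has_field_derivative
     (of_nat (Suc k) + 2 * of_nat (Suc k) * of_real (ln (real (Suc k))))) (at (- 1))"
    by (rule DERIV_cong) (simp add: npow_vals del: of_nat_Suc)
  from DERIV_diff[OF DERIV_add[OF this t[of "Suc k"]] t[of k]]
  show ?thesis unfolding em_term_def[abs_def] by (rule DERIV_imp_deriv)
qed

lemma em_term_sum: "(\<Sum>k<n. em_term k s) = (\<Sum>k<n. (s - 1) * npow k (- s)) + em_tail n s - em_tail 0 s"
  by (induction n) (simp_all add: em_term_def)

text \<open>The limit that defines the Glaisher-Kinkelin constant, whose logarithm is 1/12 -
  zeta'(-1). On Re s > 1 the Euler-Maclaurin tail vanishes in the limit; analytic continuation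
  carries the resulting identity to -1, where the series may be differentiated termwise.\<close>

lemma deriv_riemann_zeta_limit:
  "(\<lambda>n. - (\<Sum>k<n. real (Suc k) * ln (real (Suc k))) + real (Suc n)^2 * ln (real (Suc n)) / 2 - real (Suc n)^2 / 4
      - real (Suc n) * ln (real (Suc n)) / 2 + ln (real (Suc n)) / 12 + 1 / 12) \<longlonglongrightarrow> Re (deriv riemann_zeta (- 1))"
proof (rule zeta_numerator_entire)
  fix A assume A: "A holomorphic_on UNIV" "\<And>s. 1 < Re s \<Longrightarrow> (\<lambda>k. (s - 1) * npow k (- s)) sums A s"
  define U where "U = {s :: complex. - 2 < Re s}"
  have oU: "open U" unfolding U_def by (rule open_halfplane)
  have hol: "em_term k holomorphic_on U" for k
    unfolding em_term_taylor[abs_def] by (intro holomorphic_intros) auto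
  have bd: "\<exists>d h. 0 < d \<and> summable h \<and> (\<forall>k. \<forall>y\<in>ball x d \<inter> U. norm (em_term k y) \<le> h k)" if "x \<in> U" for x
    unfolding U_def by (rule halfplane_bound[OF em_term_bound]) (use that in \<open>auto simp: U_def\<close>)
  show ?thesis
  proof (rule holomorphic_series[OF oU hol bd])
    fix G assume G: "G holomorphic_on U" "\<And>x. x \<in> U \<Longrightarrow> (\<lambda>k. em_term k x) sums G x"
      "\<And>x. x \<in> U \<Longrightarrow> (\<lambda>k. deriv (em_term k) x) sums deriv G x"
    have tail0: "em_tail 0 s = 1 + (s - 1) / 2 + s * (s - 1) / 12" for s by (simp add: em_tail_def npow_def)
    have GA: "G s = A s - em_tail 0 s" if s: "1 < Re s" for s
    proof -
      have "em_tail n s = npow n (1 - s) + (s - 1) / 2 * npow n (- s) + s * (s - 1) / 12 * npow n (- s - 1)" for n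
        by (simp add: em_tail_def)
      moreover have "(\<lambda>n. npow n (1 - s) + (s - 1) / 2 * npow n (- s) + s * (s - 1) / 12 * npow n (- s - 1))
         \<longlonglongrightarrow> 0 + (s - 1) / 2 * 0 + s * (s - 1) / 12 * 0"
        using s by (intro tendsto_intros npow_tendsto_0) auto
      ultimately have "(\<lambda>n. em_tail n s) \<longlonglongrightarrow> 0" by simp
      moreover have "(\<lambda>n. \<Sum>k<n. (s - 1) * npow k (- s)) \<longlonglongrightarrow> A s" using A(2)[OF s] by (simp add: sums_def)
      ultimately have "(\<lambda>n. (\<Sum>k<n. (s - 1) * npow k (- s)) + em_tail n s - em_tail 0 s) \<longlonglongrightarrow> A s + 0 - em_tail 0 s"
        by (intro tendsto_intros)
      moreover have "(\<lambda>n. \<Sum>k<n. em_term k s) \<longlonglongrightarrow> G s" using G(2)[of s] s by (simp add: sums_def U_def)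
      ultimately show ?thesis unfolding em_term_sum using LIMSEQ_unique by fastforce
    qed
    have AG: "A s = G s + (1 + (s - 1) / 2 + s * (s - 1) / 12)" if s: "s \<in> U" for s
    proof (rule analytic_continuation_open[of "{s. 1 < Re s}" U A "\<lambda>s. G s + (1 + (s - 1) / 2 + s * (s - 1) / 12)"])
      show "open {s. 1 < Re s}" by (rule open_halfplane)
      show "{s. 1 < Re s} \<noteq> {}" by (auto intro!: exI[of _ "2 :: complex"])
      show "connected U" unfolding U_def by (intro convex_connected convex_halfspace_Re_gt)
      show "A holomorphic_on U" by (rule holomorphic_on_subset[OF A(1)]) simp
      show "(\<lambda>s. G s + (1 + (s - 1) / 2 + s * (s - 1) / 12)) holomorphic_on U" by (intro holomorphic_intros G) auto
      show "A z = G z + (1 + (z - 1) / 2 + z * (z - 1) / 12)" if "z \<in> {s. 1 < Re s}" for z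
        using GA[of z] that by (simp add: tail0)
    qed (use oU s in \<open>auto simp: U_def\<close>)
    have m1: "- 1 \<in> U" by (simp add: U_def)
    have npow_vals: "npow k 2 = of_nat (Suc k) ^ 2" "npow k 1 = of_nat (Suc k)" "npow k 0 = 1" for k
      using npow_of_nat[of k 2] npow_of_nat[of k 1] npow_of_nat[of k 0] by simp_all
    \<comment> \<open>At -1 the summand is a linear function of k + 1 and the Euler-Maclaurin
      formula is exact, so every term vanishes. This yields A(-1) = 1/6, that is, zeta(-1) =
      -1/12.\<close>
    have part: "(\<Sum>k<n. em_term k (- 1)) = 0" for n
    proof -
      have "em_term k (- 1) = 0" for k
        by (simp add: em_term_def em_tail_def npow_vals power2_eq_square algebra_simps)
      then show ?thesis by simp
    qed
    then have "G (- 1) = 0" using G(2)[OF m1] by (simp add: sums_def LIMSEQ_const_iff)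
    then have A1: "A (- 1) = 1 / 6" using AG[OF m1] by simp
    have dA: "(A has_field_derivative deriv A (- 1)) (at (- 1))"
      using A(1) by (intro holomorphic_derivI[of _ UNIV]) auto
    have "(G has_field_derivative deriv G (- 1)) (at (- 1))" by (rule holomorphic_derivI[OF G(1) oU m1])
    then have "((\<lambda>s. G s + (1 + (s - 1) / 2 + s * (s - 1) / 12)) has_field_derivative deriv G (- 1) + 1 / 4) (at (- 1))"
      by (auto intro!: derivative_eq_intros)
    then have "(A has_field_derivative deriv G (- 1) + 1 / 4) (at (- 1))"
      by (rule has_field_derivative_transform_within_open[OF _ oU m1]) (simp add: AG)
    then have dAG: "deriv A (- 1) = deriv G (- 1) + 1 / 4" by (rule DERIV_imp_deriv)
    have zA: "riemann_zeta s = A s / (s - 1)" if "s \<noteq> 1" for s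
    proof (rule is_riemann_zeta_unique[OF is_riemann_zeta_riemann_zeta _ that])
      show "is_riemann_zeta (\<lambda>s. A s / (s - 1))"
        unfolding is_riemann_zeta_def
      proof (intro conjI allI impI)
        show "(\<lambda>s. A s / (s - 1)) holomorphic_on - {1}"
          by (intro holomorphic_intros holomorphic_on_subset[OF A(1)]) auto
        fix s :: complex assume s: "1 < Re s"
        then have "s - 1 \<noteq> 0" by auto
        then have "(s - 1) * npow n (- s) / (s - 1) = 1 / of_nat (Suc n) powr s" for n
          by (simp add: npow_def powr_minus divide_inverse)
        then show "(\<lambda>n. 1 / of_nat (Suc n) powr s) sums (A s / (s - 1))"
          using sums_divide[OF A(2)[OF s], of "s - 1"] by simp
      qed
    qed
    have "((\<lambda>s. A s / (s - 1)) has_field_derivative (deriv A (- 1) * (- 1 - 1) - A (- 1) * 1) / ((- 1 - 1) * (- 1 - 1))) (at (- 1))"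
      by (rule DERIV_cong, rule DERIV_divide[OF dA DERIV_diff[OF DERIV_ident DERIV_const]]) auto
    then have "(riemann_zeta has_field_derivative (deriv A (- 1) * (- 1 - 1) - A (- 1) * 1) / ((- 1 - 1) * (- 1 - 1))) (at (- 1))"
      by (rule has_field_derivative_transform_within_open[where S = "- {1}"]) (auto simp: zA)
    \<comment> \<open>By the quotient rule the constant is -(1/4) / 2 - (1/6) / 4 = -1/6.\<close>
    then have dz: "deriv riemann_zeta (- 1) = - deriv G (- 1) / 2 - 1 / 6"
      unfolding A1 dAG by (simp add: DERIV_imp_deriv field_simps)
    define V :: "nat \<Rightarrow> real" where "V k = (let N = real (Suc k); L = ln (real (Suc k)) in
     - L * N^2 + N / 2 + L * N - 1 / 4 - L / 6)" for k
    have dt: "deriv (em_term k) (- 1) = of_real (real (Suc k) + 2 * real (Suc k) * ln (real (Suc k)) + V (Suc k) - V k)" for k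
      unfolding em_term_deriv by (simp add: V_def Let_def del: of_nat_Suc)
    have "(\<Sum>k<n. real (Suc k) + 2 * real (Suc k) * ln (real (Suc k)) + V (Suc k) - V k)
        = real n * real (Suc n) / 2 + 2 * (\<Sum>k<n. real (Suc k) * ln (real (Suc k))) + V n - V 0" for n
      by (induction n) (simp_all add: field_simps)
    moreover have "(\<lambda>n. Re (\<Sum>k<n. deriv (em_term k) (- 1))) \<longlonglongrightarrow> Re (deriv G (- 1))"
      using G(3)[OF m1] unfolding sums_def by (rule tendsto_Re)
    ultimately have lim: "(\<lambda>n. real n * real (Suc n) / 2 + 2 * (\<Sum>k<n. real (Suc k) * ln (real (Suc k))) + V n - V 0)
        \<longlonglongrightarrow> Re (deriv G (- 1))"
      unfolding dt by (simp del: of_nat_Suc flip: of_real_sum)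
    have "(\<lambda>n. - (real n * real (Suc n) / 2 + 2 * (\<Sum>k<n. real (Suc k) * ln (real (Suc k))) + V n - V 0) / 2 - 1 / 6)
        \<longlonglongrightarrow> - Re (deriv G (- 1)) / 2 - 1 / 6"
      by (intro tendsto_intros lim) auto
    moreover have "- (real n * real (Suc n) / 2 + 2 * (\<Sum>k<n. real (Suc k) * ln (real (Suc k))) + V n - V 0) / 2 - 1 / 6
       = - (\<Sum>k<n. real (Suc k) * ln (real (Suc k))) + real (Suc n)^2 * ln (real (Suc n)) / 2 - real (Suc n)^2 / 4
      - real (Suc n) * ln (real (Suc n)) / 2 + ln (real (Suc n)) / 12 + 1 / 12" for n
      unfolding V_def Let_def by (simp add: power2_eq_square field_simps)
    ultimately show ?thesis by (simp add: dz)
  qed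
qed

section \<open>Stirling's formula with its first correction, and the Barnes constant\<close>

definition stirling :: "nat \<Rightarrow> real" where
  "stirling n = ln (fact n) - (real n + 1 / 2) * ln (real n) + real n"

text \<open>Wallis' product in terms of factorials, so that its limit can identify the constant in
  Stirling's formula.\<close>

lemma wallis_partial: "(\<Prod>k=1..n. (4 * real k ^ 2) / (4 * real k ^ 2 - 1)) = 16 ^ n * fact n ^ 4 / (fact (2 * n) ^ 2 * (2 * real n + 1))"
proof (induction n)
  case (Suc n)
  have "4 * real (Suc n) ^ 2 - 1 = (2 * real n + 1) * (2 * real n + 3)" by (simp add: power2_eq_square algebra_simps)
  moreover have "fact (2 * Suc n) = fact (2 * n) * (2 * real n + 1) * (2 * real (Suc n))"
    by (simp add: algebra_simps)
  moreover have "fact (Suc n) = fact n * real (Suc n)" by simp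
  ultimately have "(\<Prod>k=1..Suc n. (4 * real k ^ 2) / (4 * real k ^ 2 - 1))
     = 16 ^ n * fact n ^ 4 / (fact (2 * n) ^ 2 * (2 * real n + 1)) * (4 * real (Suc n) ^ 2 / ((2 * real n + 1) * (2 * real n + 3)))"
    using Suc.IH by simp
  also have "\<dots> = 16 ^ Suc n * (fact n * real (Suc n)) ^ 4
      / ((fact (2 * n) * (2 * real n + 1) * (2 * real (Suc n))) ^ 2 * (2 * real (Suc n) + 1))"
  proof -
    have "(16 ^ n * f / (g ^ 2 * a)) * (4 * N ^ 2 / (a * b)) = 16 ^ Suc n * (f * N ^ 4) / ((g * a * (2 * N)) ^ 2 * b)"
      if "N > 0" for f g a b N :: real
      using that by (simp add: field_simps power2_eq_square eval_nat_numeral)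
    moreover have "2 * real (Suc n) + 1 = 2 * real n + 3" by simp
    ultimately show ?thesis unfolding power_mult_distrib[of "fact n" "real (Suc n)" 4] by (simp only:)
  qed
  also have "\<dots> = 16 ^ Suc n * fact (Suc n) ^ 4 / (fact (2 * Suc n) ^ 2 * (2 * real (Suc n) + 1))"
    using \<open>fact (2 * Suc n) = _\<close> \<open>fact (Suc n) = _\<close> by (simp only:)
  finally show ?case .
qed simp

text \<open>The term 1 / (12 n) is required because the Barnes asymptotics multiply Stirling's error
  by \<open>n\<close>. The constant \<open>c\<close> comes from Wallis' product, in which the terms
  of order n ln n and n cancel between n and 2 n.\<close>

lemma stirling_limit: "(\<lambda>n. real n * (stirling n - ln (2 * pi) / 2)) \<longlonglongrightarrow> 1 / 12"
proof -
  \<comment> \<open>Subtracting 1 / (12 n) makes the increments O(n^-3), so convergence is of order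
    n^-2 and survives multiplication by \<open>n\<close>.\<close>
  define \<tau> where "\<tau> n = stirling n - 1 / (12 * real n)" for n
  define g where "g x = 1 - (x + 1 / 2) * ln (1 + 1 / x) + 1 / (12 * x * (x + 1))" for x :: real
  have g: "(\<lambda>x. g x) \<in> O(\<lambda>x. 1 / x ^ 3)" unfolding g_def by real_asymp
  have diff: "\<tau> (Suc n) - \<tau> n = g (real n)" if n: "n \<ge> 1" for n
  proof -
    have "1 + 1 / real n = real (Suc n) / real n" using n by (simp add: field_simps)
    then have l: "ln (real (Suc n)) = ln (real n) + ln (1 + 1 / real n)"
      using n by (simp add: ln_div del: of_nat_Suc)
    have f: "ln (fact (Suc n) :: real) = ln (real (Suc n)) + ln (fact n)"
      by (simp add: ln_mult del: of_nat_Suc)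
    have q: "1 / (12 * real n * (real n + 1)) = 1 / (12 * real n) - 1 / (12 * real (Suc n))"
      using n by (simp add: field_simps)
    show ?thesis unfolding \<tau>_def stirling_def g_def f l q by (simp add: algebra_simps)
  qed
  obtain C where C: "C > 0" "eventually (\<lambda>x. norm (g x) \<le> C * norm (1 / x ^ 3)) at_top"
    using landau_o.bigE[OF g] by metis
  obtain N where N: "\<And>n. n \<ge> N \<Longrightarrow> norm (g (real n)) \<le> C * norm (1 / real n ^ 3)"
    using eventually_compose_filterlim[OF C(2) filterlim_real_sequentially] unfolding eventually_sequentially by blast
  have "\<exists>c. \<forall>k\<ge>N + 2. \<bar>\<tau> k - c\<bar> \<le> C / (real k - 1) ^ 2"
  proof (rule summable_differences_limit)
    show "\<bar>\<tau> (Suc k) - \<tau> k\<bar> \<le> C / real k ^ Suc 2" if "N + 2 \<le> k" for k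
      using N[of k] diff[of k] that by (simp add: eval_nat_numeral)
  qed (use C in auto)
  then obtain c where c: "\<And>k. k \<ge> N + 2 \<Longrightarrow> \<bar>\<tau> k - c\<bar> \<le> C / (real k - 1) ^ 2" by blast
  have lim: "(\<lambda>n. real n * (stirling n - c)) \<longlonglongrightarrow> 1 / 12"
  proof -
    have "(\<lambda>n. real n * (\<tau> n - c)) \<longlonglongrightarrow> 0"
    proof (rule tendsto_0_le[where K = 1])
      show "(\<lambda>n. real n * (C / (real n - 1) ^ 2)) \<longlonglongrightarrow> 0" by real_asymp
      show "\<forall>\<^sub>F n in sequentially. norm (real n * (\<tau> n - c)) \<le> norm (real n * (C / (real n - 1) ^ 2)) * 1"
        using eventually_ge_at_top[of "N + 2"]
      proof eventually_elim
        case (elim n)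
        have "\<bar>real n\<bar> * \<bar>\<tau> n - c\<bar> \<le> \<bar>real n\<bar> * (C / (real n - 1) ^ 2)"
          using c[OF elim] by (intro mult_left_mono) auto
        then show ?case using C(1) by (simp add: abs_mult)
      qed
    qed
    then have "(\<lambda>n. real n * (\<tau> n - c) + 1 / 12) \<longlonglongrightarrow> 0 + 1 / 12" by (intro tendsto_intros)
    then have "(\<lambda>n. real n * (\<tau> n - c) + 1 / 12) \<longlonglongrightarrow> 1 / 12" by simp
    then show ?thesis
    proof (rule Lim_transform_eventually)
      show "\<forall>\<^sub>F n in sequentially. real n * (\<tau> n - c) + 1 / 12 = real n * (stirling n - c)"
        using eventually_gt_at_top[of 0] by eventually_elim (simp add: \<tau>_def field_simps)
    qed
  qed
  have st: "stirling \<longlonglongrightarrow> c"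
  proof -
    have "(\<lambda>n. inverse (real n) * (real n * (stirling n - c)) + c) \<longlonglongrightarrow> 0 * (1 / 12) + c"
      by (intro tendsto_intros lim LIMSEQ_inverse_real_of_nat) (rule lim_inverse_n)
    then have "(\<lambda>n. inverse (real n) * (real n * (stirling n - c)) + c) \<longlonglongrightarrow> c" by simp
    then show ?thesis
    proof (rule Lim_transform_eventually)
      show "\<forall>\<^sub>F n in sequentially. inverse (real n) * (real n * (stirling n - c)) + c = stirling n"
        using eventually_gt_at_top[of 0] by eventually_elim (simp add: field_simps)
    qed
  qed
  have W: "ln (\<Prod>k=1..n. (4 * real k ^ 2) / (4 * real k ^ 2 - 1)) = 4 * stirling n - 2 * stirling (2 * n)
      + (ln (real n) - ln 2 - ln (2 * real n + 1))" if n: "n \<ge> 1" for n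
  proof -
    have "ln (16 ^ n * fact n ^ 4 / (fact (2 * n) ^ 2 * (2 * real n + 1)) :: real)
       = real n * ln 16 + 4 * ln (fact n) - (2 * ln (fact (2 * n)) + ln (2 * real n + 1))"
      by (simp add: ln_div ln_mult ln_realpow)
    moreover have "ln (16 :: real) = 4 * ln 2" using ln_realpow[of "2 :: real" 4] by simp
    moreover have "ln (real (2 * n)) = ln 2 + ln (real n)" using n by (simp add: ln_mult)
    ultimately show ?thesis unfolding wallis_partial stirling_def by (simp add: algebra_simps)
  qed
  have "(\<lambda>n. stirling (2 * n)) \<longlonglongrightarrow> c"
    using LIMSEQ_subseq_LIMSEQ[OF st, of "\<lambda>n. 2 * n"] by (simp add: strict_mono_def o_def)
  moreover have "(\<lambda>n. ln (real n) - ln 2 - ln (2 * real n + 1)) \<longlonglongrightarrow> - (2 * ln 2)"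
    by real_asymp
  ultimately have "(\<lambda>n. 4 * stirling n - 2 * stirling (2 * n) + (ln (real n) - ln 2 - ln (2 * real n + 1)))
      \<longlonglongrightarrow> 4 * c - 2 * c + - (2 * ln 2)"
    by (intro tendsto_intros st)
  then have "(\<lambda>n. ln (\<Prod>k=1..n. (4 * real k ^ 2) / (4 * real k ^ 2 - 1))) \<longlonglongrightarrow> 4 * c - 2 * c + - (2 * ln 2)"
  proof (rule Lim_transform_eventually)
    show "\<forall>\<^sub>F n in sequentially. 4 * stirling n - 2 * stirling (2 * n) + (ln (real n) - ln 2 - ln (2 * real n + 1))
       = ln (\<Prod>k=1..n. (4 * real k ^ 2) / (4 * real k ^ 2 - 1))"
      using eventually_ge_at_top[of 1] by eventually_elim (simp only: W)
  qed
  moreover have "(\<lambda>n. ln (\<Prod>k=1..n. (4 * real k ^ 2) / (4 * real k ^ 2 - 1))) \<longlonglongrightarrow> ln (pi / 2)"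
    by (intro tendsto_ln wallis) simp
  ultimately have "4 * c - 2 * c + - (2 * ln 2) = ln (pi / 2)" by (rule LIMSEQ_unique)
  then have c_eq: "c = ln (2 * pi) / 2" by (simp add: ln_div ln_mult)
  show ?thesis using lim unfolding c_eq .
qed

text \<open>Summation by parts, which reduces the product of factorials to the sum of k ln k known
  from \<open>deriv_riemann_zeta_limit\<close>.\<close>

lemma sum_ln_fact: "(\<Sum>j<Suc n. ln (fact j)) = real (Suc n) * ln (fact n) - (\<Sum>k<n. real (Suc k) * ln (real (Suc k)))"
proof (induction n)
  case (Suc n)
  have "ln (fact (Suc n)) = ln (real (Suc n)) + ln (fact n)" by (simp add: ln_mult del: of_nat_Suc)
  with Suc.IH show ?case by (simp add: algebra_simps)
qed simp

text \<open>The 1/12 from Stirling's correction cancels the 1/12 in the zeta limit, and the term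
  with 1/240 vanishes; the constant is exactly zeta'(-1).\<close>

lemma barnes_error_tendsto: "barnes_error \<longlonglongrightarrow> Re (deriv riemann_zeta (- 1))"
proof -
  define h where "h n = - (\<Sum>k<n. real (Suc k) * ln (real (Suc k))) + real (Suc n)^2 * ln (real (Suc n)) / 2 - real (Suc n)^2 / 4
      - real (Suc n) * ln (real (Suc n)) / 2 + ln (real (Suc n)) / 12 + 1 / 12" for n
  have h: "h \<longlonglongrightarrow> Re (deriv riemann_zeta (- 1))" unfolding h_def[abs_def] by (rule deriv_riemann_zeta_limit)
  have eq: "barnes_error (Suc n) = h n + real (Suc n) * (stirling (Suc n) - ln (2 * pi) / 2) - 1 / 12 + 1 / (240 * real (Suc n) ^ 2)" for n
  proof -
    have "ln (fact (Suc n)) = ln (real (Suc n)) + ln (fact n)" by (simp add: ln_mult del: of_nat_Suc)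
    then show ?thesis unfolding barnes_error_def h_def stirling_def sum_ln_fact
      by (simp add: algebra_simps power2_eq_square del: of_nat_Suc)
  qed
  have "(\<lambda>n. 1 / (240 * real (Suc n) ^ 2)) \<longlonglongrightarrow> 0" by real_asymp
  then have "(\<lambda>n. h n + real (Suc n) * (stirling (Suc n) - ln (2 * pi) / 2) - 1 / 12 + 1 / (240 * real (Suc n) ^ 2))
     \<longlonglongrightarrow> Re (deriv riemann_zeta (- 1)) + 1 / 12 - 1 / 12 + 0"
    by (intro tendsto_intros h LIMSEQ_Suc[OF stirling_limit])
  then have "(\<lambda>n. barnes_error (Suc n)) \<longlonglongrightarrow> Re (deriv riemann_zeta (- 1))" unfolding eq by simp
  then show ?thesis by (rule LIMSEQ_imp_Suc)
qed

theorem theorem2p4: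
  fixes t :: real
  shows "(\<lambda>n :: nat. ln (hankel_det n t) -
     ( (real n)^2 * ln (real n) / 4
     - (3 / 8 + ln 12 / 4) * (real n)^2
     + 2 * real n powr (3 / 2) * t / (3 * sqrt 3)
     + (t^2 / 12 + ln (2 * pi)) * real n
     + real n powr (1 / 2) * t^3 / (36 * sqrt 3)
     - ln (real n) / 12
     + t^4 / 432
     + Re (deriv riemann_zeta (- 1))
     - ln 2 / 12
     + t * (t^4 - 120) / (2880 * sqrt 3 * real n powr (1 / 2))
     - t^2 / (288 * real n)
     - t^3 * (t^4 - 168) / (290304 * sqrt 3 * real n powr (3 / 2))
     + (5 * t^4 - 267) / (34560 * (real n)^2)))
   \<in> O(\<lambda>n. real n powr (- 5 / 2))"
proof -
  \<comment> \<open>The error of \<open>det_approx\<close> is of order n^-4; the exponent -5/2 of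
    the claim stems from expanding \<open>det_approx\<close> for fixed \<open>t\<close>.\<close>
  obtain C N where C: "\<And>n. n \<ge> N \<Longrightarrow> \<bar>det_error t n - Re (deriv riemann_zeta (- 1))\<bar> \<le> C / real n ^ 4"
    by (rule det_error_asymptotics[OF barnes_error_tendsto, of t], rule that)
  have "norm (det_error t n - Re (deriv riemann_zeta (- 1))) \<le> 1 * norm (C / real n ^ 4)" if "n \<ge> N" for n
    using C[OF that] by (simp del: abs_divide)
  then have "(\<lambda>n. det_error t n - Re (deriv riemann_zeta (- 1))) \<in> O(\<lambda>n. C / real n ^ 4)"
    by (intro bigoI[of _ 1] eventually_sequentiallyI[of N])
  also have "(\<lambda>n. C / real n ^ 4) \<in> O(\<lambda>n. real n powr (- 5 / 2))" by real_asymp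
  finally have "(\<lambda>n. det_error t n - Re (deriv riemann_zeta (- 1))) \<in> O(\<lambda>n. real n powr (- 5 / 2))" .
  note * = sum_in_bigo(1)[OF this det_approx_expansion[of t]]
  show ?thesis
    by (rule subst[where P = "\<lambda>f. f \<in> O(\<lambda>n. real n powr (- 5 / 2))", rotated, OF *], rule ext)
      (unfold det_error_def, linarith)
qed

end
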